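(* Let $\Omega\subset\mathbb{C}$ be a Denjoy domain with complement $E=\overline{\mathbb{C}}\setminus\Omega\subset\overline{\mathbb{R}}$, every point of $E$ (including $\infty\in E$) being regular for the Dirichlet problem in $\Omega$. Suppose that $E^*=\mathbb{R}\setminus E=\bigcup_{j=-N}^{M}(c_j,d_j)$, where $M+N=\infty$ (i.e. at least one of $M,N$ is infinite) and the real numbers $c_j,d_j$ satisfy $d_{j-1}<c_j<d_j<c_{j+1}$. If $$\sum_{j=-N}^{M}\left(\frac{d_j-c_j}{|c_j+d_j|+1}\right)^2=\infty,$$ then $\dim\mathcal{P}_\infty=1$, and $\limsup_{\Omega\ni t\to\infty}g_\Omega(t,z)\,|t|=\infty$ for some $z\in\Omega$.
   Context: $\overline{\mathbb{C}}=\mathbb{C}\cup\{\infty\}$, $\overline{\mathbb{R}}=\mathbb{R}\cup\{\infty\}$. A Denjoy domain is an open subset $\Omega$ of $\mathbb{C}$ whose complement $E=\overline{\mathbb{C}}\setminus\Omega$ is a subset of $\overline{\mathbb{R}}$. $g_\Omega(\cdot,z)$ is the Green function of $\Omega$ with pole at $z\in\Omega$. $\mathcal{P}_\infty=\mathcal{P}_\infty(\Omega)$ is the cone of positive harmonic functions on $\Omega$ which have vanishing boundary values at every point of $E\setminus\{\infty\}$. By a known theorem (Ancona, Benedicks), either all functions in $\mathcal{P}_\infty$ are proportional, written $\dim\mathcal{P}_\infty=1$, or $\mathcal{P}_\infty$ is generated by two linearly independent minimal positive harmonic functions, written $\dim\mathcal{P}_\infty=2$. *)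

theory Defs
  imports "HOL-Analysis.Analysis"
begin

section \<open>Harmonic and subharmonic functions on open sets of the plane\<close>

text \<open>\<open>C\<^sup>2\<close> with vanishing Laplacian; meant for open \<open>S\<close> only.  The values of \<open>u\<close> outside
  \<open>S\<close> are irrelevant.\<close>

definition harmonic_on :: "complex set \<Rightarrow> (complex \<Rightarrow> real) \<Rightarrow> bool" where
  "harmonic_on S u \<longleftrightarrow>
    (\<exists>ux uy uxx uxy uyx uyy :: complex \<Rightarrow> real.
      (\<forall>z\<in>S. (u has_derivative (\<lambda>h. ux z * Re h + uy z * Im h)) (at z)
           \<and> (ux has_derivative (\<lambda>h. uxx z * Re h + uxy z * Im h)) (at z)
           \<and> (uy has_derivative (\<lambda>h. uyx z * Re h + uyy z * Im h)) (at z)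
           \<and> uxx z + uyy z = 0)
      \<and> continuous_on S uxx \<and> continuous_on S uxy
      \<and> continuous_on S uyx \<and> continuous_on S uyy)"

text \<open>Upper semicontinuous with values in \<open>[-\<infinity>, \<infinity>)\<close>, and dominated on each closed disc in \<open>S\<close> by
  every harmonic function that dominates it on the bounding circle.  The constant \<open>-\<infinity>\<close> is
  allowed.\<close>

definition subharmonic_on :: "complex set \<Rightarrow> (complex \<Rightarrow> ereal) \<Rightarrow> bool" where
  "subharmonic_on S u \<longleftrightarrow>
     (\<forall>z\<in>S. u z < \<infinity>) \<and>
     (\<forall>z\<in>S. \<forall>y. u z < y \<longrightarrow> eventually (\<lambda>w. u w < y) (at z within S)) \<and>
     (\<forall>a r h. 0 < r \<longrightarrow> cball a r \<subseteq> S \<longrightarrow> continuous_on (cball a r) h \<longrightarrow>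
        harmonic_on (ball a r) h \<longrightarrow> (\<forall>w\<in>sphere a r. u w \<le> ereal (h w)) \<longrightarrow>
        (\<forall>w\<in>ball a r. u w \<le> ereal (h w)))"


section \<open>The Dirichlet problem in the extended plane\<close>

text \<open>The extended plane is the one-point compactification of the plane: \<open>Some z\<close> is the finite
  point \<open>z\<close>, and \<open>None\<close> is the point at infinity.\<close>

abbreviation extended_plane :: "complex option topology" where
  "extended_plane \<equiv> Alexandroff_compactification euclidean"

definition ext_compl :: "complex set \<Rightarrow> complex option set" where
  "ext_compl \<Omega> = - Some ` \<Omega>"

definition ext_boundary :: "complex set \<Rightarrow> complex option set" where
  "ext_boundary \<Omega> = extended_plane frontier_of (Some ` \<Omega>)"

text \<open>The filter of \<open>z \<rightarrow> \<zeta>\<close>, \<open>z \<in> \<Omega>\<close>.\<close>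

definition approach :: "complex set \<Rightarrow> complex option \<Rightarrow> complex filter" where
  "approach \<Omega> \<zeta> =
     (case \<zeta> of None \<Rightarrow> inf at_infinity (principal \<Omega>) | Some a \<Rightarrow> at a within \<Omega>)"

definition perron_class ::
    "complex set \<Rightarrow> (complex option \<Rightarrow> real) \<Rightarrow> (complex \<Rightarrow> ereal) set" where
  "perron_class \<Omega> f =
     {u. subharmonic_on \<Omega> u \<and>
         (\<forall>\<zeta>\<in>ext_boundary \<Omega>. Limsup (approach \<Omega> \<zeta>) u \<le> ereal (f \<zeta>))}"

definition perron_solution :: "complex set \<Rightarrow> (complex option \<Rightarrow> real) \<Rightarrow> complex \<Rightarrow> ereal" where
  "perron_solution \<Omega> f z = (SUP u\<in>perron_class \<Omega> f. u z)"

definition regular_boundary_point :: "complex set \<Rightarrow> complex option \<Rightarrow> bool" where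
  "regular_boundary_point \<Omega> \<zeta> \<longleftrightarrow>
     \<zeta> \<in> ext_boundary \<Omega> \<and>
     (\<forall>f. continuous_map (subtopology extended_plane (ext_boundary \<Omega>)) euclideanreal f \<longrightarrow>
          (perron_solution \<Omega> f \<longlongrightarrow> ereal (f \<zeta>)) (approach \<Omega> \<zeta>))"


section \<open>Denjoy domains, the Green function and the cone of positive harmonic functions\<close>

definition denjoy_domain :: "complex set \<Rightarrow> bool" where
  "denjoy_domain \<Omega> \<longleftrightarrow> open \<Omega> \<and> ext_compl \<Omega> \<subseteq> insert None (Some ` \<real>)"

text \<open>The Green function with pole \<open>z\<close> is the least nonnegative harmonic function on
  \<open>\<Omega> - {z}\<close> with singularity \<open>- ln \<bar>t - z\<bar>\<close> at \<open>z\<close>.  It is determined only on \<open>\<Omega> - {z}\<close>.\<close>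

definition green_candidate :: "complex set \<Rightarrow> complex \<Rightarrow> (complex \<Rightarrow> real) \<Rightarrow> bool" where
  "green_candidate \<Omega> z u \<longleftrightarrow>
     (\<forall>t\<in>\<Omega> - {z}. 0 \<le> u t) \<and>
     (\<exists>h. harmonic_on \<Omega> h \<and> (\<forall>t\<in>\<Omega> - {z}. u t = h t - ln (cmod (t - z))))"

definition is_green_function :: "complex set \<Rightarrow> complex \<Rightarrow> (complex \<Rightarrow> real) \<Rightarrow> bool" where
  "is_green_function \<Omega> z g \<longleftrightarrow>
     green_candidate \<Omega> z g \<and>
     (\<forall>u. green_candidate \<Omega> z u \<longrightarrow> (\<forall>t\<in>\<Omega> - {z}. g t \<le> u t))"

definition P_infinity :: "complex set \<Rightarrow> (complex \<Rightarrow> real) set" where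
  "P_infinity \<Omega> =
     {u. harmonic_on \<Omega> u \<and> (\<forall>z\<in>\<Omega>. 0 < u z) \<and>
         (\<forall>\<zeta>\<in>ext_compl \<Omega> - {None}. (u \<longlongrightarrow> 0) (approach \<Omega> \<zeta>))}"

text \<open>Proportionality is only required on \<open>\<Omega>\<close>, since members of the cone have arbitrary values
  elsewhere.\<close>

definition dim_P_infinity_eq_1 :: "complex set \<Rightarrow> bool" where
  "dim_P_infinity_eq_1 \<Omega> \<longleftrightarrow>
     P_infinity \<Omega> \<noteq> {} \<and>
     (\<forall>u\<in>P_infinity \<Omega>. \<forall>v\<in>P_infinity \<Omega>. \<exists>k::real. \<forall>z\<in>\<Omega>. v z = k * u z)"


section \<open>Index sets\<close>

text \<open>The integers \<open>j\<close> with \<open>- N \<le> j \<le> M\<close>, where \<open>M\<close> and \<open>N\<close> may be infinite.  The function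
  \<open>nat\<close> truncates negative integers to \<open>0\<close>, so each conjunct constrains only one sign of \<open>j\<close>.\<close>

definition index_range :: "enat \<Rightarrow> enat \<Rightarrow> int set" where
  "index_range N M = {j. enat (nat (- j)) \<le> N \<and> enat (nat j) \<le> M}"

end

theory Submission
  imports Defs "HOL-Complex_Analysis.Complex_Analysis"
begin

text \<open>
  Here \<open>\<Omega>\<close> is the plane minus a closed subset of the real axis, and the intervals in which it
  meets the axis are called gaps.

  The cone is one-dimensional for two reasons.  First, positive harmonic functions that vanish on
  the slits and are symmetric in the real axis are always proportional (\<open>sym_cone_proportional\<close>).
  This rests on a boundary Harnack principle (\<open>boundary_harnack\<close>).  By Harnack's inequality a
  symmetric \<open>U\<close> is comparable with \<open>U(8iR)\<close> at height about \<open>R\<close> and at least a multiple of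
  \<open>\<bar>y\<bar> U(8iR) / R\<close> in a disc of radius \<open>R\<close>; a comparison in a square standing on a vertex
  (\<open>diamond_bound\<close>) gives \<open>U \<le> K U(8iR)\<close> up to the slits.  For two such functions \<open>U\<close>, \<open>V\<close> a
  combination \<open>q U - A V - B ((x - x0)\<^sup>2 - y\<^sup>2)\<close> is then nonpositive on a circle around \<open>x0\<close> and on
  the slits, and the maximum principle compares \<open>U\<close> with \<open>V\<close> above and below \<open>x0\<close>, at every scale
  with the same constant.

  Second, if the sum diverges then every \<open>u\<close> in the cone is symmetric (\<open>P_infinity_sym_cone\<close>).  Its
  odd part \<open>u(z) - u(cnj z)\<close> is harmonic in the whole plane and grows at most linearly, so it is
  \<open>k Im z\<close> (\<open>odd_part_linear\<close>).  If, say, \<open>k > 0\<close>, then \<open>u \<ge> k Im z\<close> in the upper half-plane, so \<open>u\<close> is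
  at least a multiple of \<open>d - c\<close> in the middle half of each gap \<open>(c, d)\<close>.  The Poisson integral of
  these values at \<open>\<i>\<close> is at most \<open>u(\<i>)\<close>, and it is comparable with the sum, which is therefore finite
  (\<open>linear_minorant_sum\<close>).

  The statement on the Green function \<open>g\<close> with pole \<open>\<i>\<close> has the same proof.  In the upper half-plane
  \<open>g\<close> dominates the Green function of the half-plane, which is at least \<open>2 Im z / (\<bar>z\<bar> + 1)\<^sup>2\<close>.  So \<open>g\<close>
  is at least a multiple of \<open>(d - c) / (\<bar>c + d\<bar> + 1)\<^sup>2\<close> in the middle of a gap.  If \<open>g(t) \<bar>t\<bar>\<close> were
  bounded near infinity, then \<open>y g(iy)\<close> would bound the integral of \<open>g\<close> over the gaps, and again the
  sum would be finite (\<open>green_decay_sum\<close>).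

  Existence, both of an element of the cone and of the Green function, comes from least harmonic
  majorants (\<open>least_harmonic_majorant\<close>): of \<open>\<bar>Im z\<bar>\<close> in domains that exhaust \<open>\<Omega>\<close>, followed by a
  compactness argument (\<open>sym_cone_exists\<close>), and of \<open>ln \<bar>t - \<i>\<bar>\<close> (\<open>green_function_exists\<close>).  Boundary
  values are controlled by an explicit barrier, because every complementary point is the end of an
  interval of complementary points.  Harmonic functions are handled through the local mean value
  property \<open>mvp\<close>, which is equivalent by the Poisson integral formula (\<open>harmonic_on_iff_mvp\<close>).
\<close>

section \<open>Circle means and the maximum principle\<close>

definition circ :: "complex \<Rightarrow> real \<Rightarrow> real \<Rightarrow> complex" where
  "circ a r t = a + of_real r * cis (2 * pi * t)"

definition circ_mean :: "(complex \<Rightarrow> real) \<Rightarrow> complex \<Rightarrow> real \<Rightarrow> real" where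
  "circ_mean u a r = integral {0..1} (\<lambda>t. u (circ a r t))"

text \<open>Only small circles are required, depending on the centre.  For continuous functions this
  already implies the maximum principle, and it is preserved when a function is increased away
  from the point.\<close>

definition submean :: "(complex \<Rightarrow> real) \<Rightarrow> complex \<Rightarrow> bool" where
  "submean u a \<longleftrightarrow> (\<exists>r0>0. \<forall>r. 0 < r \<longrightarrow> r < r0 \<longrightarrow> u a \<le> circ_mean u a r)"

definition mean_at :: "(complex \<Rightarrow> real) \<Rightarrow> complex \<Rightarrow> bool" where
  "mean_at u a \<longleftrightarrow> (\<exists>r0>0. \<forall>r. 0 < r \<longrightarrow> r < r0 \<longrightarrow> u a = circ_mean u a r)"

definition mvp :: "complex set \<Rightarrow> (complex \<Rightarrow> real) \<Rightarrow> bool" where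
  "mvp S u \<longleftrightarrow> continuous_on S u \<and> (\<forall>a\<in>S. mean_at u a)"

lemma continuous_on_circ [continuous_intros]: "continuous_on T (circ a r)"
  unfolding circ_def by (intro continuous_intros)

lemma dist_circ [simp]: "dist a (circ a r t) = \<bar>r\<bar>"
  by (simp add: circ_def dist_norm norm_mult)

lemma circ_in_sphere: "0 \<le> r \<Longrightarrow> circ a r t \<in> sphere a r"
  by simp

lemma cis_surj:
  assumes "cmod w = 1"
  obtains t where "t \<in> {0..1}" "cis (2 * pi * t) = w"
proof
  show "Arg2pi w / (2 * pi) \<in> {0..1}"
    using Arg2pi_ge_0[of w] Arg2pi_lt_2pi[of w] by (auto simp: field_simps)
  show "cis (2 * pi * (Arg2pi w / (2 * pi))) = w"
    using Arg2pi_eq[of w] assms by (simp add: cis_conv_exp mult.commute)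
qed

lemma continuous_on_compose_circ:
  assumes "continuous_on S u" "sphere a r \<subseteq> S" "0 \<le> r"
  shows "continuous_on T (\<lambda>t. u (circ a r t))"
  using assms circ_in_sphere[of r a]
  by (intro continuous_on_compose2[OF assms(1)] continuous_intros) blast+

lemma integrable_circ:
  fixes u :: "complex \<Rightarrow> real"
  assumes "continuous_on S u" "sphere a r \<subseteq> S" "0 \<le> r"
  shows "(\<lambda>t. u (circ a r t)) integrable_on {0..1::real}"
  by (intro integrable_continuous_real continuous_on_compose_circ[OF assms])

lemma circ_mean_le:
  assumes "continuous_on S u" "continuous_on S v" "sphere a r \<subseteq> S" "0 \<le> r"
    and "\<And>z. z \<in> sphere a r \<Longrightarrow> u z \<le> v z"
  shows "circ_mean u a r \<le> circ_mean v a r"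
  unfolding circ_mean_def
  using assms by (intro integral_le integrable_circ[of S]) auto

lemma circ_mean_add:
  assumes "continuous_on S u" "continuous_on S v" "sphere a r \<subseteq> S" "0 \<le> r"
  shows "circ_mean (\<lambda>z. u z + v z) a r = circ_mean u a r + circ_mean v a r"
  unfolding circ_mean_def
  using assms by (intro integral_add integrable_circ[of S]) auto

lemma circ_mean_cmult: "circ_mean (\<lambda>z. c * u z) a r = c * circ_mean u a r"
  unfolding circ_mean_def by simp

lemma circ_mean_const [simp]: "circ_mean (\<lambda>z. c) a r = c"
  unfolding circ_mean_def by simp

lemma circ_mean_cong:
  assumes "\<And>z. z \<in> sphere a r \<Longrightarrow> u z = v z" "0 \<le> r"
  shows "circ_mean u a r = circ_mean v a r"
  unfolding circ_mean_def using assms by (intro integral_cong) auto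

lemma small_circle:
  assumes "open S" "a \<in> S"
  obtains r1 where "r1 > 0" "\<And>r. 0 < r \<Longrightarrow> r < r1 \<Longrightarrow> cball a r \<subseteq> S"
proof -
  obtain e where "e > 0" "cball a e \<subseteq> S" using assms open_contains_cball by blast
  then show ?thesis by (intro that[of e]) (auto simp: subset_iff)
qed

lemma submean_add:
  assumes "open S" "a \<in> S" "continuous_on S u" "continuous_on S v" "submean u a" "submean v a"
  shows "submean (\<lambda>z. u z + v z) a"
proof -
  obtain r1 where r1: "r1 > 0" "\<And>r. 0 < r \<Longrightarrow> r < r1 \<Longrightarrow> cball a r \<subseteq> S"
    using small_circle[OF assms(1,2)] by blast
  obtain r2 where r2: "r2 > 0" "\<And>r. 0 < r \<Longrightarrow> r < r2 \<Longrightarrow> u a \<le> circ_mean u a r"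
    using assms(5) unfolding submean_def by blast
  obtain r3 where r3: "r3 > 0" "\<And>r. 0 < r \<Longrightarrow> r < r3 \<Longrightarrow> v a \<le> circ_mean v a r"
    using assms(6) unfolding submean_def by blast
  show ?thesis unfolding submean_def
  proof (intro exI[of _ "min r1 (min r2 r3)"] conjI allI impI)
    fix r assume r: "0 < r" "r < min r1 (min r2 r3)"
    have "sphere a r \<subseteq> S" using r1(2)[of r] r by (auto simp: subset_iff)
    then have "circ_mean (\<lambda>z. u z + v z) a r = circ_mean u a r + circ_mean v a r"
      using r by (intro circ_mean_add[OF assms(3,4)]) auto
    then show "u a + v a \<le> circ_mean (\<lambda>z. u z + v z) a r"
      using r2(2)[of r] r3(2)[of r] r by auto
  qed (use r1 r2 r3 in auto)
qed

lemma mean_at_submean: "mean_at u a \<Longrightarrow> submean u a"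
  unfolding mean_at_def submean_def by force

lemma mean_at_cmult: "mean_at u a \<Longrightarrow> mean_at (\<lambda>z. c * u z) a"
  unfolding mean_at_def circ_mean_cmult by metis

lemma mean_at_const [simp]: "mean_at (\<lambda>z. c) a"
  unfolding mean_at_def by (auto intro: exI[of _ 1])

lemma submean_cong:
  assumes "open S" "a \<in> S" "\<And>z. z \<in> S \<Longrightarrow> u z = v z" "submean u a"
  shows "submean v a"
proof -
  obtain r1 where r1: "r1 > 0" "\<And>r. 0 < r \<Longrightarrow> r < r1 \<Longrightarrow> cball a r \<subseteq> S"
    using small_circle[OF assms(1,2)] by blast
  obtain r2 where r2: "r2 > 0" "\<And>r. 0 < r \<Longrightarrow> r < r2 \<Longrightarrow> u a \<le> circ_mean u a r"
    using assms(4) unfolding submean_def by blast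
  show ?thesis unfolding submean_def
  proof (intro exI[of _ "min r1 r2"] conjI allI impI)
    fix r assume r: "0 < r" "r < min r1 r2"
    have "circ_mean u a r = circ_mean v a r"
      using r r1(2)[of r] assms(3) by (intro circ_mean_cong) (auto simp: subset_iff)
    then show "v a \<le> circ_mean v a r" using r2(2)[of r] r assms(2,3) by auto
  qed (use r1 r2 in auto)
qed

text \<open>Reduces statements on the mean value property to the corresponding ones for submeans.\<close>

lemma mean_at_iff: "mean_at u a \<longleftrightarrow> submean u a \<and> submean (\<lambda>z. - u z) a"
proof
  assume "mean_at u a"
  then show "submean u a \<and> submean (\<lambda>z. - u z) a"
    using mean_at_submean mean_at_cmult[of u a "-1"] by auto
next
  assume A: "submean u a \<and> submean (\<lambda>z. - u z) a"
  obtain r2 where r2: "r2 > 0" "\<And>r. 0 < r \<Longrightarrow> r < r2 \<Longrightarrow> u a \<le> circ_mean u a r"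
    using A unfolding submean_def by blast
  obtain r3 where r3: "r3 > 0" "\<And>r. 0 < r \<Longrightarrow> r < r3 \<Longrightarrow> - u a \<le> circ_mean (\<lambda>z. - u z) a r"
    using A unfolding submean_def by blast
  have "circ_mean (\<lambda>z. - u z) a r = - circ_mean u a r" for r
    using circ_mean_cmult[of "-1" u a r] by simp
  with r2 r3 show "mean_at u a" unfolding mean_at_def
    by (intro exI[of _ "min r2 r3"]) (auto intro!: antisym)
qed

lemma mean_at_add:
  assumes "open S" "a \<in> S" "continuous_on S u" "continuous_on S v" "mean_at u a" "mean_at v a"
  shows "mean_at (\<lambda>z. u z + v z) a"
  using submean_add[OF assms(1-4)] submean_add[OF assms(1,2), of "\<lambda>z. - u z" "\<lambda>z. - v z"] assms
  by (auto simp: mean_at_iff intro!: continuous_intros)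

lemma mean_at_cong:
  assumes "open S" "a \<in> S" "\<And>z. z \<in> S \<Longrightarrow> u z = v z" "mean_at u a"
  shows "mean_at v a"
  using assms(4) submean_cong[OF assms(1,2), of u v]
    submean_cong[OF assms(1,2), of "\<lambda>z. - u z" "\<lambda>z. - v z"] assms(3)
  by (auto simp: mean_at_iff)

lemma mvp_add: "open S \<Longrightarrow> mvp S u \<Longrightarrow> mvp S v \<Longrightarrow> mvp S (\<lambda>z. u z + v z)"
  unfolding mvp_def by (auto intro: mean_at_add continuous_intros)

lemma mvp_cmult: "mvp S u \<Longrightarrow> mvp S (\<lambda>z. c * u z)"
  unfolding mvp_def by (auto intro: mean_at_cmult continuous_intros)

lemma mvp_const [simp]: "mvp S (\<lambda>z. c)"
  unfolding mvp_def by auto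

lemma mvp_diff: "open S \<Longrightarrow> mvp S u \<Longrightarrow> mvp S v \<Longrightarrow> mvp S (\<lambda>z. u z - v z)"
  using mvp_add[of S u "\<lambda>z. -1 * v z"] mvp_cmult[of S v "-1"] by simp

lemma mvp_subset: "mvp S u \<Longrightarrow> T \<subseteq> S \<Longrightarrow> mvp T u"
  unfolding mvp_def by (auto intro: continuous_on_subset)

lemma mvp_continuous: "mvp S u \<Longrightarrow> continuous_on S u"
  by (simp add: mvp_def)

lemma mvp_mean_at: "mvp S u \<Longrightarrow> a \<in> S \<Longrightarrow> mean_at u a"
  by (simp add: mvp_def)

lemma mvp_submean: "mvp S u \<Longrightarrow> a \<in> S \<Longrightarrow> submean u a"
  by (simp add: mvp_def mean_at_submean)

lemma mvp_cong:
  assumes "open S" "mvp S u" "\<And>z. z \<in> S \<Longrightarrow> u z = v z"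
  shows "mvp S v"
proof -
  have "continuous_on S v"
    using mvp_continuous[OF assms(2)] assms(3) by (metis continuous_on_cong)
  moreover have "mean_at v a" if "a \<in> S" for a
    using mean_at_cong[OF assms(1) that, of u v] assms(3) mvp_mean_at[OF assms(2) that] by blast
  ultimately show ?thesis unfolding mvp_def by blast
qed

lemma mvp_local:
  assumes "\<And>z. z \<in> S \<Longrightarrow> \<exists>T. open T \<and> z \<in> T \<and> mvp T u" 
  shows "mvp S u"
  unfolding mvp_def
proof (intro conjI ballI)
  show "continuous_on S u"
    using assms mvp_continuous
    by (meson continuous_at_imp_continuous_on continuous_on_eq_continuous_at)
  show "mean_at u a" if "a \<in> S" for a using assms[OF that] mvp_mean_at by blast
qed

lemma submean_max:
  assumes "open S" "a \<in> S" "continuous_on S u" "continuous_on S v"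
    and "u a \<ge> v a \<Longrightarrow> submean u a" "v a \<ge> u a \<Longrightarrow> submean v a"
  shows "submean (\<lambda>z. max (u z) (v z)) a"
proof -
  obtain r1 where r1: "r1 > 0" "\<And>r. 0 < r \<Longrightarrow> r < r1 \<Longrightarrow> cball a r \<subseteq> S"
    using small_circle[OF assms(1,2)] by blast
  have *: "submean (\<lambda>z. max (u z) (v z)) a"
    if w: "submean w a" "continuous_on S w" "\<And>z. w z \<le> max (u z) (v z)" "w a = max (u a) (v a)" for w
  proof -
    obtain r2 where r2: "r2 > 0" "\<And>r. 0 < r \<Longrightarrow> r < r2 \<Longrightarrow> w a \<le> circ_mean w a r"
      using w(1) unfolding submean_def by blast
    show ?thesis unfolding submean_def
    proof (intro exI[of _ "min r1 r2"] conjI allI impI)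
      fix r assume r: "0 < r" "r < min r1 r2"
      have "circ_mean w a r \<le> circ_mean (\<lambda>z. max (u z) (v z)) a r"
        using r r1(2)[of r] w assms
        by (intro circ_mean_le[of S]) (auto simp: subset_iff intro!: continuous_on_max)
      then show "max (u a) (v a) \<le> circ_mean (\<lambda>z. max (u z) (v z)) a r"
        using r2(2)[of r] r w(4) by auto
    qed (use r1 r2 in auto)
  qed
  show ?thesis
  proof (cases "u a \<ge> v a")
    case True
    then show ?thesis using assms by (intro *[of u]) auto
  next
    case False
    then show ?thesis using assms by (intro *[of v]) auto
  qed
qed

text \<open>Among the points where a positive maximum is attained, take one of largest modulus: a small
  circle around it leaves the set of maximum points, so its mean lies below the maximum.  Asking
  that the superlevel sets are compact replaces all boundary conditions, at infinity as well.\<close>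

lemma max_principle:
  assumes U: "open U" and cont: "continuous_on U W"
    and cpt: "\<And>e. e > 0 \<Longrightarrow> compact {z\<in>U. W z \<ge> e}"
    and sub: "\<And>z. z \<in> U \<Longrightarrow> W z > 0 \<Longrightarrow> submean W z"
    and z0: "z0 \<in> U"
  shows "W z0 \<le> 0"
proof (rule ccontr)
  assume "\<not> W z0 \<le> 0"
  then have pos: "W z0 > 0" by simp
  define K where "K = {z\<in>U. W z \<ge> W z0}"
  have K: "compact K" "z0 \<in> K" "K \<subseteq> U"
    using cpt[OF pos] z0 by (auto simp: K_def)
  have contK: "continuous_on K W" using cont K(3) continuous_on_subset by blast
  obtain b where b: "b \<in> K" "\<And>z. z \<in> K \<Longrightarrow> W z \<le> W b"
    using continuous_attains_sup[OF K(1) _ contK] K(2) by blast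
  have bU: "W z \<le> W b" if "z \<in> U" for z
    using b that K(2) unfolding K_def by fastforce
  define K' where "K' = {z\<in>K. W z = W b}"
  have "compact K'"
  proof -
    have "closedin (top_of_set K) {z\<in>K. W z = W b}"
      using continuous_closedin_preimage_constant[OF contK] by simp
    then show ?thesis using K(1) closedin_compact unfolding K'_def by blast
  qed
  moreover have "K' \<noteq> {}" using b(1) unfolding K'_def by blast
  moreover have "continuous_on K' cmod" by (rule continuous_on_norm_id)
  ultimately have "\<exists>a\<in>K'. \<forall>z\<in>K'. cmod z \<le> cmod a" by (rule continuous_attains_sup)
  then obtain a where a: "a \<in> K'" "\<And>z. z \<in> K' \<Longrightarrow> cmod z \<le> cmod a" by blast
  have aU: "a \<in> U" "W a = W b" using a K by (auto simp: K'_def)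
  have "W a > 0" using aU b K pos by fastforce
  then obtain r2 where r2: "r2 > 0" "\<And>r. 0 < r \<Longrightarrow> r < r2 \<Longrightarrow> W a \<le> circ_mean W a r"
    using sub[OF aU(1)] unfolding submean_def by blast
  obtain r1 where r1: "r1 > 0" "\<And>r. 0 < r \<Longrightarrow> r < r1 \<Longrightarrow> cball a r \<subseteq> U"
    using small_circle[OF U aU(1)] by blast
  define r where "r = min r1 r2 / 2"
  have r: "0 < r" "r < r1" "r < r2" using r1 r2 by (auto simp: r_def)
  have sph: "sphere a r \<subseteq> U" using r1(2)[of r] r by (auto simp: subset_iff)
  \<comment> \<open>the point of the circle that lies farthest from the origin\<close>
  define w where "w = (if a = 0 then 1 else sgn a)"
  have "cmod w = 1" by (auto simp: w_def norm_sgn)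
  then obtain t where t: "t \<in> {0..1}" "cis (2 * pi * t) = w" by (rule cis_surj)
  have far: "cmod (circ a r t) = cmod a + r"
  proof (cases "a = 0")
    case True
    then show ?thesis using t r by (simp add: circ_def w_def norm_mult)
  next
    case False
    have "circ a r t = of_real (1 + r / cmod a) * a"
      using t False by (simp add: circ_def w_def sgn_div_norm scaleR_conv_of_real field_simps)
    then show ?thesis using False r by (simp add: norm_mult field_simps del: of_real_add of_real_divide)
  qed
  have ct: "continuous_on {0..1} (\<lambda>t. W b - W (circ a r t))"
    using r by (intro continuous_intros continuous_on_compose_circ[OF cont sph]) auto
  have "integral {0..1} (\<lambda>t. W b - W (circ a r t)) = W b - circ_mean W a r"
    unfolding circ_mean_def using integrable_circ[OF cont sph] r
    by (subst integral_diff) auto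
  also have "\<dots> \<le> 0" using r2(2)[of r] r aU(2) by auto
  finally have "integral {0..1} (\<lambda>t. W b - W (circ a r t)) \<le> 0" .
  moreover have inU: "circ a r t \<in> U" for t
    using sph circ_in_sphere[of r a t] r by (meson less_imp_le subsetD)
  moreover have nonneg: "W b - W (circ a r t) \<ge> 0" for t
    using bU[OF inU, of t] by simp
  moreover have "integral {0..1} (\<lambda>t. W b - W (circ a r t)) \<ge> 0"
    using ct nonneg by (intro integral_nonneg integrable_continuous_real) auto
  ultimately have "integral {0..1} (\<lambda>t. W b - W (circ a r t)) = 0" by simp
  then have "W b - W (circ a r t) = 0"
    using integral_eq_0_iff[OF ct] nonneg t(1) by simp
  moreover note inU[of t]
  ultimately have "circ a r t \<in> K'" using b(1) by (auto simp: K'_def K_def)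
  then show False using a(2) far r by force
qed

lemma max_principle_compact:
  assumes S: "compact S" and cont: "continuous_on S W"
    and sub: "\<And>z. z \<in> S \<Longrightarrow> W z > 0 \<Longrightarrow> z \<in> interior S \<and> submean W z"
    and z0: "z0 \<in> S"
  shows "W z0 \<le> 0"
proof (rule ccontr)
  assume n: "\<not> W z0 \<le> 0"
  then have "z0 \<in> interior S" using sub[OF z0] by auto
  moreover have "compact {z \<in> interior S. W z \<ge> e}" if "e > 0" for e
  proof -
    have "{z \<in> interior S. W z \<ge> e} = {z \<in> S. W z \<ge> e}"
      using sub interior_subset[of S] that by force
    moreover have "closedin (top_of_set S) (S \<inter> W -` {e..})"
      using continuous_closedin_preimage[OF cont, of "{e..}"] by simp
    moreover have "S \<inter> W -` {e..} = {z \<in> S. W z \<ge> e}" by auto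
    ultimately show ?thesis using S closedin_compact by metis
  qed
  ultimately have "W z0 \<le> 0"
    using continuous_on_subset[OF cont interior_subset] sub interior_subset[of S]
    by (intro max_principle[of "interior S"]) auto
  then show False using n by simp
qed

text \<open>The version for functions that are not continuous up to the boundary or live on unbounded
  sets.\<close>

lemma max_principle_frontier:
  assumes U: "open U" and cont: "continuous_on U W"
    and sub: "\<And>z. z \<in> U \<Longrightarrow> W z > 0 \<Longrightarrow> submean W z"
    and bd: "\<And>x e. x \<notin> U \<Longrightarrow> e > 0 \<Longrightarrow> \<forall>\<^sub>F z in at x within U. W z < e"
    and inf: "\<And>e. e > 0 \<Longrightarrow> \<exists>R. \<forall>z\<in>U. R < cmod z \<longrightarrow> W z < e"
    and z0: "z0 \<in> U"
  shows "W z0 \<le> 0"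
proof (rule max_principle[OF U cont _ sub z0])
  fix e :: real assume e: "e > 0"
  define A where "A = {z\<in>U. W z \<ge> e}"
  obtain R where R: "\<And>z. z \<in> U \<Longrightarrow> R < cmod z \<Longrightarrow> W z < e" using inf[OF e] by blast
  have "cmod z \<le> R" if "z \<in> A" for z using R[of z] that by (force simp: A_def)
  then have "bounded A" unfolding bounded_iff by blast
  moreover have "closed A"
    unfolding closed_limpt
  proof (intro allI impI)
    fix x assume x: "x islimpt A"
    have ev: "\<not> (\<forall>\<^sub>F z in at x within U. W z < e)"
    proof
      assume "\<forall>\<^sub>F z in at x within U. W z < e"
      then have "\<forall>\<^sub>F z in at x. z \<notin> A"
        unfolding eventually_at_filter by eventually_elim (auto simp: A_def)
      then show False using x unfolding islimpt_conv_frequently_at frequently_def by simp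
    qed
    have xU: "x \<in> U" using bd[OF _ e] ev by blast
    moreover have "W x \<ge> e"
    proof (rule ccontr)
      assume "\<not> W x \<ge> e"
      moreover have "(W \<longlongrightarrow> W x) (at x within U)" using cont xU by (simp add: continuous_on_def)
      ultimately have "\<forall>\<^sub>F z in at x within U. W z < e" by (simp add: order_tendstoD(2))
      then show False using ev by blast
    qed
    ultimately show "x \<in> A" by (simp add: A_def)
  qed
  ultimately show "compact {z\<in>U. W z \<ge> e}" unfolding A_def by (simp add: compact_eq_bounded_closed)
qed auto

lemma mvp_eq_on_ball:
  assumes "continuous_on (cball a r) u" "continuous_on (cball a r) v"
    and "mvp (ball a r) u" "mvp (ball a r) v" "\<And>z. z \<in> sphere a r \<Longrightarrow> u z = v z"
    and "z \<in> cball a r"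
  shows "u z = v z"
proof -
  have *: "u z - v z \<le> 0"
    if "continuous_on (cball a r) u" "continuous_on (cball a r) v"
    and "mvp (ball a r) u" "mvp (ball a r) v" "\<And>z. z \<in> sphere a r \<Longrightarrow> u z = v z" for u v
  proof (rule max_principle_compact[of "cball a r" "\<lambda>z. u z - v z", OF _ _ _ assms(6)])
    fix z assume z: "z \<in> cball a r" "u z - v z > 0"
    then have "z \<in> ball a r" using that(5)[of z] by (force simp: less_le)
    then show "z \<in> interior (cball a r) \<and> submean (\<lambda>z. u z - v z) z"
      using mvp_diff[OF open_ball that(3,4)] mvp_submean by auto
  qed (use that in \<open>auto intro!: continuous_intros\<close>)
  show ?thesis using *[of u v] *[of v u] assms by fastforce
qed

section \<open>The Poisson integral on a disc\<close>

lemma circ_circlepath: "circ a r t = circlepath a r t"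
  by (simp add: circ_def circlepath cis_conv_exp mult_ac)

lemma ball_radius_pos: "z \<in> ball (a::complex) r \<Longrightarrow> 0 < r"
  using zero_le_dist[of a z] by (simp only: mem_ball)

lemma circ_mean_Re_holomorphic:
  assumes f: "f holomorphic_on S" "open S" "cball a r \<subseteq> S" and r: "0 < r"
  shows "circ_mean (\<lambda>z. Re (f z)) a r = Re (f a)"
proof -
  have fc: "f holomorphic_on cball a r" using f holomorphic_on_subset by blast
  have "((\<lambda>u. f u / (u - a)) has_contour_integral 2 * of_real pi * \<i> * f a) (circlepath a r)"
    using fc r
    by (intro Cauchy_integral_circlepath holomorphic_on_imp_continuous_on)
       (auto intro: holomorphic_on_subset)
  then have "((\<lambda>t. f (circ a r t) / (circ a r t - a) *
      (2 * of_real pi * \<i> * r * exp (2 * of_real pi * \<i> * t))) has_integral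
        (2 * of_real pi * \<i> * f a)) {0..1}"
    unfolding has_contour_integral circ_circlepath
    by (simp add: vector_derivative_circlepath cong: has_integral_cong)
  then have "((\<lambda>t. 2 * of_real pi * \<i> * f (circ a r t)) has_integral
        (2 * of_real pi * \<i> * f a)) {0..1}"
    using r by (simp add: circ_def cis_conv_exp mult_ac)
  from has_integral_mult_right[OF this, of "inverse (2 * of_real pi * \<i>)"]
  have "((\<lambda>t. f (circ a r t)) has_integral f a) {0..1}" by (simp add: field_simps)
  from has_integral_linear[OF this bounded_linear_Re]
  show ?thesis unfolding circ_mean_def by (simp add: o_def integral_unique)
qed

lemma mvp_Re_holomorphic:
  assumes f: "f holomorphic_on S" and S: "open S"
  shows "mvp S (\<lambda>z. Re (f z))"
  unfolding mvp_def
proof (intro conjI ballI)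
  show "continuous_on S (\<lambda>z. Re (f z))"
    using f by (intro continuous_intros holomorphic_on_imp_continuous_on)
  show "mean_at (\<lambda>z. Re (f z)) a" if "a \<in> S" for a
  proof -
    obtain r1 where "r1 > 0" "\<And>r. 0 < r \<Longrightarrow> r < r1 \<Longrightarrow> cball a r \<subseteq> S"
      using small_circle[OF S \<open>a \<in> S\<close>] by blast
    then show ?thesis unfolding mean_at_def
      using circ_mean_Re_holomorphic[OF f S] by metis
  qed
qed

definition poisson_kernel :: "complex \<Rightarrow> real \<Rightarrow> complex \<Rightarrow> complex \<Rightarrow> real" where
  "poisson_kernel a r z \<zeta> = (r\<^sup>2 - (cmod (z - a))\<^sup>2) / (cmod (\<zeta> - z))\<^sup>2"

definition poisson :: "(complex \<Rightarrow> real) \<Rightarrow> complex \<Rightarrow> real \<Rightarrow> complex \<Rightarrow> real" where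
  "poisson \<phi> a r z = circ_mean (\<lambda>\<zeta>. poisson_kernel a r z \<zeta> * \<phi> \<zeta>) a r"

lemma poisson_kernel_nonneg: "z \<in> ball a r \<Longrightarrow> 0 \<le> poisson_kernel a r z \<zeta>"
  unfolding poisson_kernel_def
  by (intro divide_nonneg_nonneg) (auto simp: dist_norm norm_minus_commute power_mono)

lemma circ_neq_ball: "z \<in> ball a r \<Longrightarrow> circ a r t \<noteq> z"
  using dist_circ[of a r t] by auto

lemma continuous_on_poisson_kernel:
  "z \<in> ball a r \<Longrightarrow> continuous_on (sphere a r) (poisson_kernel a r z)"
  unfolding poisson_kernel_def by (intro continuous_intros) auto

lemma Re_cayley:
  assumes "\<zeta> \<noteq> z"
  shows "Re ((\<zeta> - a + (z - a)) / (\<zeta> - z)) = ((cmod (\<zeta> - a))\<^sup>2 - (cmod (z - a))\<^sup>2) / (cmod (\<zeta> - z))\<^sup>2"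
proof -
  have "Re ((\<zeta> - a + (z - a)) * cnj (\<zeta> - z)) = (cmod (\<zeta> - a))\<^sup>2 - (cmod (z - a))\<^sup>2"
    unfolding cmod_power2 by (simp add: algebra_simps power2_eq_square)
  then show ?thesis
    by (subst complex_div_cnj) (simp add: Re_divide_of_real flip: of_real_power del: times_complex.simps)
qed

text \<open>The Schwarz integral, whose real part is the Poisson integral.\<close>

definition schwarz :: "(complex \<Rightarrow> real) \<Rightarrow> complex \<Rightarrow> real \<Rightarrow> complex \<Rightarrow> complex" where
  "schwarz \<phi> a r z = integral {0..1}
     (\<lambda>t. of_real (\<phi> (circ a r t)) * ((circ a r t - a + (z - a)) / (circ a r t - z)))"

lemma continuous_on_schwarz_kernel:
  assumes "continuous_on (sphere a r) \<phi>" "z \<in> ball a r"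
  shows "continuous_on {0..1} (\<lambda>t. of_real (\<phi> (circ a r t)) * ((circ a r t - a + (z - a)) / (circ a r t - z)))"
proof -
  have "0 < r" using ball_radius_pos assms(2) by blast
  then show ?thesis
    using assms circ_neq_ball[OF assms(2)]
    by (intro continuous_intros continuous_on_compose_circ[OF assms(1)]) auto
qed

lemma Re_of_real_mult: "Re (of_real x * w) = x * Re w"
  by simp

lemma poisson_eq_Re:
  assumes "continuous_on (sphere a r) \<phi>" "z \<in> ball a r"
  shows "poisson \<phi> a r z = Re (schwarz \<phi> a r z)"
proof -
  have r: "0 < r" using ball_radius_pos assms(2) by blast
  have "((\<lambda>t. of_real (\<phi> (circ a r t)) * ((circ a r t - a + (z - a)) / (circ a r t - z)))
      has_integral schwarz \<phi> a r z) {0..1}"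
    unfolding schwarz_def
    by (intro integrable_integral integrable_continuous_real continuous_on_schwarz_kernel assms)
  from has_integral_linear[OF this bounded_linear_Re]
  have "((\<lambda>t. \<phi> (circ a r t) * Re ((circ a r t - a + (z - a)) / (circ a r t - z)))
      has_integral Re (schwarz \<phi> a r z)) {0..1}"
    unfolding o_def Re_of_real_mult .
  moreover have "Re ((circ a r t - a + (z - a)) / (circ a r t - z)) = poisson_kernel a r z (circ a r t)" for t
  proof -
    have "cmod (circ a r t - a) = r"
      using dist_circ[of a r t] r by (simp add: dist_norm norm_minus_commute)
    then show ?thesis
      using Re_cayley[OF circ_neq_ball[OF assms(2), of t], of a] by (simp add: poisson_kernel_def)
  qed
  ultimately show ?thesis
    unfolding poisson_def circ_mean_def by (simp add: integral_unique mult.commute)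
qed

lemma holomorphic_on_schwarz:
  assumes "continuous_on (sphere a r) \<phi>"
  shows "schwarz \<phi> a r holomorphic_on ball a r"
proof -
  have "(\<lambda>z. integral (cbox 0 1) (\<lambda>t. of_real (\<phi> (circ a r t)) *
      ((circ a r t - a + (z - a)) / (circ a r t - z)))) holomorphic_on ball a r"
  proof (cases "r > 0")
    case True
    note r = this
    show ?thesis
    proof (rule leibniz_rule_holomorphic)
      fix z t assume z: "z \<in> ball a r" and "t \<in> cbox (0::real) 1"
      have nz: "circ a r t \<noteq> z" using circ_neq_ball[OF z] .
      show "((\<lambda>z. of_real (\<phi> (circ a r t)) * ((circ a r t - a + (z - a)) / (circ a r t - z)))
        has_field_derivative of_real (\<phi> (circ a r t)) * (2 * (circ a r t - a) / (circ a r t - z)\<^sup>2))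
        (at z within ball a r)"
        using nz by (auto intro!: derivative_eq_intros simp: power2_eq_square algebra_simps)
    next
      fix z assume "z \<in> ball a r"
      then show "(\<lambda>t. of_real (\<phi> (circ a r t)) * ((circ a r t - a + (z - a)) / (circ a r t - z)))
          integrable_on cbox 0 1"
        using integrable_continuous_real[OF continuous_on_schwarz_kernel[OF assms]] by simp
    next
      have c: "continuous_on (ball a r \<times> cbox 0 1) (\<lambda>p. circ a r (snd p))"
        unfolding circ_def by (intro continuous_intros)
      have "continuous_on (ball a r \<times> cbox 0 1) (\<lambda>p. \<phi> (circ a r (snd p)))"
        using r by (intro continuous_on_compose2[OF assms c]) auto
      then show "continuous_on (ball a r \<times> cbox 0 1)
          (\<lambda>(z, t). of_real (\<phi> (circ a r t)) * (2 * (circ a r t - a) / (circ a r t - z)\<^sup>2))"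
        unfolding case_prod_unfold
        using c circ_neq_ball by (intro continuous_intros) auto
    qed auto
  next
    case False
    then have "ball a r = {}" by simp
    then show ?thesis by (simp only: holomorphic_on_empty)
  qed
  then show ?thesis unfolding schwarz_def by (simp cong: holomorphic_cong)
qed

lemma mvp_poisson:
  assumes "continuous_on (sphere a r) \<phi>"
  shows "mvp (ball a r) (poisson \<phi> a r)"
  by (rule mvp_cong[OF open_ball mvp_Re_holomorphic[OF holomorphic_on_schwarz[OF assms] open_ball]])
     (simp add: poisson_eq_Re[OF assms])

text \<open>On the circle the Poisson kernel is the real part of the conjugate of a function of
  \<open>\<zeta>\<close> that is holomorphic on the closed disc, with value \<open>1\<close> at the centre.\<close>

lemma circ_mean_poisson_kernel:
  assumes z: "z \<in> ball a r"
  shows "circ_mean (poisson_kernel a r z) a r = 1"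
proof -
  have r: "0 < r" using ball_radius_pos z by blast
  define w where "w = z - a"
  have w: "cmod w < r" using z by (simp add: w_def dist_norm norm_minus_commute)
  define h where "h = (\<lambda>\<zeta>. (of_real (r\<^sup>2) + cnj w * (\<zeta> - a)) / (of_real (r\<^sup>2) - cnj w * (\<zeta> - a)))"
  define R where "R = r\<^sup>2 / (cmod w + r) + r"
  have ne: "of_real (r\<^sup>2) - cnj w * (\<zeta> - a) \<noteq> 0" if "cmod (\<zeta> - a) * cmod w < r\<^sup>2" for \<zeta>
  proof
    assume "of_real (r\<^sup>2) - cnj w * (\<zeta> - a) = 0"
    then have "cmod (of_real (r\<^sup>2)) = cmod (cnj w * (\<zeta> - a))" by simp
    then show False using that by (simp add: norm_mult norm_power mult.commute)
  qed
  define S where "S = {\<zeta>. cmod (\<zeta> - a) * cmod w < r\<^sup>2}"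
  have "open S" unfolding S_def by (intro open_Collect_less continuous_intros)
  moreover have "cball a r \<subseteq> S"
  proof
    fix \<zeta> assume "\<zeta> \<in> cball a r"
    then have "cmod (\<zeta> - a) * cmod w \<le> r * cmod w"
      by (intro mult_right_mono) (auto simp: dist_norm norm_minus_commute)
    also have "\<dots> < r\<^sup>2" using w r by (simp add: power2_eq_square)
    finally show "\<zeta> \<in> S" by (simp add: S_def)
  qed
  moreover have "h holomorphic_on S"
    unfolding h_def using ne by (intro holomorphic_intros) (auto simp: S_def)
  ultimately have "circ_mean (\<lambda>\<zeta>. Re (h \<zeta>)) a r = Re (h a)"
    using r by (intro circ_mean_Re_holomorphic)
  also have "Re (h a) = 1" using r by (simp add: h_def)
  also have "circ_mean (\<lambda>\<zeta>. Re (h \<zeta>)) a r = circ_mean (poisson_kernel a r z) a r"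
  proof (rule circ_mean_cong)
    fix \<zeta> assume "\<zeta> \<in> sphere a r"
    then have \<zeta>: "cmod (\<zeta> - a) = r" by (simp add: dist_norm norm_minus_commute)
    have nz: "\<zeta> \<noteq> z" using \<zeta> w w_def by auto
    have rr: "(of_real (r\<^sup>2) :: complex) = (\<zeta> - a) * cnj (\<zeta> - a)"
      using \<zeta> by (metis complex_norm_square)
    have "h \<zeta> = ((\<zeta> - a) * cnj (\<zeta> - a + w)) / ((\<zeta> - a) * cnj (\<zeta> - a - w))"
      unfolding h_def rr by (simp add: algebra_simps)
    also have "\<dots> = cnj ((\<zeta> - a + (z - a)) / (\<zeta> - z))"
      using \<zeta> r by (subst mult_divide_mult_cancel_left) (auto simp: w_def)
    finally have "Re (h \<zeta>) = Re ((\<zeta> - a + (z - a)) / (\<zeta> - z))" by (simp del: complex_cnj_divide)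
    then show "Re (h \<zeta>) = poisson_kernel a r z \<zeta>"
      using Re_cayley[OF nz, of a] \<zeta> by (simp add: poisson_kernel_def)
  qed (use r in auto)
  finally show ?thesis .
qed

text \<open>On the arc near \<open>\<zeta>0\<close> the boundary function is almost constant and the kernel has mean
  \<open>1\<close>; on the rest of the circle the kernel tends to zero uniformly.\<close>

lemma poisson_boundary:
  assumes \<phi>: "continuous_on (sphere a r) \<phi>" and \<zeta>0: "\<zeta>0 \<in> sphere a r" and r: "0 < r" and e: "0 < e"
  obtains d where "0 < d" "\<And>z. z \<in> ball a r \<Longrightarrow> dist z \<zeta>0 < d \<Longrightarrow> \<bar>poisson \<phi> a r z - \<phi> \<zeta>0\<bar> < e"
proof -
  have "bounded (\<phi> ` sphere a r)"
    using \<phi> compact_continuous_image compact_imp_bounded compact_sphere by blast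
  then obtain M where "M > 0" "\<forall>x\<in>\<phi> ` sphere a r. norm x \<le> M"
    unfolding bounded_pos by blast
  then have M: "\<And>\<zeta>. \<zeta> \<in> sphere a r \<Longrightarrow> \<bar>\<phi> \<zeta>\<bar> \<le> M" "M > 0" by auto
  obtain d1 where d1: "d1 > 0" "\<And>\<zeta>. \<zeta> \<in> sphere a r \<Longrightarrow> dist \<zeta> \<zeta>0 < d1 \<Longrightarrow> \<bar>\<phi> \<zeta> - \<phi> \<zeta>0\<bar> < e / 2"
    using \<phi> \<zeta>0 e unfolding continuous_on_iff dist_real_def by (metis half_gt_zero)
  define C where "C = 2 * M * 4 / d1\<^sup>2"
  have C: "C > 0" using M d1 by (simp add: C_def)
  define d where "d = min (d1 / 2) (e / (4 * C * r))"
  show thesis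
  proof (rule that[of d])
    show "0 < d" using d1 C r e by (simp add: d_def)
    fix z assume z: "z \<in> ball a r" and zd: "dist z \<zeta>0 < d"
    have wz: "cmod (z - a) < r" using z by (simp add: dist_norm norm_minus_commute)
    have small: "r\<^sup>2 - (cmod (z - a))\<^sup>2 < e / (2 * C)"
    proof -
      have "r - cmod (z - a) \<le> dist z \<zeta>0"
        using \<zeta>0 dist_triangle[of a \<zeta>0 z] by (simp add: dist_norm norm_minus_commute)
      also have "\<dots> < e / (4 * C * r)" using zd by (simp add: d_def)
      finally have A: "r - cmod (z - a) < e / (4 * C * r)" .
      have "r\<^sup>2 - (cmod (z - a))\<^sup>2 = (r - cmod (z - a)) * (r + cmod (z - a))"
        by (simp add: power2_eq_square algebra_simps)
      also have "\<dots> \<le> (r - cmod (z - a)) * (2 * r)" using wz by (intro mult_left_mono) auto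
      also have "\<dots> < e / (4 * C * r) * (2 * r)" using A r by (intro mult_strict_right_mono) auto
      also have "\<dots> = e / (2 * C)" using r C by (simp add: field_simps)
      finally show ?thesis .
    qed
    have pt: "\<bar>\<phi> \<zeta> - \<phi> \<zeta>0\<bar> * poisson_kernel a r z \<zeta> \<le> e / 2 * poisson_kernel a r z \<zeta> + C * (r\<^sup>2 - (cmod (z - a))\<^sup>2)"
      if \<zeta>: "\<zeta> \<in> sphere a r" for \<zeta>
    proof (cases "dist \<zeta> \<zeta>0 < d1")
      case True
      have "\<bar>\<phi> \<zeta> - \<phi> \<zeta>0\<bar> * poisson_kernel a r z \<zeta> \<le> e / 2 * poisson_kernel a r z \<zeta>"
        using d1(2)[OF \<zeta> True] poisson_kernel_nonneg[OF z, of \<zeta>] by (intro mult_right_mono) auto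
      moreover have "0 \<le> C * (r\<^sup>2 - (cmod (z - a))\<^sup>2)"
        using C wz by (intro mult_nonneg_nonneg) (auto simp: power_mono)
      ultimately show ?thesis by linarith
    next
      case False
      have far: "d1 / 2 \<le> cmod (\<zeta> - z)"
        using False zd dist_triangle[of \<zeta> \<zeta>0 z] by (simp add: d_def dist_norm)
      have "poisson_kernel a r z \<zeta> \<le> (r\<^sup>2 - (cmod (z - a))\<^sup>2) / (d1 / 2)\<^sup>2"
        unfolding poisson_kernel_def using far d1 wz
        by (intro divide_left_mono power_mono mult_pos_pos) (auto simp: power_mono intro: order_less_le_trans)
      then have "\<bar>\<phi> \<zeta> - \<phi> \<zeta>0\<bar> * poisson_kernel a r z \<zeta> \<le> (2 * M) * ((r\<^sup>2 - (cmod (z - a))\<^sup>2) / (d1 / 2)\<^sup>2)"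
        using M(1)[OF \<zeta>] M(1)[OF \<zeta>0] poisson_kernel_nonneg[OF z, of \<zeta>] M(2)
        by (intro mult_mono) auto
      also have "\<dots> = C * (r\<^sup>2 - (cmod (z - a))\<^sup>2)"
        by (simp add: C_def power2_eq_square field_simps)
      finally show ?thesis using poisson_kernel_nonneg[OF z, of \<zeta>] e by (simp add: add_increasing)
    qed
    have cp: "continuous_on (sphere a r) (poisson_kernel a r z)" using continuous_on_poisson_kernel[OF z] .
    define D where "D = (\<lambda>\<zeta>. poisson_kernel a r z \<zeta> * (\<phi> \<zeta> - \<phi> \<zeta>0))"
    have cD: "continuous_on (sphere a r) D" unfolding D_def by (intro continuous_intros cp \<phi>)
    define B where "B = (\<lambda>\<zeta>. e / 2 * poisson_kernel a r z \<zeta> + C * (r\<^sup>2 - (cmod (z - a))\<^sup>2))"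
    have cB: "continuous_on (sphere a r) B" unfolding B_def by (intro continuous_intros cp)
    have mB: "circ_mean B a r < e"
    proof -
      have "circ_mean B a r = e / 2 + C * (r\<^sup>2 - (cmod (z - a))\<^sup>2)"
        unfolding B_def using cp r circ_mean_cmult[of "e / 2" "poisson_kernel a r z" a r]
        by (subst circ_mean_add[of "sphere a r"])
           (auto simp: circ_mean_poisson_kernel[OF z] intro!: continuous_intros)
      also have "\<dots> < e" using small C by (simp add: field_simps)
      finally show ?thesis .
    qed
    have Dabs: "\<bar>D \<zeta>\<bar> \<le> B \<zeta>" if "\<zeta> \<in> sphere a r" for \<zeta>
      using pt[OF that] poisson_kernel_nonneg[OF z, of \<zeta>] by (simp add: D_def B_def abs_mult mult.commute)
    have "circ_mean D a r \<le> circ_mean B a r"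
      using Dabs r by (intro circ_mean_le[OF cD cB]) fastforce+
    moreover have "circ_mean (\<lambda>\<zeta>. -1 * D \<zeta>) a r \<le> circ_mean B a r"
      using Dabs r by (intro circ_mean_le[of "sphere a r"] cB continuous_intros cD) fastforce+
    ultimately have "\<bar>circ_mean D a r\<bar> < e"
      using mB unfolding circ_mean_cmult by linarith
    moreover have "poisson \<phi> a r z = circ_mean D a r + \<phi> \<zeta>0"
    proof -
      have "poisson \<phi> a r z = circ_mean (\<lambda>\<zeta>. D \<zeta> + \<phi> \<zeta>0 * poisson_kernel a r z \<zeta>) a r"
        unfolding poisson_def D_def by (simp add: algebra_simps)
      also have "\<dots> = circ_mean D a r + \<phi> \<zeta>0"
        using r cp by (subst circ_mean_add[of "sphere a r"])
          (auto simp: circ_mean_cmult circ_mean_poisson_kernel[OF z] intro!: continuous_intros cD)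
      finally show ?thesis .
    qed
    ultimately show "\<bar>poisson \<phi> a r z - \<phi> \<zeta>0\<bar> < e" by simp
  qed
qed

definition poisson_mod :: "complex \<Rightarrow> real \<Rightarrow> (complex \<Rightarrow> real) \<Rightarrow> complex \<Rightarrow> real" where
  "poisson_mod a r \<phi> z = (if z \<in> ball a r then poisson \<phi> a r z else \<phi> z)"

lemma continuous_on_poisson_mod_cball:
  assumes \<phi>: "continuous_on (sphere a r) \<phi>" and r: "0 < r"
  shows "continuous_on (cball a r) (poisson_mod a r \<phi>)"
  unfolding continuous_on_iff
proof (intro ballI allI impI)
  fix x e :: real and z assume z: "z \<in> cball a r" and e: "e > 0"
  show "\<exists>d>0. \<forall>x'\<in>cball a r. dist x' z < d \<longrightarrow> dist (poisson_mod a r \<phi> x') (poisson_mod a r \<phi> z) < e"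
  proof (cases "z \<in> ball a r")
    case True
    have "continuous_on (ball a r) (poisson \<phi> a r)" using mvp_continuous[OF mvp_poisson[OF \<phi>]] .
    then obtain d where d: "d > 0" "\<And>x'. x' \<in> ball a r \<Longrightarrow> dist x' z < d \<Longrightarrow> dist (poisson \<phi> a r x') (poisson \<phi> a r z) < e"
      using True e unfolding continuous_on_iff by metis
    obtain d2 where d2: "d2 > 0" "ball z d2 \<subseteq> ball a r"
      using True open_ball open_contains_ball by blast
    show ?thesis
    proof (intro exI[of _ "min d d2"] conjI ballI impI)
      fix x' assume x': "dist x' z < min d d2"
      then have "x' \<in> ball a r" using d2(2) by (auto simp: dist_commute subset_iff)
      then show "dist (poisson_mod a r \<phi> x') (poisson_mod a r \<phi> z) < e"
        using d(2)[of x'] x' True by (simp add: poisson_mod_def)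
    qed (use d d2 in auto)
  next
    case False
    then have zs: "z \<in> sphere a r" using z by auto
    obtain d where d: "d > 0" "\<And>x. x \<in> ball a r \<Longrightarrow> dist x z < d \<Longrightarrow> \<bar>poisson \<phi> a r x - \<phi> z\<bar> < e"
      using poisson_boundary[OF \<phi> zs r e] by blast
    obtain d1 where d1: "d1 > 0" "\<And>\<zeta>. \<zeta> \<in> sphere a r \<Longrightarrow> dist \<zeta> z < d1 \<Longrightarrow> \<bar>\<phi> \<zeta> - \<phi> z\<bar> < e"
      using \<phi> zs e unfolding continuous_on_iff dist_real_def by metis
    show ?thesis
    proof (intro exI[of _ "min d d1"] conjI ballI impI)
      fix x' assume x': "x' \<in> cball a r" "dist x' z < min d d1"
      show "dist (poisson_mod a r \<phi> x') (poisson_mod a r \<phi> z) < e"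
      proof (cases "x' \<in> ball a r")
        case True
        then show ?thesis using d(2)[of x'] x' False by (simp add: poisson_mod_def dist_real_def)
      next
        case F2: False
        then have "x' \<in> sphere a r" using x' by auto
        then show ?thesis using d1(2)[of x'] x' False F2 by (simp add: poisson_mod_def dist_real_def)
      qed
    qed (use d d1 in auto)
  qed
qed

lemma mvp_eq_poisson:
  assumes "continuous_on (cball a r) u" "mvp (ball a r) u" "z \<in> ball a r"
  shows "u z = poisson u a r z"
proof -
  have r: "0 < r" using ball_radius_pos assms(3) by blast
  have cs: "continuous_on (sphere a r) u" using assms(1) by (rule continuous_on_subset) auto
  have "u z = poisson_mod a r u z"
  proof (rule mvp_eq_on_ball[OF assms(1) continuous_on_poisson_mod_cball[OF cs r] assms(2)])
    show "mvp (ball a r) (poisson_mod a r u)"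
      by (rule mvp_cong[OF open_ball mvp_poisson[OF cs]]) (simp add: poisson_mod_def)
  qed (use assms(3) in \<open>auto simp: poisson_mod_def\<close>)
  then show ?thesis using assms(3) by (simp add: poisson_mod_def)
qed

section \<open>Harmonic functions and the mean value property\<close>

lemma Re_mult_unique:
  assumes "\<And>h. Re (g * h) = Re (g' * h)"
  shows "g = g'"
  using assms[of 1] assms[of \<i>] by (simp add: complex_eq_iff)

text \<open>Local holomorphic functions with real part \<open>u\<close> differ by constants, so their derivatives fit
  together to one holomorphic function, and it carries the partial derivatives of \<open>u\<close>.\<close>

lemma harmonic_on_local_Re:
  assumes S: "open S"
    and loc: "\<And>z. z \<in> S \<Longrightarrow> \<exists>r>0. \<exists>f. f holomorphic_on ball z r \<and> (\<forall>w\<in>ball z r. u w = Re (f w))"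
  shows "harmonic_on S u"
proof -
  have "\<forall>z\<in>S. \<exists>T f. open T \<and> z \<in> T \<and> T \<subseteq> S \<and> f holomorphic_on T \<and> (\<forall>w\<in>T. u w = Re (f w))"
  proof
    fix z assume z: "z \<in> S"
    obtain r f where rf: "r > 0" "f holomorphic_on ball z r" "\<forall>w\<in>ball z r. u w = Re (f w)"
      using loc[OF z] by blast
    show "\<exists>T f. open T \<and> z \<in> T \<and> T \<subseteq> S \<and> f holomorphic_on T \<and> (\<forall>w\<in>T. u w = Re (f w))"
      by (rule exI[of _ "ball z r \<inter> S"], rule exI[of _ f])
         (use S z rf in \<open>auto intro: holomorphic_on_subset\<close>)
  qed
  then obtain T f where T: "\<And>z. z \<in> S \<Longrightarrow> open (T z)" "\<And>z. z \<in> S \<Longrightarrow> z \<in> T z" "\<And>z. z \<in> S \<Longrightarrow> T z \<subseteq> S"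
    and f: "\<And>z. z \<in> S \<Longrightarrow> f z holomorphic_on T z" "\<And>z w. z \<in> S \<Longrightarrow> w \<in> T z \<Longrightarrow> u w = Re (f z w)"
    by metis
  define G where "G = (\<lambda>z. deriv (f z) z)"
  have der: "(u has_derivative (\<lambda>h. Re (deriv (f z) w * h))) (at w)" if "z \<in> S" "w \<in> T z" for z w
  proof -
    have "(f z has_field_derivative deriv (f z) w) (at w)"
      using f(1) T(1) that holomorphic_derivI by blast
    then have "(f z has_derivative (\<lambda>h. deriv (f z) w * h)) (at w)"
      by (simp add: has_field_derivative_def)
    from bounded_linear.has_derivative[OF bounded_linear_Re this]
    have "((\<lambda>x. Re (f z x)) has_derivative (\<lambda>h. Re (deriv (f z) w * h))) (at w)" .
    then show ?thesis
      by (rule has_derivative_transform_within_open[of _ _ _ _ "T z"]) (use T f(2) that in auto)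
  qed
  have Geq: "G w = deriv (f z) w" if "z \<in> S" "w \<in> T z" for z w
  proof (rule Re_mult_unique)
    fix h
    have "w \<in> S" using T(3) that by blast
    then have "(u has_derivative (\<lambda>h. Re (G w * h))) (at w)"
      using der[of w w] T(2) by (simp add: G_def)
    from has_derivative_unique[OF this der[OF that]]
    show "Re (G w * h) = Re (deriv (f z) w * h)" by meson
  qed
  have Ghol: "G holomorphic_on S"
    unfolding holomorphic_on_open[OF S]
  proof
    fix z assume z: "z \<in> S"
    have "deriv (f z) holomorphic_on T z" using f(1) T(1) z holomorphic_deriv by blast
    then have "(deriv (f z) has_field_derivative deriv (deriv (f z)) z) (at z)"
      using T z holomorphic_derivI by blast
    then have "(G has_field_derivative deriv (deriv (f z)) z) (at z)"
      by (rule has_field_derivative_transform_within_open[of _ _ _ "T z"]) (use T z Geq in auto)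
    then show "\<exists>d. (G has_field_derivative d) (at z)" by blast
  qed
  define G' where "G' = deriv G"
  have G'c: "continuous_on S G'"
    unfolding G'_def using Ghol S holomorphic_deriv holomorphic_on_imp_continuous_on by blast
  have dG: "(G has_derivative (\<lambda>h. G' z * h)) (at z)" if "z \<in> S" for z
    using Ghol S that holomorphic_derivI unfolding G'_def has_field_derivative_def by blast
  show ?thesis unfolding harmonic_on_def
  proof (rule exI[of _ "\<lambda>z. Re (G z)"], rule exI[of _ "\<lambda>z. - Im (G z)"],
      rule exI[of _ "\<lambda>z. Re (G' z)"], rule exI[of _ "\<lambda>z. - Im (G' z)"],
      rule exI[of _ "\<lambda>z. - Im (G' z)"], rule exI[of _ "\<lambda>z. - Re (G' z)"], intro conjI ballI)
    fix z assume z: "z \<in> S"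
    show "(u has_derivative (\<lambda>h. Re (G z) * Re h + - Im (G z) * Im h)) (at z)"
      using der[of z z] T(2) z by (simp add: G_def)
    show "((\<lambda>z. Re (G z)) has_derivative (\<lambda>h. Re (G' z) * Re h + - Im (G' z) * Im h)) (at z)"
      using bounded_linear.has_derivative[OF bounded_linear_Re dG[OF z]] by simp
    have "(\<lambda>h. - Im (G' z * h)) = (\<lambda>h. - Im (G' z) * Re h + - Re (G' z) * Im h)"
      by (auto simp: algebra_simps)
    then show "((\<lambda>z. - Im (G z)) has_derivative (\<lambda>h. - Im (G' z) * Re h + - Re (G' z) * Im h)) (at z)"
      using has_derivative_minus[OF bounded_linear.has_derivative[OF bounded_linear_Im dG[OF z]]] by simp
  qed (use G'c in \<open>auto intro!: continuous_intros\<close>)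
qed

lemma mvp_imp_harmonic_on:
  assumes S: "open S" and u: "mvp S u"
  shows "harmonic_on S u"
proof (rule harmonic_on_local_Re[OF S])
  fix z assume "z \<in> S"
  then obtain r where r: "r > 0" "cball z r \<subseteq> S" using S open_contains_cball by blast
  have c: "continuous_on (cball z r) u" using mvp_continuous[OF u] r(2) continuous_on_subset by blast
  have "u w = Re (schwarz u z r w)" if "w \<in> ball z r" for w
    using mvp_eq_poisson[OF c mvp_subset[OF u] that] poisson_eq_Re[OF _ that, of u] r(2)
      continuous_on_subset[OF c sphere_cball] by fastforce
  moreover have "schwarz u z r holomorphic_on ball z r"
    by (rule holomorphic_on_schwarz[OF continuous_on_subset[OF c]]) auto
  ultimately show "\<exists>r>0. \<exists>f. f holomorphic_on ball z r \<and> (\<forall>w\<in>ball z r. u w = Re (f w))"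
    using r(1) by blast
qed

text \<open>The second difference over a square of side \<open>h\<close> can be evaluated by the mean value theorem in
  either order.\<close>

lemma mixed_partials_points:
  fixes u ux uy uxy uyx :: "complex \<Rightarrow> real"
  assumes h: "0 < h"
    and R: "\<And>s t. 0 \<le> s \<Longrightarrow> s \<le> h \<Longrightarrow> 0 \<le> t \<Longrightarrow> t \<le> h \<Longrightarrow> Complex (x + s) (y + t) \<in> S"
    and u: "\<And>z. z \<in> S \<Longrightarrow> (u has_derivative (\<lambda>k. ux z * Re k + uy z * Im k)) (at z)"
    and ux: "\<And>z. z \<in> S \<Longrightarrow> (ux has_derivative (\<lambda>k. uxx z * Re k + uxy z * Im k)) (at z)"
  shows "\<exists>s t. 0 < s \<and> s < h \<and> 0 < t \<and> t < h \<and>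
    u (Complex (x + h) (y + h)) - u (Complex (x + h) y) - u (Complex x (y + h)) + u (Complex x y)
      = h * h * uxy (Complex (x + s) (y + t))"
proof -
  have lx: "((\<lambda>s. v (Complex (x + s) b)) has_real_derivative vx (Complex (x + s) b)) (at s)"
    if "(v has_derivative (\<lambda>k. vx (Complex (x + s) b) * Re k + vy (Complex (x + s) b) * Im k)) (at (Complex (x + s) b))"
    for v vx vy :: "complex \<Rightarrow> real" and s b
  proof -
    have "((\<lambda>s. Complex (x + s) b) has_derivative (\<lambda>k. Complex k 0)) (at s)"
      unfolding Complex_eq by (auto intro!: derivative_eq_intros)
    from has_derivative_compose[OF this that]
    show ?thesis by (simp add: has_field_derivative_def)
  qed
  have ly: "((\<lambda>t. v (Complex b (y + t))) has_real_derivative vy (Complex b (y + t))) (at t)"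
    if "(v has_derivative (\<lambda>k. vx (Complex b (y + t)) * Re k + vy (Complex b (y + t)) * Im k)) (at (Complex b (y + t)))"
    for v vx vy :: "complex \<Rightarrow> real" and t b
  proof -
    have "((\<lambda>t. Complex b (y + t)) has_derivative (\<lambda>k. Complex 0 k)) (at t)"
      unfolding Complex_eq by (auto intro!: derivative_eq_intros)
    from has_derivative_compose[OF this that]
    show ?thesis by (simp add: has_field_derivative_def)
  qed
  define p where "p = (\<lambda>s. u (Complex (x + s) (y + h)) - u (Complex (x + s) y))"
  have "\<exists>s>0. s < h \<and> p h - p 0 = (h - 0) * (ux (Complex (x + s) (y + h)) - ux (Complex (x + s) y))"
  proof (rule MVT2)
    fix s assume "0 \<le> s" "s \<le> h"
    then show "(p has_real_derivative (ux (Complex (x + s) (y + h)) - ux (Complex (x + s) y))) (at s)"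
      unfolding p_def using h R[of s 0] R[of s h]
      by (intro DERIV_diff lx[of _ _ _ _ uy] u) auto
  qed (use h in auto)
  then obtain s where s: "0 < s" "s < h" "p h - p 0 = h * (ux (Complex (x + s) (y + h)) - ux (Complex (x + s) y))"
    by auto
  define q where "q = (\<lambda>t. ux (Complex (x + s) (y + t)))"
  have "\<exists>t>0. t < h \<and> q h - q 0 = (h - 0) * uxy (Complex (x + s) (y + t))"
  proof (rule MVT2)
    fix t assume "0 \<le> t" "t \<le> h"
    then show "(q has_real_derivative uxy (Complex (x + s) (y + t))) (at t)"
      unfolding q_def using s R[of s t] by (intro ly[of _ uxx] ux) auto
  qed (use h in auto)
  then obtain t where "0 < t" "t < h" "q h - q 0 = h * uxy (Complex (x + s) (y + t))" by auto
  then show ?thesis using s by (intro exI[of _ s] exI[of _ t]) (auto simp: p_def q_def)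
qed

lemma mixed_partials_eq:
  fixes u ux uy uxy uyx :: "complex \<Rightarrow> real"
  assumes S: "open S" and z: "z \<in> S"
    and u: "\<And>z. z \<in> S \<Longrightarrow> (u has_derivative (\<lambda>k. ux z * Re k + uy z * Im k)) (at z)"
    and ux: "\<And>z. z \<in> S \<Longrightarrow> (ux has_derivative (\<lambda>k. uxx z * Re k + uxy z * Im k)) (at z)"
    and uy: "\<And>z. z \<in> S \<Longrightarrow> (uy has_derivative (\<lambda>k. uyx z * Re k + uyy z * Im k)) (at z)"
    and cont: "continuous_on S uxy" "continuous_on S uyx"
  shows "uxy z = uyx z"
proof (rule ccontr)
  assume ne: "uxy z \<noteq> uyx z"
  define e where "e = \<bar>uxy z - uyx z\<bar> / 2"
  have e: "e > 0" using ne by (simp add: e_def)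
  obtain d1 where d1: "d1 > 0" "\<And>w. w \<in> S \<Longrightarrow> dist w z < d1 \<Longrightarrow> \<bar>uxy w - uxy z\<bar> < e"
    using cont(1) z e unfolding continuous_on_iff dist_real_def by metis
  obtain d2 where d2: "d2 > 0" "\<And>w. w \<in> S \<Longrightarrow> dist w z < d2 \<Longrightarrow> \<bar>uyx w - uyx z\<bar> < e"
    using cont(2) z e unfolding continuous_on_iff dist_real_def by metis
  obtain d3 where d3: "d3 > 0" "ball z d3 \<subseteq> S" using S z open_contains_ball by blast
  define x y where "x = Re z" "y = Im z"
  have zxy: "z = Complex x y" by (simp add: x_y_def)
  define h where "h = min d1 (min d2 d3) / 4"
  have h: "h > 0" using d1 d2 d3 by (simp add: h_def)
  have near: "dist (Complex (x + s) (y + t)) z < 4 * h" if "0 \<le> s" "s \<le> h" "0 \<le> t" "t \<le> h" for s t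
  proof -
    have "dist (Complex (x + s) (y + t)) z = cmod (Complex s t)"
      by (simp add: zxy dist_norm complex_diff)
    also have "\<dots> \<le> \<bar>s\<bar> + \<bar>t\<bar>" using cmod_le[of "Complex s t"] by simp
    also have "\<dots> < 4 * h" using that h by simp
    finally show ?thesis .
  qed
  have R: "Complex (x + s) (y + t) \<in> S" if "0 \<le> s" "s \<le> h" "0 \<le> t" "t \<le> h" for s t
    using near[OF that] d3(2) by (auto simp: h_def dist_commute subset_iff)
  obtain s t where st: "0 < s" "s < h" "0 < t" "t < h"
    "u (Complex (x + h) (y + h)) - u (Complex (x + h) y) - u (Complex x (y + h)) + u (Complex x y)
      = h * h * uxy (Complex (x + s) (y + t))"
    using mixed_partials_points[of h x y S u ux uy uxx uxy, OF h R u ux] by blast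
  \<comment> \<open>exchanging the coordinates gives the other order of differentiation\<close>
  define sw where "sw = (\<lambda>z. Complex (Im z) (Re z))"
  have sw: "sw (sw z) = z" "Re (sw z) = Im z" "Im (sw z) = Re z" "sw (Complex a b) = Complex b a" for z a b
    by (auto simp: sw_def)
  have bl: "bounded_linear sw"
    by (rule bounded_linear_intro[of _ 1]) (auto simp: sw_def complex_eq_iff cmod_def add.commute)
  have swd: "((\<lambda>z. v (sw z)) has_derivative (\<lambda>k. b * Re k + a * Im k)) (at w)"
    if "(v has_derivative (\<lambda>k. a * Re k + b * Im k)) (at (sw w))" for v :: "complex \<Rightarrow> real" and a b w
    using has_derivative_compose[OF bounded_linear_imp_has_derivative[OF bl] that]
    by (simp add: sw add.commute)
  have "\<exists>t s. 0 < t \<and> t < h \<and> 0 < s \<and> s < h \<and>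
    u (sw (Complex (y + h) (x + h))) - u (sw (Complex (y + h) x)) - u (sw (Complex y (x + h))) + u (sw (Complex y x))
      = h * h * uyx (sw (Complex (y + t) (x + s)))"
    by (rule mixed_partials_points[of h y x "sw -` S" "\<lambda>z. u (sw z)" "\<lambda>z. uy (sw z)" "\<lambda>z. ux (sw z)"
          "\<lambda>z. uyy (sw z)" "\<lambda>z. uyx (sw z)"])
       (use h R u uy in \<open>auto simp: sw intro!: swd\<close>)
  then obtain t' s' where st': "0 < t'" "t' < h" "0 < s'" "s' < h"
    "u (Complex (x + h) (y + h)) - u (Complex x (y + h)) - u (Complex (x + h) y) + u (Complex x y)
      = h * h * uyx (Complex (x + s') (y + t'))"
    by (auto simp: sw)
  have "h * h * uxy (Complex (x + s) (y + t)) = h * h * uyx (Complex (x + s') (y + t'))"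
    using st(5) st'(5) by linarith
  then have eq: "uxy (Complex (x + s) (y + t)) = uyx (Complex (x + s') (y + t'))" using h by simp
  have "\<bar>uxy (Complex (x + s) (y + t)) - uxy z\<bar> < e"
    using near[of s t] R[of s t] st by (intro d1) (auto simp: h_def)
  moreover have "\<bar>uyx (Complex (x + s') (y + t')) - uyx z\<bar> < e"
    using near[of s' t'] R[of s' t'] st' by (intro d2) (auto simp: h_def)
  ultimately have "\<bar>uxy z - uyx z\<bar> < 2 * e" using eq by linarith
  then show False by (simp add: e_def)
qed

text \<open>By the symmetry of the second derivative, \<open>u\<^sub>x - \<i> u\<^sub>y\<close> satisfies the Cauchy-Riemann equations;
  a primitive of it has real part \<open>u\<close> up to a constant.\<close>

lemma harmonic_on_convex_Re:
  assumes S: "open S" "convex S" and u: "harmonic_on S u"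
  obtains f where "f holomorphic_on S" "\<And>z. z \<in> S \<Longrightarrow> u z = Re (f z)"
proof (cases "S = {}")
  case True
  then show ?thesis by (intro that[of "\<lambda>_. 0"] holomorphic_on_const) blast
next
  case False
  then obtain a where a: "a \<in> S" by blast
  obtain ux uy uxx uxy uyx uyy where
    d: "\<And>z. z \<in> S \<Longrightarrow> (u has_derivative (\<lambda>h. ux z * Re h + uy z * Im h)) (at z)"
      "\<And>z. z \<in> S \<Longrightarrow> (ux has_derivative (\<lambda>h. uxx z * Re h + uxy z * Im h)) (at z)"
      "\<And>z. z \<in> S \<Longrightarrow> (uy has_derivative (\<lambda>h. uyx z * Re h + uyy z * Im h)) (at z)"
      "\<And>z. z \<in> S \<Longrightarrow> uxx z + uyy z = 0"
    and c: "continuous_on (S) uxy" "continuous_on (S) uyx"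
    using u unfolding harmonic_on_def by blast
  have mixed: "uxy z = uyx z" if "z \<in> S" for z
    using mixed_partials_eq[OF S(1) that d(1-3) c] .
  define G where "G = (\<lambda>z. of_real (ux z) - \<i> * of_real (uy z))"
  have "G holomorphic_on S"
    unfolding holomorphic_on_open[OF S(1)]
  proof
    fix z assume z: "z \<in> S"
    have "(G has_derivative (\<lambda>h. of_real (uxx z * Re h + uxy z * Im h) - \<i> * of_real (uyx z * Re h + uyy z * Im h))) (at z)"
      unfolding G_def using d[OF z] by (intro derivative_intros) auto
    moreover have "(\<lambda>h. of_real (uxx z * Re h + uxy z * Im h) - \<i> * of_real (uyx z * Re h + uyy z * Im h))
      = (\<lambda>h. Complex (uxx z) (- uyx z) * h)"
    proof -
      have "uyy z = - uxx z" using d(4)[OF z] by simp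
      then show ?thesis using mixed[OF z] by (simp add: fun_eq_iff complex_eq_iff algebra_simps)
    qed
    ultimately show "\<exists>f'. (G has_field_derivative f') (at z)"
      unfolding has_field_derivative_def by metis
  qed
  then obtain f where f: "\<And>z. z \<in> S \<Longrightarrow> (f has_field_derivative G z) (at z)"
    using holomorphic_convex_primitive'[of S G] at_within_open[OF _ S(1)] S by metis
  define k where "k = u a - Re (f a)"
  have "u z - Re (f z) = k" if z: "z \<in> S" for z
  proof -
    have "\<exists>k. \<forall>z\<in>S. u z - Re (f z) = k"
    proof (rule has_derivative_zero_constant)
      fix z assume z: "z \<in> S"
      have "((\<lambda>z. u z - Re (f z)) has_derivative (\<lambda>h. (ux z * Re h + uy z * Im h) - Re (G z * h))) (at z)"
        using d(1)[OF z] f[OF z] unfolding has_field_derivative_def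
        by (intro has_derivative_diff bounded_linear.has_derivative[OF bounded_linear_Re])
      moreover have "(\<lambda>h. (ux z * Re h + uy z * Im h) - Re (G z * h)) = (\<lambda>h. 0)"
        by (simp add: G_def fun_eq_iff)
      ultimately show "((\<lambda>z. u z - Re (f z)) has_derivative (\<lambda>h. 0)) (at z within S)"
        using has_derivative_at_withinI by simp
    qed (use S in auto)
    then show ?thesis using z a unfolding k_def by metis
  qed
  moreover have "(\<lambda>z. f z + of_real k) holomorphic_on S"
    using f by (intro holomorphic_intros) (auto simp: holomorphic_on_open[OF S(1)])
  ultimately show ?thesis by (intro that[of "\<lambda>z. f z + of_real k"]) (auto simp: algebra_simps)
qed

lemma harmonic_on_subset: "harmonic_on S u \<Longrightarrow> T \<subseteq> S \<Longrightarrow> harmonic_on T u"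
  unfolding harmonic_on_def by (elim exE, intro exI) (auto intro: continuous_on_subset)

theorem harmonic_on_iff_mvp:
  assumes S: "open S"
  shows "harmonic_on S u \<longleftrightarrow> mvp S u"
proof
  assume u: "harmonic_on S u"
  show "mvp S u"
  proof (rule mvp_local)
    fix z assume "z \<in> S"
    then obtain r where r: "r > 0" "ball z r \<subseteq> S" using openE[OF S] by metis
    obtain f where f: "f holomorphic_on ball z r" "\<And>w. w \<in> ball z r \<Longrightarrow> u w = Re (f w)"
      using harmonic_on_convex_Re[OF open_ball convex_ball harmonic_on_subset[OF u r(2)]] by blast
    have "mvp (ball z r) u"
      by (rule mvp_cong[OF open_ball mvp_Re_holomorphic[OF f(1) open_ball]]) (simp add: f(2))
    then show "\<exists>T. open T \<and> z \<in> T \<and> mvp T u" using r(1) by (intro exI[of _ "ball z r"]) auto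
  qed
qed (use mvp_imp_harmonic_on[OF S] in blast)

lemma mvp_ln_cmod: "mvp (- {b}) (\<lambda>z. ln (cmod (z - b)))"
proof -
  have "harmonic_on (- {b}) (\<lambda>z. ln (cmod (z - b)))"
  proof (rule harmonic_on_local_Re)
    fix z assume z: "z \<in> - {b}"
    define c where "c = z - b"
    have c: "c \<noteq> 0" using z by (simp add: c_def)
    define f where "f = (\<lambda>w. Ln ((w - b) / c) + of_real (ln (cmod c)))"
    have pos: "Re ((w - b) / c) > 0" if "w \<in> ball z (cmod c)" for w
    proof -
      have "cmod ((w - b) / c - 1) < 1"
      proof -
        have "(w - b) / c - 1 = (w - z) / c" using c by (simp add: c_def field_simps)
        then show ?thesis using that c by (simp add: norm_divide dist_norm norm_minus_commute)
      qed
      then show ?thesis using abs_Re_le_cmod[of "(w - b) / c - 1"] by simp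
    qed
    have slit: "(w - b) / c \<notin> \<real>\<^sub>\<le>\<^sub>0" if "w \<in> ball z (cmod c)" for w
      using pos[OF that] by (auto simp: complex_nonpos_Reals_iff)
    have "f holomorphic_on ball z (cmod c)"
      unfolding f_def using c slit by (intro holomorphic_intros) blast+
    moreover have "ln (cmod (w - b)) = Re (f w)" if "w \<in> ball z (cmod c)" for w
    proof -
      have "w \<noteq> b" using pos[OF that] by auto
      then show ?thesis using c by (simp add: f_def norm_divide ln_div)
    qed
    ultimately show "\<exists>r>0. \<exists>f. f holomorphic_on ball z r \<and> (\<forall>w\<in>ball z r. ln (cmod (w - b)) = Re (f w))"
      using c by (intro exI[of _ "cmod c"] conjI exI[of _ f]) auto
  qed auto
  then show ?thesis using harmonic_on_iff_mvp[of "- {b}"] by auto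
qed

section \<open>Harnack's inequality\<close>

lemma poisson_kernel_bounds:
  assumes z: "z \<in> ball a r" and \<zeta>: "\<zeta> \<in> sphere a r"
  shows "(r - dist a z) / (r + dist a z) \<le> poisson_kernel a r z \<zeta>"
    and "poisson_kernel a r z \<zeta> \<le> (r + dist a z) / (r - dist a z)"
proof -
  define w where "w = dist a z"
  have w: "0 \<le> w" "w < r" using z by (auto simp: w_def)
  have eq: "r\<^sup>2 - (cmod (z - a))\<^sup>2 = (r - w) * (r + w)"
    by (simp add: w_def dist_norm norm_minus_commute power2_eq_square algebra_simps)
  have up: "cmod (\<zeta> - z) \<le> r + w"
    using \<zeta> dist_triangle[of \<zeta> z a] by (simp add: w_def dist_norm norm_minus_commute)
  have lo: "r - w \<le> cmod (\<zeta> - z)"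
    using \<zeta> dist_triangle[of a \<zeta> z] by (simp add: w_def dist_norm norm_minus_commute)
  have "(r - w) * (r + w) / (r + w)\<^sup>2 \<le> (r - w) * (r + w) / (cmod (\<zeta> - z))\<^sup>2"
    using w up lo by (intro divide_left_mono power_mono mult_pos_pos zero_less_power) auto
  moreover have "(r - w) * (r + w) / (r + w)\<^sup>2 = (r - w) / (r + w)"
    using w by (simp add: power2_eq_square)
  ultimately show "(r - dist a z) / (r + dist a z) \<le> poisson_kernel a r z \<zeta>"
    unfolding poisson_kernel_def eq by (simp add: w_def)
  have "(r - w) * (r + w) / (cmod (\<zeta> - z))\<^sup>2 \<le> (r - w) * (r + w) / (r - w)\<^sup>2"
    using w lo by (intro divide_left_mono power_mono mult_pos_pos zero_less_power) auto
  moreover have "(r - w) * (r + w) / (r - w)\<^sup>2 = (r + w) / (r - w)"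
    using w by (simp add: power2_eq_square)
  ultimately show "poisson_kernel a r z \<zeta> \<le> (r + dist a z) / (r - dist a z)"
    unfolding poisson_kernel_def eq by (simp add: w_def)
qed

lemma mvp_circ_mean:
  assumes S: "open S" and u: "mvp S u" and sub: "cball a r \<subseteq> S" and r: "0 < r"
  shows "circ_mean u a r = u a"
proof -
  have c: "continuous_on (cball a r) u" using mvp_continuous[OF u] sub continuous_on_subset by blast
  have b: "mvp (ball a r) u" using mvp_subset[OF u] sub by (meson ball_subset_cball order_trans)
  have "u a = poisson u a r a" using r by (intro mvp_eq_poisson[OF c b]) auto
  also have "\<dots> = circ_mean u a r"
    unfolding poisson_def using r
    by (intro circ_mean_cong) (auto simp: poisson_kernel_def dist_norm norm_minus_commute)
  finally show ?thesis by simp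
qed

lemma harnack:
  assumes S: "open S" and u: "mvp S u" and sub: "cball a r \<subseteq> S"
    and nonneg: "\<And>z. z \<in> sphere a r \<Longrightarrow> 0 \<le> u z" and z: "z \<in> ball a r"
  shows "(r - dist a z) / (r + dist a z) * u a \<le> u z"
    and "u z \<le> (r + dist a z) / (r - dist a z) * u a"
proof -
  have r: "0 < r" using ball_radius_pos[OF z] .
  have c: "continuous_on (cball a r) u" using mvp_continuous[OF u] sub continuous_on_subset by blast
  have cs: "continuous_on (sphere a r) u" using c by (rule continuous_on_subset) auto
  have b: "mvp (ball a r) u" using mvp_subset[OF u] sub by (meson ball_subset_cball order_trans)
  have uz: "u z = circ_mean (\<lambda>\<zeta>. poisson_kernel a r z \<zeta> * u \<zeta>) a r"
    using mvp_eq_poisson[OF c b z] by (simp add: poisson_def)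
  have ua: "u a = circ_mean u a r" using mvp_circ_mean[OF S u sub r] by simp
  have cp: "continuous_on (sphere a r) (poisson_kernel a r z)" using continuous_on_poisson_kernel[OF z] .
  show "(r - dist a z) / (r + dist a z) * u a \<le> u z"
    unfolding uz ua circ_mean_cmult[symmetric]
    using poisson_kernel_bounds(1)[OF z] nonneg r cs cp
    by (intro circ_mean_le[of "sphere a r"] continuous_intros mult_right_mono) auto
  show "u z \<le> (r + dist a z) / (r - dist a z) * u a"
    unfolding uz ua circ_mean_cmult[symmetric]
    using poisson_kernel_bounds(2)[OF z] nonneg r cs cp
    by (intro circ_mean_le[of "sphere a r"] continuous_intros mult_right_mono) auto
qed

lemma harnack_oscillation:
  assumes "open S" "mvp S u" "cball a r \<subseteq> S" "\<And>z. z \<in> sphere a r \<Longrightarrow> 0 \<le> u z" "z \<in> ball a r"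
  shows "\<bar>u z - u a\<bar> \<le> 2 * dist a z / (r - dist a z) * u a"
proof -
  define w where "w = dist a z"
  have w: "0 \<le> w" "w < r" using assms(5) by (auto simp: w_def)
  have ua: "0 \<le> u a"
    using harnack(2)[OF assms(1-4), of a] mvp_circ_mean[OF assms(1-3)] w
      circ_mean_le[of "sphere a r" "\<lambda>_. 0" u a r] assms(4)
      continuous_on_subset[OF mvp_continuous[OF assms(2)], of "sphere a r"] assms(3)
    by (auto simp: subset_iff)
  have "u z \<le> (r + w) / (r - w) * u a" using harnack(2)[OF assms] by (simp add: w_def)
  moreover have "(r + w) / (r - w) * u a = u a + 2 * w / (r - w) * u a"
    using w by (simp add: field_simps)
  moreover have "(r - w) / (r + w) * u a \<le> u z" using harnack(1)[OF assms] by (simp add: w_def)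
  moreover have "u a - 2 * w / (r - w) * u a \<le> (r - w) / (r + w) * u a"
  proof -
    have "2 * w / (r + w) \<le> 2 * w / (r - w)" using w by (intro divide_left_mono) auto
    moreover have "(r - w) / (r + w) = 1 - 2 * w / (r + w)" using w by (simp add: field_simps)
    ultimately have "1 - 2 * w / (r - w) \<le> (r - w) / (r + w)" by simp
    from mult_right_mono[OF this ua] show ?thesis by (simp add: algebra_simps)
  qed
  ultimately show ?thesis by (auto simp: w_def abs_le_iff)
qed

section \<open>The least harmonic majorant\<close>

text \<open>Harnack's inequality for the differences turns convergence at one point into uniform
  convergence near it.\<close>

lemma mvp_increasing_limit:
  assumes S: "open S" and f: "\<And>k. mvp S (f k)"
    and inc: "\<And>z k l. z \<in> S \<Longrightarrow> k \<le> l \<Longrightarrow> f k z \<le> f l z"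
    and lim: "\<And>z. z \<in> S \<Longrightarrow> (\<lambda>k. f k z) \<longlonglongrightarrow> h z"
  shows "mvp S h"
proof -
  have upper: "f k z \<le> h z" if "z \<in> S" for k z
    using lim[OF that] inc[OF that] by (intro incseq_le) (auto simp: incseq_def)
  have main: "continuous_on (cball z \<rho>) h \<and> (\<forall>r. 0 < r \<longrightarrow> r < \<rho> \<longrightarrow> h z = circ_mean h z r)"
    if \<rho>: "\<rho> > 0" and sub: "cball z (2 * \<rho>) \<subseteq> S" for z \<rho>
  proof -
    have zS: "z \<in> S" using sub \<rho> by auto
    have cS: "cball z \<rho> \<subseteq> S" using sub \<rho> by (auto simp: subset_iff)
    have est: "h w - f k w \<le> 3 * (h z - f k z)" if w: "w \<in> cball z \<rho>" for w k
    proof -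
      have "f l w - f k w \<le> 3 * (f l z - f k z)" if "k \<le> l" for l
      proof -
        have wb: "w \<in> ball z (2 * \<rho>)" using w \<rho> by auto
        have "f l w - f k w \<le> (2 * \<rho> + dist z w) / (2 * \<rho> - dist z w) * (f l z - f k z)"
          using sub inc[OF _ that]
          by (intro harnack(2)[OF S mvp_diff[OF S f f] sub _ wb]) (simp add: subset_iff)
        also have "\<dots> \<le> 3 * (f l z - f k z)"
          using w \<rho> inc[OF zS that] by (intro mult_right_mono) (auto simp: divide_le_eq)
        finally show ?thesis .
      qed
      moreover have "(\<lambda>l. f l w - f k w) \<longlonglongrightarrow> h w - f k w"
        using w cS by (intro tendsto_intros lim) auto
      moreover have "(\<lambda>l. 3 * (f l z - f k z)) \<longlonglongrightarrow> 3 * (h z - f k z)"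
        by (intro tendsto_intros lim zS)
      ultimately show ?thesis by (intro LIMSEQ_le) auto
    qed
    have "uniform_limit (cball z \<rho>) f h sequentially"
      unfolding uniform_limit_iff
    proof (intro allI impI)
      fix e :: real assume "e > 0"
      then have "\<forall>\<^sub>F k in sequentially. dist (f k z) (h z) < e / 3"
        using lim[OF zS] tendstoD by (metis divide_pos_pos zero_less_numeral)
      then show "\<forall>\<^sub>F k in sequentially. \<forall>w\<in>cball z \<rho>. dist (f k w) (h w) < e"
      proof eventually_elim
        case (elim k)
        show ?case
        proof
          fix w assume w: "w \<in> cball z \<rho>"
          show "dist (f k w) (h w) < e"
            using est[OF w, of k] upper[of w k] upper[OF zS, of k] w cS elim
            by (auto simp: dist_real_def subset_iff)
        qed
      qed
    qed
    then have ch: "continuous_on (cball z \<rho>) h"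
      using continuous_on_subset[OF mvp_continuous[OF f] cS]
      by (intro uniform_limit_theorem[where f = f and F = sequentially]) auto
    moreover have "h z = circ_mean h z r" if r: "0 < r" "r < \<rho>" for r
    proof -
      have cf: "continuous_on (cball z \<rho>) (f k)" for k
        using mvp_continuous[OF f] cS by (rule continuous_on_subset)
      have sr: "sphere z r \<subseteq> cball z \<rho>" using r by auto
      have m: "circ_mean (f k) z r = f k z" for k
        using r cS by (intro mvp_circ_mean[OF S f]) auto
      have lo: "f k z \<le> circ_mean h z r" for k
        unfolding m[symmetric] using r sr cS by (intro circ_mean_le[OF cf ch] upper) auto
      have "circ_mean h z r \<le> circ_mean (\<lambda>w. f k w + 3 * (h z - f k z)) z r" for k
      proof (rule circ_mean_le[OF ch _ sr])
        show "continuous_on (cball z \<rho>) (\<lambda>w. f k w + 3 * (h z - f k z))" by (intro continuous_intros cf)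
        fix w assume "w \<in> sphere z r"
        then show "h w \<le> f k w + 3 * (h z - f k z)" using est[of w k] sr by fastforce
      qed (use r in auto)
      also have "circ_mean (\<lambda>w. f k w + 3 * (h z - f k z)) z r = f k z + 3 * (h z - f k z)" for k
        using m r sr by (subst circ_mean_add[OF cf _ sr]) auto
      finally have hi: "circ_mean h z r \<le> f k z + 3 * (h z - f k z)" for k .
      have "h z \<le> circ_mean h z r" using lo by (intro LIMSEQ_le_const2[OF lim[OF zS]]) auto
      moreover have "(\<lambda>k. f k z + 3 * (h z - f k z)) \<longlonglongrightarrow> h z + 3 * (h z - h z)"
        by (intro tendsto_intros lim zS)
      then have "circ_mean h z r \<le> h z + 3 * (h z - h z)" using hi by (intro LIMSEQ_le_const) auto
      ultimately show ?thesis by simp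
    qed
    ultimately show ?thesis by blast
  qed
  have ex: "\<exists>\<rho>>0. cball z (2 * \<rho>) \<subseteq> S" if "z \<in> S" for z
  proof -
    obtain e where "e > 0" "cball z e \<subseteq> S" using S \<open>z \<in> S\<close> open_contains_cball by blast
    then show ?thesis by (intro exI[of _ "e / 2"]) auto
  qed
  show ?thesis unfolding mvp_def
  proof (intro conjI ballI)
    show "continuous_on S h"
    proof (rule continuous_at_imp_continuous_on, rule ballI)
      fix z assume "z \<in> S"
      then obtain \<rho> where \<rho>: "\<rho> > 0" "cball z (2 * \<rho>) \<subseteq> S" using ex by blast
      then have "continuous_on (ball z \<rho>) h" using main[OF \<rho>] by (meson ball_subset_cball continuous_on_subset)
      then show "isCont h z" using \<rho> by (simp add: continuous_on_eq_continuous_at)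
    qed
    show "mean_at h z" if "z \<in> S" for z
      unfolding mean_at_def using ex[OF that] main by meson
  qed
qed

lemma poisson_mod_properties:
  assumes S: "open S" and sub: "cball a r \<subseteq> S" and r: "0 < r"
    and cont: "continuous_on UNIV \<psi>" and sm: "\<And>z. z \<in> S \<Longrightarrow> submean \<psi> z"
  shows "continuous_on UNIV (poisson_mod a r \<psi>)"
    and "mvp (ball a r) (poisson_mod a r \<psi>)"
    and "\<psi> z \<le> poisson_mod a r \<psi> z"
    and "z \<in> S \<Longrightarrow> submean (poisson_mod a r \<psi>) z"
    and "mvp S H \<Longrightarrow> (\<And>z. z \<in> S \<Longrightarrow> \<psi> z \<le> H z) \<Longrightarrow> z \<in> S \<Longrightarrow> poisson_mod a r \<psi> z \<le> H z"
proof -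
  have cs: "continuous_on (sphere a r) \<psi>" using cont continuous_on_subset by blast
  have cb: "continuous_on (cball a r) (poisson_mod a r \<psi>)" using continuous_on_poisson_mod_cball[OF cs r] .
  have "continuous_on (- ball a r) (poisson_mod a r \<psi>)"
    using continuous_on_subset[OF cont, of "- ball a r"]
    by (rule continuous_on_eq) (auto simp: poisson_mod_def)
  then have "continuous_on (cball a r \<union> - ball a r) (poisson_mod a r \<psi>)"
    by (intro continuous_on_closed_Un cb) auto
  moreover have "cball a r \<union> - ball a r = UNIV" by auto
  ultimately show c: "continuous_on UNIV (poisson_mod a r \<psi>)" by simp
  show m: "mvp (ball a r) (poisson_mod a r \<psi>)"
    by (rule mvp_cong[OF open_ball mvp_poisson[OF cs]]) (simp add: poisson_mod_def)
  have le: "\<psi> w - poisson_mod a r \<psi> w \<le> 0" if "w \<in> cball a r" for w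
  proof (rule max_principle_compact[OF _ _ _ that])
    show "continuous_on (cball a r) (\<lambda>z. \<psi> z - poisson_mod a r \<psi> z)"
      using continuous_on_subset[OF cont] cb by (intro continuous_intros) auto
    fix z assume z: "z \<in> cball a r" "\<psi> z - poisson_mod a r \<psi> z > 0"
    then have zb: "z \<in> ball a r" by (auto simp: poisson_mod_def split: if_splits)
    have "z \<in> S" using zb sub by auto
    have "submean (\<lambda>z. \<psi> z + -1 * poisson_mod a r \<psi> z) z"
      using zb sm[OF \<open>z \<in> S\<close>]
      by (intro submean_add[of "ball a r"] mean_at_submean[OF mean_at_cmult] mvp_mean_at[OF m])
         (auto intro!: continuous_intros continuous_on_subset[OF c] continuous_on_subset[OF cont])
    then show "z \<in> interior (cball a r) \<and> submean (\<lambda>z. \<psi> z - poisson_mod a r \<psi> z) z" using zb by simp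
  qed auto
  show ge: "\<psi> z \<le> poisson_mod a r \<psi> z" for z using le[of z]
    by (cases "z \<in> ball a r") (auto simp: poisson_mod_def)
  show "submean (poisson_mod a r \<psi>) z" if z: "z \<in> S" for z
  proof (cases "z \<in> ball a r")
    case True
    then show ?thesis using mvp_submean[OF m] by blast
  next
    case False
    obtain r0 where r0: "r0 > 0" "\<And>\<rho>. 0 < \<rho> \<Longrightarrow> \<rho> < r0 \<Longrightarrow> \<psi> z \<le> circ_mean \<psi> z \<rho>"
      using sm[OF z] unfolding submean_def by blast
    show ?thesis unfolding submean_def
    proof (intro exI[of _ r0] conjI allI impI r0(1))
      fix \<rho> assume \<rho>: "0 < \<rho>" "\<rho> < r0"
      have "poisson_mod a r \<psi> z = \<psi> z" using False by (simp add: poisson_mod_def)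
      also have "\<dots> \<le> circ_mean \<psi> z \<rho>" using r0 \<rho> by blast
      also have "\<dots> \<le> circ_mean (poisson_mod a r \<psi>) z \<rho>"
        using \<rho> ge by (intro circ_mean_le[OF cont c]) auto
      finally show "poisson_mod a r \<psi> z \<le> circ_mean (poisson_mod a r \<psi>) z \<rho>" .
    qed
  qed
  show "poisson_mod a r \<psi> z \<le> H z"
    if H: "mvp S H" and maj: "\<And>z. z \<in> S \<Longrightarrow> \<psi> z \<le> H z" and z: "z \<in> S" for z
  proof (cases "z \<in> ball a r")
    case True
    have "poisson_mod a r \<psi> z - H z \<le> 0"
    proof (rule max_principle_compact[of "cball a r" "\<lambda>z. poisson_mod a r \<psi> z - H z"])
      show "continuous_on (cball a r) (\<lambda>z. poisson_mod a r \<psi> z - H z)"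
        using cb continuous_on_subset[OF mvp_continuous[OF H] sub] by (intro continuous_intros)
      fix z assume z: "z \<in> cball a r" "poisson_mod a r \<psi> z - H z > 0"
      then have zb: "z \<in> ball a r" using maj[of z] sub by (auto simp: poisson_mod_def split: if_splits)
      have "mvp (ball a r) H" using mvp_subset[OF H] sub by (meson ball_subset_cball order_trans)
      from mvp_diff[OF open_ball m this] mvp_submean zb
      show "z \<in> interior (cball a r) \<and> submean (\<lambda>z. poisson_mod a r \<psi> z - H z) z" by auto
    qed (use True in auto)
    then show ?thesis by simp
  next
    case False
    then show ?thesis using maj[OF z] by (simp add: poisson_mod_def)
  qed
qed

lemma countable_disc_cover:
  assumes S: "open (S :: complex set)" "S \<noteq> {}"
  shows "\<exists>D :: nat \<Rightarrow> complex \<times> real.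
    (\<forall>n. 0 < snd (D n) \<and> cball (fst (D n)) (snd (D n)) \<subseteq> S) \<and>
    (\<forall>z\<in>S. \<exists>d. z \<in> ball (fst d) (snd d) \<and> infinite {n. D n = d})"
proof -
  define P where "P = {(a :: complex, r :: real). 0 < r \<and> cball a r \<subseteq> S}"
  define F where "F = (\<lambda>(a, r). ball a r) ` P"
  have "\<Union>F = S"
  proof
    show "\<Union>F \<subseteq> S" unfolding F_def P_def using ball_subset_cball by fastforce
    show "S \<subseteq> \<Union>F"
    proof
      fix z assume "z \<in> S"
      then obtain e where "e > 0" "cball z e \<subseteq> S" using S(1) open_contains_cball by blast
      then have "ball z e \<in> F" "z \<in> ball z e"
        unfolding F_def P_def by (auto intro!: image_eqI[of _ _ "(z, e)"])
      then show "z \<in> \<Union>F" by blast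
    qed
  qed
  moreover have "\<And>T. T \<in> F \<Longrightarrow> open T" by (auto simp: F_def)
  ultimately obtain F' where F': "F' \<subseteq> F" "countable F'" "\<Union>F' = S"
    using Lindelof by metis
  then obtain P' where P': "P' \<subseteq> P" "countable P'" "F' = (\<lambda>(a, r). ball a r) ` P'"
    unfolding F_def using countable_subset_image by metis
  have ne: "P' \<noteq> {}" using F' P' S(2) by auto
  define D where "D = (\<lambda>n. from_nat_into P' (fst (prod_decode n)))"
  have DP: "D n \<in> P" for n unfolding D_def using from_nat_into[OF ne] P'(1) by blast
  show ?thesis
  proof (intro exI[of _ D] conjI allI ballI)
    show "0 < snd (D n)" "cball (fst (D n)) (snd (D n)) \<subseteq> S" for n
      using DP[of n] by (auto simp: P_def case_prod_unfold)
    fix z assume "z \<in> S"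
    then obtain d where d: "d \<in> P'" "z \<in> ball (fst d) (snd d)"
      using F'(3) P'(3) by (auto simp: case_prod_unfold)
    obtain i where i: "from_nat_into P' i = d" using from_nat_into_surj[OF P'(2) d(1)] by blast
    have "range (\<lambda>k. prod_encode (i, k)) \<subseteq> {n. D n = d}" by (auto simp: D_def i)
    moreover have "infinite (range (\<lambda>k. prod_encode (i, k)))"
      by (rule range_inj_infinite) (auto simp: inj_on_def)
    ultimately show "\<exists>d. z \<in> ball (fst d) (snd d) \<and> infinite {n. D n = d}"
      using d(2) infinite_super by blast
  qed
qed

text \<open>Poincare's sweeping: replace \<open>\<psi>\<close> by Poisson integrals in a sequence of discs that covers \<open>S\<close>
  and returns to every disc infinitely often.  The functions increase, stay below every harmonic
  majorant, and a subsequence is harmonic in any given disc.  The approximating sequence is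
  recorded as well, because its boundary values are those of \<open>\<psi>\<close>.\<close>

theorem least_harmonic_majorant:
  assumes S: "open S" "S \<noteq> {}" and cont: "continuous_on UNIV \<psi>"
    and sm: "\<And>z. z \<in> S \<Longrightarrow> submean \<psi> z"
    and H0: "mvp S H0" "\<And>z. z \<in> S \<Longrightarrow> \<psi> z \<le> H0 z"
  obtains h \<psi>s where "mvp S h"
    "\<And>k. continuous_on UNIV (\<psi>s k)" "\<And>k z. z \<in> S \<Longrightarrow> submean (\<psi>s k) z"
    "\<And>k z. z \<notin> S \<Longrightarrow> \<psi>s k z = \<psi> z" "\<And>z. z \<in> S \<Longrightarrow> (\<lambda>k. \<psi>s k z) \<longlonglongrightarrow> h z"
    "\<forall>k H. mvp S H \<longrightarrow> (\<forall>z\<in>S. \<psi> z \<le> H z) \<longrightarrow> (\<forall>z\<in>S. \<psi>s k z \<le> H z)"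
    "\<And>z. z \<in> S \<Longrightarrow> \<psi> z \<le> h z"
    "\<forall>H. mvp S H \<longrightarrow> (\<forall>z\<in>S. \<psi> z \<le> H z) \<longrightarrow> (\<forall>z\<in>S. h z \<le> H z)"
proof -
  obtain D :: "nat \<Rightarrow> complex \<times> real" where D0: "(\<forall>n. 0 < snd (D n) \<and> cball (fst (D n)) (snd (D n)) \<subseteq> S) \<and>
    (\<forall>z\<in>S. \<exists>d. z \<in> ball (fst d) (snd d) \<and> infinite {n. D n = d})"
    using countable_disc_cover[OF S] ..
  then have D: "\<And>n. 0 < snd (D n)" "\<And>n. cball (fst (D n)) (snd (D n)) \<subseteq> S"
    "\<And>z. z \<in> S \<Longrightarrow> \<exists>d. z \<in> ball (fst d) (snd d) \<and> infinite {n. D n = d}"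
    by simp_all
  define f where "f = rec_nat \<psi> (\<lambda>n. poisson_mod (fst (D n)) (snd (D n)))"
  have f0: "f 0 = \<psi>" and fS: "f (Suc n) = poisson_mod (fst (D n)) (snd (D n)) (f n)" for n
    by (simp_all add: f_def)
  have inv: "continuous_on UNIV (f n) \<and> (\<forall>z\<in>S. submean (f n) z)" for n
    by (induction n)
       (simp_all add: f0 fS cont sm poisson_mod_properties(1,4)[OF S(1) D(2) D(1)])
  note step = poisson_mod_properties[OF S(1) D(2) D(1) conjunct1[OF inv] bspec[OF conjunct2[OF inv]]]
  have inc1: "f n z \<le> f (Suc n) z" for n z unfolding fS by (rule step(3))
  have inc: "f k z \<le> f l z" if "k \<le> l" for k l z
    using lift_Suc_mono_le[of "\<lambda>n. f n z", OF inc1 that] .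
  have bd: "f n z \<le> H z" if "mvp S H" "\<And>z. z \<in> S \<Longrightarrow> \<psi> z \<le> H z" "z \<in> S" for n H z
    using that(3)
  proof (induction n arbitrary: z)
    case (Suc n)
    show ?case unfolding fS by (rule step(5)[OF _ that(1) Suc.IH Suc.prems])
  qed (use that in \<open>simp add: f0\<close>)
  have out: "f n z = \<psi> z" if "z \<notin> S" for n z
  proof (induction n)
    case (Suc n)
    have "z \<notin> ball (fst (D n)) (snd (D n))" using D(2)[of n] that ball_subset_cball by blast
    then show ?case using Suc by (simp add: fS poisson_mod_def)
  qed (simp add: f0)
  define h where "h = (\<lambda>z. lim (\<lambda>n. f n z))"
  have lim: "(\<lambda>n. f n z) \<longlonglongrightarrow> h z" if "z \<in> S" for z
  proof -
    have "incseq (\<lambda>n. f n z)" using inc by (simp add: incseq_def)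
    moreover have "\<forall>n. f n z \<le> H0 z" using bd[OF H0 that] by blast
    ultimately obtain L where "(\<lambda>n. f n z) \<longlonglongrightarrow> L" by (rule incseq_convergent)
    then have "convergent (\<lambda>n. f n z)" unfolding convergent_def by blast
    then show ?thesis unfolding h_def by (simp add: convergent_LIMSEQ_iff)
  qed
  have "mvp S h"
  proof (rule mvp_local)
    fix z assume "z \<in> S"
    then obtain d where d: "z \<in> ball (fst d) (snd d)" "infinite {n. D n = d}" using D(3) by blast
    define e where "e = enumerate {n. D n = d}"
    have e: "strict_mono e" "\<And>k. D (e k) = d"
      using strict_mono_enumerate[OF d(2)] enumerate_in_set[OF d(2)] by (auto simp: e_def)
    have dS: "ball (fst d) (snd d) \<subseteq> S" using D(2)[of "e 0"] e(2)[of 0] ball_subset_cball by auto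
    have "mvp (ball (fst d) (snd d)) h"
    proof (rule mvp_increasing_limit[of _ "\<lambda>k. f (Suc (e k))"])
      show "mvp (ball (fst d) (snd d)) (f (Suc (e k)))" for k
        using step(2)[of "e k"] by (simp add: fS e(2))
      show "f (Suc (e k)) w \<le> f (Suc (e l)) w" if "k \<le> l" for w k l
        using inc e(1) that by (simp add: strict_mono_less_eq)
      show "(\<lambda>k. f (Suc (e k)) w) \<longlonglongrightarrow> h w" if "w \<in> ball (fst d) (snd d)" for w
        using LIMSEQ_subseq_LIMSEQ[OF LIMSEQ_Suc[OF lim[of w]] e(1)] that dS by (auto simp: o_def)
    qed auto
    then show "\<exists>T. open T \<and> z \<in> T \<and> mvp T h" using d(1) by blast
  qed
  moreover have "\<psi> z \<le> h z" if "z \<in> S" for z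
    using LIMSEQ_le_const[OF lim[OF that]] inc[of 0] f0 by auto
  moreover have "h z \<le> H z" if "mvp S H" "\<And>z. z \<in> S \<Longrightarrow> \<psi> z \<le> H z" "z \<in> S" for H z
    using LIMSEQ_le_const2[OF lim[OF that(3)]] bd[OF that] by auto
  ultimately show thesis using inv lim bd out that[of h f] by blast
qed

section \<open>Harnack estimates in a half-plane\<close>

text \<open>Harnack's inequality in a disc around \<open>x + \<i> Y\<close> that stays at distance \<open>y / 2\<close> from the axis.\<close>

lemma vertical_harnack:
  assumes u: "mvp {z. Im z > 0} u" and nonneg: "\<And>z. Im z > 0 \<Longrightarrow> 0 \<le> u z" and y: "0 < y" "y < Y"
  shows "y / (4 * Y) * u (Complex x Y) \<le> u (Complex x y)"
    and "u (Complex x y) \<le> 4 * Y / y * u (Complex x Y)"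
proof -
  define r where "r = Y - y / 2"
  have sub: "cball (Complex x Y) r \<subseteq> {z. Im z > 0}"
  proof
    fix z assume "z \<in> cball (Complex x Y) r"
    then have "\<bar>Y - Im z\<bar> \<le> r"
      using abs_Im_le_cmod[of "Complex x Y - z"] by (simp add: dist_norm)
    then show "z \<in> {z. Im z > 0}" using y by (simp add: r_def)
  qed
  have d: "dist (Complex x Y) (Complex x y) = Y - y"
    using y by (simp add: dist_norm complex_diff cmod_def)
  have b: "Complex x y \<in> ball (Complex x Y) r" using y by (simp add: d r_def)
  have S: "open {z. Im z > 0}" by (simp add: open_halfspace_Im_gt)
  have nn: "0 \<le> u z" if "z \<in> sphere (Complex x Y) r" for z
    using nonneg that sub by (simp add: subset_iff)
  have uc: "0 \<le> u (Complex x Y)" using nonneg y by simp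
  have "y / (4 * Y) \<le> (r - (Y - y)) / (r + (Y - y))"
    using y by (simp add: r_def divide_simps)
  from mult_right_mono[OF this uc] harnack(1)[OF S u sub nn b]
  show "y / (4 * Y) * u (Complex x Y) \<le> u (Complex x y)" by (simp add: d)
  have "(r + (Y - y)) / (r - (Y - y)) \<le> 4 * Y / y"
    using y by (simp add: r_def divide_simps)
  from mult_right_mono[OF this uc] harnack(2)[OF S u sub nn b]
  show "u (Complex x y) \<le> 4 * Y / y * u (Complex x Y)" by (simp add: d)
qed

text \<open>The vertical step from height \<open>y\<close> to height \<open>8 R\<close> costs the factor \<open>32 R / y\<close>, the horizontal
  step at that height the factor \<open>3\<close>.\<close>

lemma half_plane_harnack:
  assumes u: "mvp {z. Im z > 0} u" and nonneg: "\<And>z. Im z > 0 \<Longrightarrow> 0 \<le> u z"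
    and R: "R > 0" and x: "\<bar>x\<bar> \<le> 3 * R" and y: "0 < y" "y < 8 * R"
  shows "y / (96 * R) * u (Complex 0 (8 * R)) \<le> u (Complex x y)"
    and "u (Complex x y) \<le> 96 * R / y * u (Complex 0 (8 * R))"
proof -
  have S: "open {z. Im z > 0}" by (simp add: open_halfspace_Im_gt)
  have sub: "cball (Complex 0 (8 * R)) (6 * R) \<subseteq> {z. Im z > 0}"
  proof
    fix z assume "z \<in> cball (Complex 0 (8 * R)) (6 * R)"
    then have "\<bar>8 * R - Im z\<bar> \<le> 6 * R"
      using abs_Im_le_cmod[of "Complex 0 (8 * R) - z"] by (simp add: dist_norm)
    then show "z \<in> {z. Im z > 0}" using R by simp
  qed
  have d: "dist (Complex 0 (8 * R)) (Complex x (8 * R)) = \<bar>x\<bar>"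
    by (simp add: dist_norm complex_diff cmod_def)
  have b: "Complex x (8 * R) \<in> ball (Complex 0 (8 * R)) (6 * R)" using x R by (simp add: d)
  have nn: "0 \<le> u z" if "z \<in> sphere (Complex 0 (8 * R)) (6 * R)" for z
    using nonneg that sub by (simp add: subset_iff)
  have q: "0 \<le> u (Complex 0 (8 * R))" using nonneg R by simp
  have "0 < 6 * R + \<bar>x\<bar>" using R by linarith
  then have "1 / 3 \<le> (6 * R - \<bar>x\<bar>) / (6 * R + \<bar>x\<bar>)" using x by (simp add: pos_le_divide_eq)
  from order_trans[OF mult_right_mono[OF this q] harnack(1)[OF S u sub nn b, unfolded d]]
  have lo: "1 / 3 * u (Complex 0 (8 * R)) \<le> u (Complex x (8 * R))" .
  have "(6 * R + \<bar>x\<bar>) / (6 * R - \<bar>x\<bar>) \<le> 3" using x R by (simp add: pos_divide_le_eq)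
  from order_trans[OF harnack(2)[OF S u sub nn b, unfolded d] mult_right_mono[OF this q]]
  have hi: "u (Complex x (8 * R)) \<le> 3 * u (Complex 0 (8 * R))" .
  have "y / (96 * R) * u (Complex 0 (8 * R)) = y / (4 * (8 * R)) * (1 / 3 * u (Complex 0 (8 * R)))" by simp
  also have "\<dots> \<le> y / (4 * (8 * R)) * u (Complex x (8 * R))"
    using y R by (intro mult_left_mono lo) auto
  also have "\<dots> \<le> u (Complex x y)" using vertical_harnack(1)[OF u nonneg y] .
  finally show "y / (96 * R) * u (Complex 0 (8 * R)) \<le> u (Complex x y)" .
  have "u (Complex x y) \<le> 4 * (8 * R) / y * u (Complex x (8 * R))"
    using vertical_harnack(2)[OF u nonneg y] .
  also have "\<dots> \<le> 4 * (8 * R) / y * (3 * u (Complex 0 (8 * R)))"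
    using y R by (intro mult_left_mono hi) auto
  finally show "u (Complex x y) \<le> 96 * R / y * u (Complex 0 (8 * R))" by simp
qed

section \<open>Symmetric functions vanishing on the complement\<close>

definition slit_domain :: "complex set \<Rightarrow> bool" where
  "slit_domain \<Omega> \<longleftrightarrow> open \<Omega> \<and> (\<forall>z. Im z \<noteq> 0 \<longrightarrow> z \<in> \<Omega>)"

text \<open>The condition \<open>W = 0\<close> on the complement, together with continuity in the plane, encodes the
  boundary values at the finite boundary points.\<close>

definition sym_cone :: "complex set \<Rightarrow> (complex \<Rightarrow> real) set" where
  "sym_cone \<Omega> = {W. continuous_on UNIV W \<and> (\<forall>z. 0 \<le> W z) \<and> (\<forall>z. W (cnj z) = W z) \<and>
      (\<forall>z. z \<notin> \<Omega> \<longrightarrow> W z = 0) \<and> mvp \<Omega> W}"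

lemma sym_coneD:
  assumes "W \<in> sym_cone \<Omega>"
  shows "continuous_on UNIV W" "0 \<le> W z" "W (cnj z) = W z" "z \<notin> \<Omega> \<Longrightarrow> W z = 0" "mvp \<Omega> W"
    "0 < W z \<Longrightarrow> z \<in> \<Omega>" "0 < W z \<Longrightarrow> mean_at W z"
  using assms mvp_mean_at unfolding sym_cone_def by force+

lemma sym_cone_half_plane:
  assumes \<Omega>: "slit_domain \<Omega>" and W: "W \<in> sym_cone \<Omega>" and R: "R > 0"
    and z: "\<bar>Re z\<bar> \<le> 3 * R" "Im z \<noteq> 0" "\<bar>Im z\<bar> < 8 * R"
  shows "\<bar>Im z\<bar> / (96 * R) * W (Complex 0 (8 * R)) \<le> W z"
    and "W z \<le> 96 * R / \<bar>Im z\<bar> * W (Complex 0 (8 * R))"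
proof -
  have m: "mvp {z. Im z > 0} W"
    using \<Omega> by (intro mvp_subset[OF sym_coneD(5)[OF W]]) (auto simp: slit_domain_def)
  have eq: "W z = W (Complex (Re z) \<bar>Im z\<bar>)"
  proof (cases "Im z > 0")
    case True
    then show ?thesis by (simp add: complex_surj)
  next
    case False
    then have "Complex (Re z) \<bar>Im z\<bar> = cnj z" by (simp add: complex_eq_iff)
    then show ?thesis using sym_coneD(3)[OF W] by simp
  qed
  show "\<bar>Im z\<bar> / (96 * R) * W (Complex 0 (8 * R)) \<le> W z"
    unfolding eq using z by (intro half_plane_harnack[OF m sym_coneD(2)[OF W] R]) auto
  show "W z \<le> 96 * R / \<bar>Im z\<bar> * W (Complex 0 (8 * R))"
    unfolding eq using z by (intro half_plane_harnack[OF m sym_coneD(2)[OF W] R]) auto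
qed

text \<open>A circle centred on the real axis meets it at right angles, and the bound \<open>B / \<bar>Im z\<bar>\<close> is not
  integrable there.  In a square standing on a vertex the corners are
  sharp enough: the bound is dominated on the boundary by the positive harmonic function below.\<close>

lemma diamond_bound:
  fixes W :: "complex \<Rightarrow> real"
  assumes cont: "continuous_on UNIV W" and nonneg: "\<And>z. 0 \<le> W z"
    and mean: "\<And>z. 0 < W z \<Longrightarrow> mean_at W z"
    and R: "R > 0" and B: "B > 0"
    and bound: "\<And>z. \<bar>Re z - x\<bar> \<le> R \<Longrightarrow> \<bar>Im z\<bar> \<le> R \<Longrightarrow> Im z \<noteq> 0 \<Longrightarrow> W z \<le> B / \<bar>Im z\<bar>"
    and y: "\<bar>y\<bar> < R"
  shows "W (Complex x y) \<le> 4 * B / R"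
proof -
  define h where "h = (\<lambda>z :: complex. Re (R / (R - (z - x))) + Re (R / (R + (z - x))))"
  have ReR: "Re (of_real R / v) = R * Re v / (cmod v)\<^sup>2" for v
    by (simp add: Re_divide cmod_power2)
  have hpos: "0 \<le> Re (R / (R - (z - x)))" "0 \<le> Re (R / (R + (z - x)))" if "\<bar>Re z - x\<bar> < R" for z :: complex
    using that R unfolding ReR by (intro divide_nonneg_nonneg mult_nonneg_nonneg; simp)+
  have hm: "mvp {z. \<bar>Re z - x\<bar> < R} h"
  proof -
    have op: "open {z. \<bar>Re z - x\<bar> < R}" by (intro open_Collect_less continuous_intros)
    have "(\<lambda>z :: complex. R / (R - (z - x)) + R / (R + (z - x))) holomorphic_on {z. \<bar>Re z - x\<bar> < R}"
      by (intro holomorphic_intros) (auto simp: complex_eq_iff)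
    from mvp_Re_holomorphic[OF this op] show ?thesis by (simp add: h_def)
  qed
  have "compact (cball (of_real x :: complex) (2 * R))" by simp
  then have "bounded (W ` cball (of_real x) (2 * R))"
    using cont continuous_on_subset compact_continuous_image compact_imp_bounded by blast
  then obtain M where "M > 0" "\<forall>v\<in>W ` cball (of_real x) (2 * R). norm v \<le> M"
    unfolding bounded_pos by blast
  then have M: "W z \<le> M" if "dist (of_real x) z \<le> 2 * R" for z
    using that by (metis abs_le_D1 imageI mem_cball real_norm_def)
  \<comment> \<open>the corners are cut off at distance \<open>\<eta>\<close>, where \<open>h\<close> is so large that it dominates the maximum of \<open>W\<close>\<close>
  define \<eta> where "\<eta> = min ((R - \<bar>y\<bar>)) (min (R / 2) (B / M))"
  have \<eta>: "0 < \<eta>" "\<eta> < R" "M \<le> B / \<eta>"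
  proof -
    show "0 < \<eta>" using y R B \<open>M > 0\<close> by (simp add: \<eta>_def)
    show "\<eta> < R" using R by (simp add: \<eta>_def)
    have "\<eta> \<le> B / M" by (simp add: \<eta>_def)
    then show "M \<le> B / \<eta>" using \<open>0 < \<eta>\<close> \<open>M > 0\<close> by (simp add: field_simps)
  qed
  define S where "S = {z. \<bar>Re z - x\<bar> + \<bar>Im z\<bar> \<le> R \<and> \<bar>Re z - x\<bar> \<le> R - \<eta>}"
  define U where "U = {z. \<bar>Re z - x\<bar> + \<bar>Im z\<bar> < R \<and> \<bar>Re z - x\<bar> < R - \<eta>}"
  have dS: "dist (of_real x) z \<le> 2 * R" if "z \<in> S" for z
    using that cmod_le[of "of_real x - z"] \<eta> by (auto simp: S_def dist_norm abs_minus_commute)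
  have "closed S" unfolding S_def by (intro closed_Collect_conj closed_Collect_le continuous_intros)
  moreover have "S \<subseteq> cball (of_real x) (2 * R)" using dS by auto
  ultimately have cS: "compact S" using compact_eq_bounded_closed bounded_cball bounded_subset by blast
  have oU: "open U" unfolding U_def by (intro open_Collect_conj open_Collect_less continuous_intros)
  have US: "U \<subseteq> interior S" by (intro interior_maximal oU) (auto simp: U_def S_def)
  have Sh: "S \<subseteq> {z. \<bar>Re z - x\<bar> < R}" using \<eta> by (auto simp: S_def)
  define F where "F = (\<lambda>z. W z + - (2 * B / R) * h z)"
  have cF: "continuous_on S F"
    unfolding F_def using continuous_on_subset[OF mvp_continuous[OF hm] Sh] continuous_on_subset[OF cont]
    by (intro continuous_intros) auto
  have edge: "F z \<le> 0" if z: "z \<in> S" "z \<notin> U" for z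
  proof -
    have hz: "Re (R / (R - (z - x))) \<le> h z" "Re (R / (R + (z - x))) \<le> h z"
      using hpos[of z] Sh z by (auto simp: h_def)
    have "W z \<le> 2 * B / R * h z"
    proof (cases "\<bar>Re z - x\<bar> + \<bar>Im z\<bar> = R")
      case True
      then have im: "\<bar>Im z\<bar> = R - \<bar>Re z - x\<bar>" "\<bar>Im z\<bar> > 0" using z \<eta> by (auto simp: S_def)
      have "R / (2 * \<bar>Im z\<bar>) \<le> h z"
      proof (cases "Re z \<ge> x")
        case True
        have "Re (R / (R - (z - x))) = R * \<bar>Im z\<bar> / (\<bar>Im z\<bar>\<^sup>2 + (Im z)\<^sup>2)"
          using True im unfolding ReR cmod_power2 by simp
        also have "\<dots> = R / (2 * \<bar>Im z\<bar>)" using im by (simp add: power2_eq_square field_simps)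
        finally show ?thesis using hz by simp
      next
        case False
        have "Re (R / (R + (z - x))) = R * \<bar>Im z\<bar> / (\<bar>Im z\<bar>\<^sup>2 + (Im z)\<^sup>2)"
        proof -
          have a: "Re (R + (z - x)) = \<bar>Im z\<bar>" using False im by simp
          show ?thesis unfolding ReR cmod_power2 a by simp
        qed
        also have "\<dots> = R / (2 * \<bar>Im z\<bar>)" using im by (simp add: power2_eq_square field_simps)
        finally show ?thesis using hz by simp
      qed
      then have "2 * B / R * (R / (2 * \<bar>Im z\<bar>)) \<le> 2 * B / R * h z"
        using B R by (intro mult_left_mono) auto
      moreover have "2 * B / R * (R / (2 * \<bar>Im z\<bar>)) = B / \<bar>Im z\<bar>" using R by simp
      moreover have "W z \<le> B / \<bar>Im z\<bar>" using im z by (intro bound) auto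
      ultimately show ?thesis by linarith
    next
      case False
      then have re: "\<bar>Re z - x\<bar> = R - \<eta>" "\<bar>Im z\<bar> \<le> \<eta>" using z by (auto simp: S_def U_def)
      have im2: "(Im z)\<^sup>2 \<le> \<eta>\<^sup>2" using re(2) abs_le_square_iff[of "Im z" \<eta>] \<eta> by simp
      have q: "R / (2 * \<eta>) \<le> R * \<eta> / (\<eta>\<^sup>2 + (Im z)\<^sup>2)"
      proof -
        have "R * \<eta> / (\<eta>\<^sup>2 + \<eta>\<^sup>2) \<le> R * \<eta> / (\<eta>\<^sup>2 + (Im z)\<^sup>2)"
          using im2 \<eta> R by (intro divide_left_mono mult_pos_pos add_pos_nonneg) auto
        then show ?thesis using \<eta> by (simp add: power2_eq_square field_simps)
      qed
      have "R / (2 * \<eta>) \<le> h z"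
      proof (cases "Re z \<ge> x")
        case True
        have "Re (R / (R - (z - x))) = R * \<eta> / (\<eta>\<^sup>2 + (Im z)\<^sup>2)"
          using True re unfolding ReR cmod_power2 by simp
        then show ?thesis using hz q by simp
      next
        case False
        have "Re (R / (R + (z - x))) = R * \<eta> / (\<eta>\<^sup>2 + (Im z)\<^sup>2)"
        proof -
          have a: "Re (R + (z - x)) = \<eta>" using False re by simp
          show ?thesis unfolding ReR cmod_power2 a by simp
        qed
        then show ?thesis using hz q by simp
      qed
      then have "2 * B / R * (R / (2 * \<eta>)) \<le> 2 * B / R * h z"
        using B R by (intro mult_left_mono) auto
      moreover have "2 * B / R * (R / (2 * \<eta>)) = B / \<eta>" using R by simp
      moreover have "W z \<le> M" using M dS z by blast
      ultimately show ?thesis using \<eta>(3) by linarith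
    qed
    then show ?thesis by (simp add: F_def)
  qed
  have "F (Complex x y) \<le> 0"
  proof (rule max_principle_compact[OF cS cF])
    fix z assume z: "z \<in> S" "F z > 0"
    then have zU: "z \<in> U" using edge by force
    have "h z \<ge> 0" using hpos[of z] Sh z by (auto simp: h_def)
    then have "- (2 * B / R) * h z \<le> 0" using B R by (simp add: divide_nonneg_pos)
    then have "W z > 0" using z(2) unfolding F_def by linarith
    then have "submean F z"
      unfolding F_def using mean zU US Sh interior_subset[of S]
      by (intro submean_add[of U] mean_at_submean mean_at_cmult mvp_mean_at[OF hm] oU)
         (auto intro!: continuous_intros continuous_on_subset[OF cont]
            continuous_on_subset[OF mvp_continuous[OF hm]])
    then show "z \<in> interior S \<and> submean F z" using zU US by blast
  qed (use y \<eta> in \<open>auto simp: S_def \<eta>_def\<close>)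
  then have "W (Complex x y) \<le> 2 * B / R * h (Complex x y)" by (simp add: F_def)
  also have "\<dots> \<le> 2 * B / R * 2"
  proof (intro mult_left_mono)
    have "Re (R / (R - (Complex x y - x))) = R * R / (R\<^sup>2 + y\<^sup>2)" unfolding ReR cmod_power2 by simp
    moreover have "Re (R / (R + (Complex x y - x))) = R * R / (R\<^sup>2 + y\<^sup>2)" unfolding ReR cmod_power2 by simp
    moreover have "R * R / (R\<^sup>2 + y\<^sup>2) \<le> 1"
      using R by (simp add: divide_le_eq power2_eq_square add_pos_nonneg)
    ultimately show "h (Complex x y) \<le> 2" by (simp add: h_def)
  qed (use B R in auto)
  finally show ?thesis by simp
qed

text \<open>Carleson's estimate: the bound \<open>96 R / \<bar>Im z\<bar>\<close> of the half-plane is fed into the square.\<close>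

lemma carleson_estimate:
  assumes \<Omega>: "slit_domain \<Omega>" and W: "W \<in> sym_cone \<Omega>" and R: "R > 0"
    and z: "\<bar>Re z\<bar> \<le> 2 * R" "\<bar>Im z\<bar> \<le> 2 * R"
  shows "W z \<le> 384 * W (Complex 0 (8 * R))"
proof -
  define q where "q = W (Complex 0 (8 * R))"
  have q: "q \<ge> 0" using sym_coneD(2)[OF W] by (simp add: q_def)
  show ?thesis
  proof (cases "\<bar>Im z\<bar> < R")
    case True
    have "W z \<le> 384 * q + e" if "e > 0" for e
    proof -
      have "W (Complex (Re z) (Im z)) \<le> 4 * (96 * R * (q + e / 384)) / R"
      proof (rule diamond_bound[OF sym_coneD(1,2)[OF W] sym_coneD(7)[OF W] R])
        fix w assume w: "\<bar>Re w - Re z\<bar> \<le> R" "\<bar>Im w\<bar> \<le> R" "Im w \<noteq> 0"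
        have "W w \<le> 96 * R / \<bar>Im w\<bar> * q"
          unfolding q_def using w z R by (intro sym_cone_half_plane(2)[OF \<Omega> W R]) auto
        also have "\<dots> \<le> 96 * R * (q + e / 384) / \<bar>Im w\<bar>"
          using w R that by (simp add: field_simps)
        finally show "W w \<le> 96 * R * (q + e / 384) / \<bar>Im w\<bar>" .
      qed (use R q that True in \<open>auto intro!: mult_pos_pos\<close>)
      moreover have "4 * (96 * R * (q + e / 384)) / R = 384 * q + e" using R by (simp add: field_simps)
      ultimately show ?thesis by (simp add: complex_surj)
    qed
    then show ?thesis unfolding q_def by (rule field_le_epsilon)
  next
    case False
    then have im: "R \<le> \<bar>Im z\<bar>" "Im z \<noteq> 0" using R by auto
    have "W z \<le> 96 * R / \<bar>Im z\<bar> * q"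
      unfolding q_def using im z R by (intro sym_cone_half_plane(2)[OF \<Omega> W R]) auto
    also have "\<dots> \<le> 384 * q"
      using im R q by (intro mult_right_mono) (auto simp: divide_le_eq)
    finally show ?thesis by (simp add: q_def)
  qed
qed

text \<open>Boundary Harnack principle.  By symmetry the quadratic \<open>(x - x0)\<^sup>2 - y\<^sup>2\<close> can absorb the part
  of the circle near the real axis, where \<open>V\<close> has no lower bound, without contributing at the
  points above the centre: it is nonpositive there.\<close>

theorem boundary_harnack:
  assumes \<Omega>: "slit_domain \<Omega>" and U: "U \<in> sym_cone \<Omega>" and V: "V \<in> sym_cone \<Omega>" and R: "R > 0"
    and z: "\<bar>Re z\<bar> \<le> R" "\<bar>Im z\<bar> < R"
  shows "V (Complex 0 (8 * R)) * U z \<le> 73728 * U (Complex 0 (8 * R)) * V z"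
proof -
  define p q where "p = U (Complex 0 (8 * R))" "q = V (Complex 0 (8 * R))"
  have pq: "p \<ge> 0" "q \<ge> 0" using sym_coneD(2) U V by (auto simp: p_q_def)
  define x where "x = Re z"
  define c where "c = complex_of_real x"
  define \<Psi> where "\<Psi> = (\<lambda>w. (Re w - x)\<^sup>2 - (Im w)\<^sup>2)"
  have \<Psi>m: "mvp UNIV \<Psi>"
  proof -
    have "mvp UNIV (\<lambda>w. Re ((w - c)\<^sup>2))"
      by (intro mvp_Re_holomorphic holomorphic_intros) auto
    moreover have "(\<lambda>w. Re ((w - c)\<^sup>2)) = \<Psi>"
      by (simp add: fun_eq_iff \<Psi>_def c_def power2_eq_square)
    ultimately show ?thesis by simp
  qed
  define K where "K = (384 :: real)"
  \<comment> \<open>on the circle \<open>\<Psi> = R\<^sup>2 - 2 y\<^sup>2\<close>, and the loss \<open>2 K p q y\<^sup>2 / R\<^sup>2\<close> is made up for by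
    \<open>192 K p V \<ge> 2 K p q \<bar>y\<bar> / R\<close>\<close>
  define F where "F = (\<lambda>w. q * U w + (- (192 * K * p) * V w + - (K * p * q / R\<^sup>2) * \<Psi> w))"
  have cF: "continuous_on T F" for T
    unfolding F_def using sym_coneD(1) U V mvp_continuous[OF \<Psi>m]
    by (intro continuous_intros) (auto intro: continuous_on_subset)
  have zero: "F w \<le> 0" if w: "w \<notin> \<Omega>" for w
  proof -
    have "Im w = 0" using \<Omega> w by (auto simp: slit_domain_def)
    then show ?thesis using sym_coneD(4)[OF U w] sym_coneD(4)[OF V w] pq R by (simp add: F_def \<Psi>_def K_def)
  qed
  have edge: "F w \<le> 0" if w: "w \<in> sphere c R" for w
  proof (cases "w \<in> \<Omega>")
    case True
    have sq: "(Re w - x)\<^sup>2 + (Im w)\<^sup>2 = R\<^sup>2"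
      using w R by (auto simp: c_def dist_norm cmod_def power2_commute)
    have "\<bar>Re (w - c)\<bar> \<le> R" "\<bar>Im (w - c)\<bar> \<le> R"
      using w abs_Re_le_cmod[of "w - c"] abs_Im_le_cmod[of "w - c"]
      by (auto simp: dist_norm norm_minus_commute)
    then have wb: "\<bar>Re w\<bar> \<le> 2 * R" "\<bar>Im w\<bar> \<le> R" using z by (auto simp: c_def x_def)
    have Uw: "U w \<le> K * p"
      unfolding p_q_def K_def using wb R by (intro carleson_estimate[OF \<Omega> U R]) auto
    have Vw: "\<bar>Im w\<bar> / (96 * R) * q \<le> V w"
    proof (cases "Im w = 0")
      case True
      then show ?thesis using sym_coneD(2)[OF V] by simp
    next
      case False
      then show ?thesis unfolding p_q_def using wb R by (intro sym_cone_half_plane(1)[OF \<Omega> V R]) auto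
    qed
    have Kp: "0 \<le> K * p" "0 \<le> 192 * K * p" using pq by (auto simp: K_def)
    have "F w = q * U w - 192 * K * p * V w - K * p * q / R\<^sup>2 * (R\<^sup>2 - 2 * (Im w)\<^sup>2)"
    proof -
      have "\<Psi> w = R\<^sup>2 - 2 * (Im w)\<^sup>2" using sq by (simp add: \<Psi>_def)
      then show ?thesis by (simp add: F_def)
    qed
    also have "\<dots> = q * U w - 192 * K * p * V w - K * p * q + 2 * K * p * q * ((Im w)\<^sup>2 / R\<^sup>2)"
      using R by (simp add: field_simps)
    also have "\<dots> \<le> q * (K * p) - 192 * K * p * (\<bar>Im w\<bar> / (96 * R) * q) - K * p * q
        + 2 * K * p * q * ((Im w)\<^sup>2 / R\<^sup>2)"
      using mult_left_mono[OF Uw pq(2)] mult_left_mono[OF Vw Kp(2)] by linarith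
    also have "\<dots> = 2 * K * p * q * ((\<bar>Im w\<bar> / R)\<^sup>2 - \<bar>Im w\<bar> / R)"
      using R by (simp add: field_simps power2_eq_square)
    also have "\<dots> \<le> 0"
    proof -
      have "(\<bar>Im w\<bar> / R)\<^sup>2 \<le> \<bar>Im w\<bar> / R"
        using wb R power_decreasing[of 1 2 "\<bar>Im w\<bar> / R"] by simp
      then show ?thesis using pq Kp by (intro mult_nonneg_nonpos) auto
    qed
    finally show ?thesis .
  qed (use zero in auto)
  have "F z \<le> 0"
  proof (rule max_principle_compact[OF compact_cball[of c R] cF])
    fix w assume w: "w \<in> cball c R" "F w > 0"
    have wO: "w \<in> \<Omega>" using zero w by force
    have wb: "w \<in> ball c R" using edge[of w] w by (force simp: less_le)
    have "open \<Omega>" using \<Omega> by (simp add: slit_domain_def)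
    have "mvp \<Omega> F" unfolding F_def
      by (intro mvp_add mvp_cmult \<open>open \<Omega>\<close> sym_coneD(5)[OF U] sym_coneD(5)[OF V] mvp_subset[OF \<Psi>m]) auto
    then show "w \<in> interior (cball c R) \<and> submean F w" using wb wO mvp_submean by auto
  next
    have "dist c z = \<bar>Im z\<bar>" by (simp add: c_def x_def dist_norm cmod_def)
    then show "z \<in> cball c R" using z by simp
  qed
  moreover have "\<Psi> z = - (Im z)\<^sup>2" by (simp add: \<Psi>_def x_def)
  ultimately have "q * U z + K * p * q / R\<^sup>2 * (Im z)\<^sup>2 \<le> 192 * K * p * V z"
    by (simp add: F_def)
  moreover have "0 \<le> K * p * q / R\<^sup>2 * (Im z)\<^sup>2" using pq by (simp add: K_def)
  ultimately show ?thesis by (simp add: K_def p_q_def)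
qed

text \<open>The boundary Harnack principle is applied in both directions, so that the unknown ratio at
  \<open>8iR\<close> cancels; \<open>R\<close> is any radius that covers both points.\<close>

corollary sym_cone_comparable:
  assumes \<Omega>: "slit_domain \<Omega>" and U: "U \<in> sym_cone \<Omega>" and V: "V \<in> sym_cone \<Omega>"
    and pos: "\<And>z. Im z \<noteq> 0 \<Longrightarrow> 0 < V z"
  shows "U z * V w \<le> 73728\<^sup>2 * (U w * V z)"
proof -
  define R where "R = cmod z + cmod w + 1"
  have R: "R > 0" by (simp add: R_def add_nonneg_pos)
  define p q where "p = U (Complex 0 (8 * R))" "q = V (Complex 0 (8 * R))"
  have q: "q > 0" using pos[of "Complex 0 (8 * R)"] R by (simp add: p_q_def)
  have zw: "\<bar>Re z\<bar> \<le> R" "\<bar>Im z\<bar> < R" "\<bar>Re w\<bar> \<le> R" "\<bar>Im w\<bar> < R"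
    using abs_Re_le_cmod[of z] abs_Im_le_cmod[of z] abs_Re_le_cmod[of w] abs_Im_le_cmod[of w]
      norm_ge_zero[of z] norm_ge_zero[of w]
    unfolding R_def by linarith+
  have 1: "q * U z \<le> 73728 * p * V z"
    unfolding p_q_def using zw by (intro boundary_harnack[OF \<Omega> U V R])
  have 2: "p * V w \<le> 73728 * q * U w"
    unfolding p_q_def using zw by (intro boundary_harnack[OF \<Omega> V U R])
  have "q * (U z * V w) = (q * U z) * V w" by simp
  also have "\<dots> \<le> (73728 * p * V z) * V w" using sym_coneD(2)[OF V] by (intro mult_right_mono 1)
  also have "\<dots> = 73728 * V z * (p * V w)" by simp
  also have "\<dots> \<le> 73728 * V z * (73728 * q * U w)" using sym_coneD(2)[OF V] by (intro mult_left_mono 2) simp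
  finally show ?thesis using q by (simp add: power2_eq_square mult_ac)
qed

text \<open>Subtract from \<open>V\<close> the largest possible multiple of \<open>U\<close>.  If something is left, it dominates a
  small multiple of \<open>U\<close>, a contradiction.\<close>

theorem sym_cone_proportional:
  assumes \<Omega>: "slit_domain \<Omega>" and U: "U \<in> sym_cone \<Omega>" and V: "V \<in> sym_cone \<Omega>"
    and Upos: "\<And>z. z \<in> \<Omega> \<Longrightarrow> 0 < U z"
  shows "\<exists>k. \<forall>z. V z = k * U z"
proof -
  have Im_\<Omega>: "z \<in> \<Omega>" if "Im z \<noteq> 0" for z using \<Omega> that by (simp add: slit_domain_def)
  have i\<Omega>: "\<i> \<in> \<Omega>" using Im_\<Omega>[of \<i>] by simp
  define k where "k = (INF z\<in>\<Omega>. V z / U z)"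
  have bdd: "bdd_below ((\<lambda>z. V z / U z) ` \<Omega>)"
    using sym_coneD(2)[OF V] sym_coneD(2)[OF U] by (intro bdd_belowI2[of _ 0]) (simp add: divide_nonneg_nonneg)
  have kle: "k * U z \<le> V z" for z
  proof (cases "z \<in> \<Omega>")
    case True
    have "k \<le> V z / U z" unfolding k_def by (rule cINF_lower[OF bdd True])
    then show ?thesis using Upos[OF True] by (simp add: field_simps)
  next
    case False
    then show ?thesis using sym_coneD(4)[OF U] sym_coneD(4)[OF V] by simp
  qed
  define W where "W = (\<lambda>z. V z - k * U z)"
  have W: "W \<in> sym_cone \<Omega>"
    unfolding sym_cone_def mem_Collect_eq
  proof (intro conjI allI impI)
    show "continuous_on UNIV W" unfolding W_def by (intro continuous_intros sym_coneD(1)[OF U] sym_coneD(1)[OF V])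
    show "mvp \<Omega> W"
      unfolding W_def using \<Omega> by (intro mvp_diff mvp_cmult sym_coneD(5)[OF U] sym_coneD(5)[OF V]) (simp add: slit_domain_def)
  qed (use kle sym_coneD(3,4)[OF U] sym_coneD(3,4)[OF V] in \<open>auto simp: W_def\<close>)
  have "W z = 0" for z
  proof (rule ccontr)
    assume "W z \<noteq> 0"
    then have Wz: "W z > 0" using sym_coneD(2)[OF W, of z] by simp
    then have z\<Omega>: "z \<in> \<Omega>" using sym_coneD(6)[OF W] by blast
    define e where "e = W z / (73728\<^sup>2 * U z)"
    have e: "e > 0" using Wz Upos[OF z\<Omega>] by (simp add: e_def)
    have "k + e \<le> V w / U w" if w: "w \<in> \<Omega>" for w
    proof -
      have "W z * U w \<le> 73728\<^sup>2 * (W w * U z)"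
        by (intro sym_cone_comparable[OF \<Omega> W U] Upos Im_\<Omega>)
      then have "e * U w \<le> W w"
        using Upos[OF z\<Omega>] by (simp add: e_def field_simps)
      then show ?thesis using Upos[OF w] by (simp add: W_def field_simps)
    qed
    then have "k + e \<le> k" unfolding k_def using i\<Omega> by (intro cINF_greatest) auto
    then show False using e by simp
  qed
  then show ?thesis by (intro exI[of _ k]) (simp add: W_def)
qed

section \<open>Symmetry up to a multiple of the imaginary part\<close>

lemma circ_mean_cnj: 
  assumes "continuous_on S u" "sphere a r \<subseteq> S" "0 \<le> r"
  shows "circ_mean (\<lambda>z. u (cnj z)) (cnj a) r = circ_mean u a r"
proof -
  have cnj: "cnj (circ (cnj a) r t) = circ a r (1 - t)" for t
  proof -
    have "cis (2 * pi * (1 - t)) = cis (2 * pi) * cis (- (2 * pi * t))"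
      unfolding cis_mult by (simp add: algebra_simps)
    then show ?thesis by (simp add: circ_def cis_cnj)
  qed
  define g where "g = (\<lambda>t. u (circ a r t))"
  have cg: "continuous_on T g" for T
    unfolding g_def by (rule continuous_on_compose_circ[OF assms])
  have "circ_mean (\<lambda>z. u (cnj z)) (cnj a) r = integral {- 0..- (- 1)} (\<lambda>t. (g \<circ> (\<lambda>x. x + 1)) (- t))"
    by (simp add: circ_mean_def cnj g_def add.commute)
  also have "\<dots> = integral {- 1..0} (g \<circ> (\<lambda>x. x + 1))" by (rule Henstock_Kurzweil_Integration.integral_reflect_real[of 0 "- 1" "g \<circ> (\<lambda>x. x + 1)"])
  also have "\<dots> = integral {- 1 + 1..0 + 1} g" by (rule integral_shift[OF cg])
  finally show ?thesis by (simp add: circ_mean_def g_def)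
qed

lemma mean_at_cnj:
  assumes "open S" "a \<in> S" "continuous_on S u" "mean_at u a"
  shows "mean_at (\<lambda>z. u (cnj z)) (cnj a)"
proof -
  obtain r1 where r1: "r1 > 0" "\<And>r. 0 < r \<Longrightarrow> r < r1 \<Longrightarrow> cball a r \<subseteq> S"
    using small_circle[OF assms(1,2)] by blast
  obtain r2 where r2: "r2 > 0" "\<And>r. 0 < r \<Longrightarrow> r < r2 \<Longrightarrow> u a = circ_mean u a r"
    using assms(4) unfolding mean_at_def by blast
  show ?thesis unfolding mean_at_def
  proof (intro exI[of _ "min r1 r2"] conjI allI impI)
    fix r assume r: "0 < r" "r < min r1 r2"
    have "sphere a r \<subseteq> S" using r1(2)[of r] r by (auto simp: subset_iff)
    from circ_mean_cnj[OF assms(3) this] r2(2)[of r] r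
    show "u (cnj (cnj a)) = circ_mean (\<lambda>z. u (cnj z)) (cnj a) r" by simp
  qed (use r1 r2 in auto)
qed

lemma mvp_cnj:
  assumes S: "open S" and sym: "\<And>z. cnj z \<in> S \<longleftrightarrow> z \<in> S" and u: "mvp S u"
  shows "mvp S (\<lambda>z. u (cnj z))"
  unfolding mvp_def
proof (intro conjI ballI)
  show "continuous_on S (\<lambda>z. u (cnj z))"
    using sym by (intro continuous_on_compose2[OF mvp_continuous[OF u]] continuous_intros) auto
  show "mean_at (\<lambda>z. u (cnj z)) a" if "a \<in> S" for a
    using mean_at_cnj[OF S _ mvp_continuous[OF u] mvp_mean_at[OF u], of "cnj a"] that sym by simp
qed

lemma slit_domain_cnj: "slit_domain \<Omega> \<Longrightarrow> cnj z \<in> \<Omega> \<longleftrightarrow> z \<in> \<Omega>"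
  unfolding slit_domain_def by (cases "Im z = 0") (auto simp: complex_cnj_cancel_iff complex_eq_iff intro!: arg_cong[of _ _ "\<lambda>w. w \<in> \<Omega>"])

text \<open>Liouville's theorem for \<open>exp \<circ> g\<close>.\<close>

lemma bounded_Re_entire_const:
  assumes g: "g holomorphic_on UNIV" and b: "\<And>z. Re (g z) \<le> B"
  shows "deriv g z = 0"
proof -
  have "(\<lambda>z. exp (g z)) holomorphic_on UNIV" using g by (intro holomorphic_intros)
  moreover have "bounded (range (\<lambda>z. exp (g z)))"
    using b by (auto simp: bounded_iff intro!: exI[of _ "exp B"])
  ultimately have "(\<lambda>z. exp (g z)) constant_on UNIV" by (rule Liouville_theorem)
  then obtain k where k: "\<And>z. exp (g z) = k" unfolding constant_on_def by blast
  have "(g has_field_derivative deriv g z) (at z)" using g holomorphic_derivI by blast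
  then have "((\<lambda>z. exp (g z)) has_field_derivative exp (g z) * deriv g z) (at z)"
    by (rule DERIV_chain2[OF DERIV_exp])
  moreover have "((\<lambda>z. exp (g z)) has_field_derivative 0) (at z)" by (simp add: k)
  ultimately have "exp (g z) * deriv g z = 0" by (rule DERIV_unique)
  then show ?thesis by simp
qed

text \<open>A harmonic function of linear growth is Lipschitz by Harnack's inequality, hence its
  differences are bounded and constant by Liouville's theorem.\<close>

lemma harmonic_linear_growth:
  assumes W: "mvp UNIV W" and C: "\<And>z. \<bar>W z\<bar> \<le> C * (1 + cmod z)"
  obtains \<alpha> \<beta> where "\<And>z. W z = Re (\<alpha> * z + \<beta>)"
proof -
  have C0: "C \<ge> 0" using C[of 0] by simp
  have lip: "\<bar>W (z + h) - W z\<bar> \<le> 4 * C * cmod h" for z h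
  proof -
    have est: "\<bar>W (z + h) - W z\<bar> \<le> 2 * cmod h / (R - cmod h) * (2 * C * (1 + cmod z + R))"
      if R: "R > cmod h" for R
    proof -
      define p where "p = (\<lambda>w. W w + C * (1 + cmod z + R))"
      have p: "mvp UNIV p" unfolding p_def by (intro mvp_add W mvp_const) auto
      have nn: "0 \<le> p w" if "w \<in> sphere z R" for w
      proof -
        have "cmod w \<le> cmod z + R" using that norm_triangle_ineq[of z "w - z"] by (simp add: dist_norm norm_minus_commute)
        then have "C * (1 + cmod w) \<le> C * (1 + cmod z + R)" using C0 by (intro mult_left_mono) auto
        then show ?thesis using C[of w] by (simp add: p_def)
      qed
      have "\<bar>p (z + h) - p z\<bar> \<le> 2 * dist z (z + h) / (R - dist z (z + h)) * p z"
        using R by (intro harnack_oscillation[OF _ p _ nn]) (auto simp: dist_norm)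
      also have "\<dots> \<le> 2 * cmod h / (R - cmod h) * (2 * C * (1 + cmod z + R))"
      proof -
        have "C * (1 + cmod z) \<le> C * (1 + cmod z + R)"
          using C0 R norm_ge_zero[of h] by (intro mult_left_mono) linarith+
        then have "p z \<le> 2 * C * (1 + cmod z + R)" using C[of z] by (simp add: p_def)
        then have "2 * cmod h / (R - cmod h) * p z \<le> 2 * cmod h / (R - cmod h) * (2 * C * (1 + cmod z + R))"
          using R by (intro mult_left_mono) auto
        then show ?thesis by (simp add: dist_norm)
      qed
      finally show ?thesis by (simp add: p_def)
    qed
    have lim: "((\<lambda>R. 2 * cmod h / (R - cmod h) * (2 * C * (1 + cmod z + R))) \<longlongrightarrow> 4 * C * cmod h) at_top"
      by real_asymp
    show ?thesis
      by (rule tendsto_lowerbound[OF lim eventually_mono[OF eventually_gt_at_top[of "cmod h"] est]]) auto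
  qed
  have "harmonic_on UNIV W" using W harmonic_on_iff_mvp[of UNIV] by simp
  then obtain f where f: "f holomorphic_on UNIV" "\<And>z. W z = Re (f z)"
    using harmonic_on_convex_Re[of UNIV W] by auto
  have fd: "(f has_field_derivative deriv f z) (at z)" for z using f(1) holomorphic_derivI by blast
  have "deriv f z = deriv f 0" for z
  proof -
    define g where "g = (\<lambda>w. f (w + z) - f w)"
    have "((\<lambda>w. f (w + z)) has_field_derivative deriv f (w + z)) (at w)" for w
      using fd[of "w + z"] DERIV_shift by blast
    then have gd: "(g has_field_derivative deriv f (w + z) - deriv f w) (at w)" for w
      unfolding g_def by (intro DERIV_diff fd)
    then have gh: "g holomorphic_on UNIV" by (auto simp: holomorphic_on_open)
    have "Re (g w) \<le> 4 * C * cmod z" for w using lip[of w z] f(2) by (simp add: g_def)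
    from bounded_Re_entire_const[OF gh this] have "deriv g 0 = 0" .
    moreover have "deriv g 0 = deriv f z - deriv f 0" using DERIV_imp_deriv[OF gd[of 0]] by simp
    ultimately show ?thesis by simp
  qed
  then have "((\<lambda>z. f z - deriv f 0 * z) has_field_derivative 0) (at z)" for z
    using fd[of z] by (auto intro!: derivative_eq_intros)
  then obtain \<beta> where "\<And>z. f z - deriv f 0 * z = \<beta>"
    using has_field_derivative_zero_constant[of UNIV "\<lambda>z. f z - deriv f 0 * z"] by auto
  then have "W z = Re (deriv f 0 * z + \<beta>)" for z using f(2)[of z] by (metis diff_add_cancel add.commute)
  then show ?thesis by (rule that)
qed

text \<open>Carleson's estimate moves from \<open>z\<close> to \<open>8iR\<close> with \<open>R = 1 + \<bar>z\<bar>\<close>, and Harnack's inequality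
  moves down to \<open>\<i>\<close> at the cost of a factor \<open>32 R\<close>.\<close>

lemma sym_cone_growth:
  assumes \<Omega>: "slit_domain \<Omega>" and s: "s \<in> sym_cone \<Omega>"
  shows "s z \<le> 12288 * s \<i> * (1 + cmod z)"
proof -
  define R where "R = 1 + cmod z"
  have R: "R \<ge> 1" by (simp add: R_def)
  have "s z \<le> 384 * s (Complex 0 (8 * R))"
    using R abs_Re_le_cmod[of z] abs_Im_le_cmod[of z] by (intro carleson_estimate[OF \<Omega> s]) (auto simp: R_def)
  also have "\<dots> \<le> 384 * (32 * R * s \<i>)"
  proof -
    have m: "mvp {z. Im z > 0} s"
      using \<Omega> by (intro mvp_subset[OF sym_coneD(5)[OF s]]) (auto simp: slit_domain_def)
    have "1 / (4 * (8 * R)) * s (Complex 0 (8 * R)) \<le> s (Complex 0 1)"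
      using R by (intro vertical_harnack(1)[OF m sym_coneD(2)[OF s]]) auto
    moreover have "Complex 0 1 = \<i>" by (simp add: complex_eq_iff)
    ultimately show ?thesis using R by (simp add: field_simps)
  qed
  finally show ?thesis by (simp add: R_def mult_ac)
qed

text \<open>The odd part extends harmonically across the slits, since odd functions have mean zero over
  circles centred on the axis.  The even part bounds it and grows at most linearly.\<close>

theorem odd_part_linear:
  assumes \<Omega>: "slit_domain \<Omega>" and cont: "continuous_on UNIV U" and nonneg: "\<And>z. 0 \<le> U z"
    and zero: "\<And>z. z \<notin> \<Omega> \<Longrightarrow> U z = 0" and U: "mvp \<Omega> U"
  obtains c where "\<And>z. U z - U (cnj z) = c * Im z"
proof -
  have op: "open \<Omega>" using \<Omega> by (simp add: slit_domain_def)
  have Uc: "mvp \<Omega> (\<lambda>z. U (cnj z))" by (rule mvp_cnj[OF op slit_domain_cnj[OF \<Omega>] U])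
  have cc: "continuous_on UNIV (\<lambda>z. U (cnj z))"
    by (intro continuous_on_compose2[OF cont] continuous_intros) auto
  define s where "s = (\<lambda>z. U z + U (cnj z))"
  have s: "s \<in> sym_cone \<Omega>"
    unfolding sym_cone_def mem_Collect_eq
  proof (intro conjI allI impI)
    show "continuous_on UNIV s" unfolding s_def by (intro continuous_intros cont cc)
    show "mvp \<Omega> s" unfolding s_def by (rule mvp_add[OF op U Uc])
  qed (use nonneg zero slit_domain_cnj[OF \<Omega>] in \<open>auto simp: s_def\<close>)
  define W where "W = (\<lambda>z. U z - U (cnj z))"
  have odd: "W (cnj z) = - W z" for z by (simp add: W_def)
  have cW: "continuous_on UNIV W" unfolding W_def by (intro continuous_intros cont cc)
  have "mvp UNIV W"
    unfolding mvp_def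
  proof (intro conjI ballI cW)
    fix a :: complex
    show "mean_at W a"
    proof (cases "Im a = 0")
      case False
      then have "a \<in> \<Omega>" using \<Omega> by (simp add: slit_domain_def)
      then show ?thesis unfolding W_def using mvp_mean_at[OF mvp_diff[OF op U Uc]] by blast
    next
      case True
      then have a: "cnj a = a" by (simp add: complex_eq_iff)
      have "circ_mean W a r = 0" if "r > 0" for r
      proof -
        have "circ_mean (\<lambda>z. W (cnj z)) (cnj a) r = circ_mean W a r"
          using that by (intro circ_mean_cnj[OF cW]) auto
        then show ?thesis using circ_mean_cmult[of "-1" W a r] by (simp add: a odd)
      qed
      moreover have "W a = 0" using odd[of a] a by simp
      ultimately show ?thesis unfolding mean_at_def by (intro exI[of _ 1]) auto
    qed
  qed
  moreover have "\<bar>W z\<bar> \<le> 12288 * s \<i> * (1 + cmod z)" for z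
    using sym_cone_growth[OF \<Omega> s, of z] nonneg[of z] nonneg[of "cnj z"] by (auto simp: W_def s_def)
  ultimately obtain \<alpha> \<beta> where ab: "\<And>z. W z = Re (\<alpha> * z + \<beta>)" by (rule harmonic_linear_growth) blast
  have "W 0 = 0" "W 1 = 0" by (simp_all add: W_def)
  then have "Re \<beta> = 0" "Re \<alpha> = 0" using ab[of 0] ab[of 1] by auto
  then have "U z - U (cnj z) = - Im \<alpha> * Im z" for z using ab[of z] by (simp add: W_def)
  then show ?thesis by (rule that)
qed

section \<open>Harmonic measure of intervals in the upper half-plane\<close>

text \<open>The harmonic measure of \<open>[a, b]\<close>: the angle under which the interval is seen from \<open>z\<close>, divided
  by \<open>pi\<close>.\<close>

definition hmeas :: "real \<Rightarrow> real \<Rightarrow> complex \<Rightarrow> real" where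
  "hmeas a b z = (arctan ((Re z - a) / Im z) - arctan ((Re z - b) / Im z)) / pi"

lemma open_upper: "open {z. Im z > 0}"
  by (simp add: open_halfspace_Im_gt)

text \<open>For \<open>Im z > 0\<close> the number \<open>- \<i> (z - a)\<close> has positive real part, and its argument is minus the
  arctangent.\<close>

lemma mvp_arctan: "mvp {z. Im z > 0} (\<lambda>z. arctan ((Re z - a) / Im z))"
proof -
  have "(\<lambda>z. \<i> * Ln (- \<i> * (z - of_real a))) holomorphic_on {z. Im z > 0}"
    by (intro holomorphic_intros) (auto simp: complex_nonpos_Reals_iff)
  from mvp_Re_holomorphic[OF this open_upper]
  show ?thesis
  proof (rule mvp_cong[OF open_upper])
    fix z assume z: "z \<in> {z. Im z > 0}"
    define w where "w = - \<i> * (z - of_real a)"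
    have w: "Re w = Im z" "Im w = - (Re z - a)" "w \<noteq> 0"
      using z by (auto simp: w_def complex_eq_iff)
    have "Im (Ln w) = arctan (- ((Re z - a) / Im z))"
    proof -
      have e: "- ((Re z - a) / Im z) = (a - Re z) / Im z" using z by (simp add: field_simps)
      show ?thesis unfolding e using Arg_eq_Im_Ln[OF w(3)] arg_conv_arctan[of w] z by (simp add: w)
    qed
    then show "Re (\<i> * Ln (- \<i> * (z - of_real a))) = arctan ((Re z - a) / Im z)"
      unfolding w_def[symmetric] arctan_minus by simp
  qed
qed

lemma mvp_hmeas: "mvp {z. Im z > 0} (hmeas a b)"
proof -
  have "mvp {z. Im z > 0} (\<lambda>z. (1 / pi) * (arctan ((Re z - a) / Im z) - arctan ((Re z - b) / Im z)))"
    by (intro mvp_cmult mvp_diff mvp_arctan open_upper)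
  then show ?thesis unfolding hmeas_def by simp
qed

lemma hmeas_le_1: "hmeas a b z \<le> 1"
  using arctan_lbound[of "(Re z - b) / Im z"] arctan_ubound[of "(Re z - a) / Im z"]
  by (simp add: hmeas_def divide_le_eq)

text \<open>The mean value theorem replaces the Poisson integral over \<open>[a, b]\<close> by a value of the Poisson
  kernel.\<close>

lemma hmeas_kernel:
  assumes "a < b" "Im z > 0"
  obtains t where "a < t" "t < b" "hmeas a b z = (b - a) / pi * (Im z / ((Re z - t)\<^sup>2 + (Im z)\<^sup>2))"
proof -
  define p where "p = (\<lambda>t. - arctan ((Re z - t) / Im z))"
  have "\<exists>t>a. t < b \<and> p b - p a = (b - a) * (Im z / ((Re z - t)\<^sup>2 + (Im z)\<^sup>2))"
  proof (rule MVT2[OF assms(1)])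
    fix t
    have "1 + ((Re z - t) / Im z)\<^sup>2 = ((Re z - t)\<^sup>2 + (Im z)\<^sup>2) / (Im z)\<^sup>2"
      using assms by (simp add: field_simps)
    then have "Im z / ((Re z - t)\<^sup>2 + (Im z)\<^sup>2) = - (inverse (1 + ((Re z - t) / Im z)\<^sup>2) * (- 1 / Im z))"
      using assms by (simp add: power2_eq_square)
    then show "(p has_real_derivative Im z / ((Re z - t)\<^sup>2 + (Im z)\<^sup>2)) (at t)"
      unfolding p_def using assms by (auto intro!: derivative_eq_intros)
  qed
  then obtain t where t: "a < t" "t < b" "p b - p a = (b - a) * (Im z / ((Re z - t)\<^sup>2 + (Im z)\<^sup>2))"
    by auto
  show ?thesis
  proof (rule that[OF t(1,2)])
    have "hmeas a b z = (p b - p a) / pi" by (simp add: hmeas_def p_def)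
    then show "hmeas a b z = (b - a) / pi * (Im z / ((Re z - t)\<^sup>2 + (Im z)\<^sup>2))"
      unfolding t(3) by (simp only: times_divide_eq_left)
  qed
qed

lemma hmeas_nonneg: "a < b \<Longrightarrow> Im z > 0 \<Longrightarrow> 0 \<le> hmeas a b z"
  by (rule hmeas_kernel[of a b z]) auto

lemma hmeas_far:
  assumes ab: "a < b" and z: "Im z > 0" and D: "D > 0" "\<And>t. a < t \<Longrightarrow> t < b \<Longrightarrow> D \<le> cmod (z - of_real t)"
  shows "hmeas a b z \<le> (b - a) / pi * (Im z / D\<^sup>2)"
proof -
  obtain t where t: "a < t" "t < b" "hmeas a b z = (b - a) / pi * (Im z / ((Re z - t)\<^sup>2 + (Im z)\<^sup>2))"
    using hmeas_kernel[OF ab z] by blast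
  have "D\<^sup>2 \<le> (cmod (z - of_real t))\<^sup>2" using D t by (intro power_mono) auto
  then have "D\<^sup>2 \<le> (Re z - t)\<^sup>2 + (Im z)\<^sup>2" by (simp add: cmod_power2)
  then have "Im z / ((Re z - t)\<^sup>2 + (Im z)\<^sup>2) \<le> Im z / D\<^sup>2"
    using z D by (intro divide_left_mono mult_pos_pos add_nonneg_pos) auto
  then show ?thesis unfolding t(3) using ab by (intro mult_left_mono) auto
qed

text \<open>The sum is the Poisson integral of a step function.  At the ends of the intervals it has no
  limit, but it stays below the height of the step, and \<open>f\<close> has at least this height there.  Poles
  of \<open>f\<close> are allowed since the sum is bounded.\<close>

lemma step_function_minorant:
  fixes a b lam :: "'j \<Rightarrow> real"
  assumes fin: "finite F" and ab: "\<And>j. j \<in> F \<Longrightarrow> a j < b j" and lam: "\<And>j. j \<in> F \<Longrightarrow> 0 \<le> lam j"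
    and disj: "\<And>i j x. i \<in> F \<Longrightarrow> j \<in> F \<Longrightarrow> i \<noteq> j \<Longrightarrow> a i \<le> x \<Longrightarrow> x \<le> b i \<Longrightarrow> x < a j \<or> b j < x"
    and P: "closed P" and f: "mvp ({z. Im z > 0} - P) f"
    and nonneg: "\<And>z. Im z > 0 \<Longrightarrow> z \<notin> P \<Longrightarrow> 0 \<le> f z"
    and pole: "\<And>p. p \<in> P \<Longrightarrow> filterlim f at_top (at p)"
    and bd: "\<And>j x. j \<in> F \<Longrightarrow> a j \<le> x \<Longrightarrow> x \<le> b j \<Longrightarrow> isCont f (of_real x) \<and> lam j \<le> f (of_real x)"
    and z: "Im z > 0" "z \<notin> P"
  shows "(\<Sum>j\<in>F. lam j * hmeas (a j) (b j) z) \<le> f z"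
proof -
  define V where "V = {z. Im z > 0} - P"
  have oV: "open V" unfolding V_def by (intro open_Diff open_upper P)
  define H where "H = (\<lambda>j z. lam j * hmeas (a j) (b j) z)"
  define s where "s = (\<lambda>z. \<Sum>j\<in>F. H j z)"
  have sm: "mvp {z. Im z > 0} s"
    unfolding s_def H_def using fin
  proof (induction F rule: finite_induct)
    case (insert j F)
    then show ?case using mvp_add[OF open_upper mvp_cmult[OF mvp_hmeas]] by simp
  qed simp
  have Hnn: "0 \<le> H j z" and Hle: "H j z \<le> lam j" if "j \<in> F" "Im z > 0" for j z
    using hmeas_nonneg[OF ab[OF that(1)] that(2)] hmeas_le_1[of "a j" "b j" z] lam[OF that(1)]
    by (auto simp: H_def mult_left_le)
  have sle: "s z \<le> sum lam F" if "Im z > 0" for z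
    unfolding s_def by (intro sum_mono Hle that)
  have H0: "((\<lambda>z. H j z) \<longlongrightarrow> 0) (at (of_real x) within V)" if j: "j \<in> F" and x: "x < a j \<or> b j < x" for j x
  proof -
    define D where "D = (if x < a j then a j - x else x - b j) / 2"
    have D: "D > 0" using x ab[OF j] by (auto simp: D_def)
    have up: "\<forall>\<^sub>F w in at (of_real x) within V. H j w \<le> lam j * ((b j - a j) / pi * (Im w / D\<^sup>2))"
      unfolding eventually_at
    proof (intro exI[of _ D] conjI ballI impI D)
      fix w assume w: "w \<in> V" "w \<noteq> of_real x \<and> dist w (of_real x) < D"
      have Dt: "D \<le> cmod (w - of_real t)" if "a j < t" "t < b j" for t
      proof -
        have "2 * D \<le> \<bar>x - t\<bar>" using that x by (auto simp: D_def)
        also have "\<dots> = cmod (of_real x - of_real t)" by (metis norm_of_real of_real_diff real_norm_def)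
        also have "\<dots> \<le> cmod (w - of_real t) + dist w (of_real x)"
          using norm_triangle_ineq[of "w - of_real t" "of_real x - w"] by (simp add: dist_norm norm_minus_commute)
        finally show ?thesis using w by simp
      qed
      show "H j w \<le> lam j * ((b j - a j) / pi * (Im w / D\<^sup>2))"
        unfolding H_def using w D Dt lam[OF j] by (intro mult_left_mono hmeas_far ab[OF j]) (auto simp: V_def)
    qed
    have lo: "\<forall>\<^sub>F w in at (of_real x) within V. 0 \<le> H j w"
      using Hnn[OF j] by (auto simp: V_def eventually_at_filter)
    have "((\<lambda>w. lam j * ((b j - a j) / pi * (Im w / D\<^sup>2))) \<longlongrightarrow> lam j * ((b j - a j) / pi * (Im (of_real x) / D\<^sup>2)))
        (at (of_real x) within V)"
      using D by (intro tendsto_intros) auto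
    then have lim: "((\<lambda>w. lam j * ((b j - a j) / pi * (Im w / D\<^sup>2))) \<longlongrightarrow> 0) (at (of_real x) within V)" by simp
    show ?thesis by (rule tendsto_sandwich[OF lo up tendsto_const lim])
  qed
  have "s z - f z \<le> 0"
  proof (rule max_principle_frontier[OF oV])
    have sV: "mvp V (\<lambda>z. s z - f z)"
      using f by (intro mvp_diff oV mvp_subset[OF sm]) (auto simp: V_def)
    show "continuous_on V (\<lambda>z. s z - f z)" using mvp_continuous[OF sV] .
    show "submean (\<lambda>z. s z - f z) w" if "w \<in> V" for w using mvp_submean[OF sV that] .
    show "z \<in> V" using z by (simp add: V_def)
    show "\<exists>R. \<forall>w\<in>V. R < cmod w \<longrightarrow> s w - f w < e" if e: "e > 0" for e
    proof -
      define T where "T = (\<Sum>j\<in>F. \<bar>a j\<bar> + \<bar>b j\<bar>)"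
      define L where "L = (\<Sum>j\<in>F. lam j * ((b j - a j) / pi))"
      have tT: "\<bar>t\<bar> \<le> T" if "j \<in> F" "a j < t" "t < b j" for j t
        using member_le_sum[of j F "\<lambda>j. \<bar>a j\<bar> + \<bar>b j\<bar>"] fin that by (auto simp: T_def)
      have L0: "0 \<le> L" unfolding L_def using lam ab by (intro sum_nonneg mult_nonneg_nonneg) (auto simp: less_imp_le)
      have T0: "0 \<le> T" unfolding T_def by (intro sum_nonneg) auto
      define R where "R = 2 * T + 4 * (L + 1) / e"
      show ?thesis
      proof (intro exI[of _ R] ballI impI)
        fix w assume w: "w \<in> V" "R < cmod w"
        have Rp: "0 < cmod w" "2 * T \<le> cmod w" using w T0 L0 e by (auto simp: R_def intro: order.trans less_imp_le) (smt (verit) divide_nonneg_pos)+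
        have "H j w \<le> lam j * ((b j - a j) / pi) * (4 / cmod w)" if j: "j \<in> F" for j
        proof -
          have Dt: "cmod w / 2 \<le> cmod (w - of_real t)" if "a j < t" "t < b j" for t
            using tT[OF j that] Rp norm_triangle_ineq2[of w "of_real t"] by simp
          have "hmeas (a j) (b j) w \<le> (b j - a j) / pi * (Im w / (cmod w / 2)\<^sup>2)"
            using w Rp Dt by (intro hmeas_far ab[OF j]) (auto simp: V_def)
          also have "\<dots> \<le> (b j - a j) / pi * (cmod w / (cmod w / 2)\<^sup>2)"
            using ab[OF j] abs_Im_le_cmod[of w] by (intro mult_left_mono divide_right_mono) auto
          also have "cmod w / (cmod w / 2)\<^sup>2 = 4 / cmod w" using Rp by (simp add: power2_eq_square)
          finally have "hmeas (a j) (b j) w \<le> (b j - a j) / pi * (4 / cmod w)" .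
          from mult_left_mono[OF this lam[OF j]] show ?thesis unfolding H_def by (simp only: mult.assoc)
        qed
        then have "s w \<le> L * (4 / cmod w)" unfolding s_def L_def sum_distrib_right by (intro sum_mono)
        also have "\<dots> < e"
        proof -
          have "4 * (L + 1) / e < cmod w" using w T0 by (simp add: R_def)
          then show ?thesis using e Rp by (simp add: field_simps)
        qed
        finally show "s w - f w < e" using nonneg[of w] w by (simp add: V_def)
      qed
    qed
    show "\<forall>\<^sub>F w in at x within V. s w - f w < e" if x: "x \<notin> V" and e: "e > 0" for x e
    proof -
      consider "x \<in> P" | "Im x < 0" | "Im x = 0" using x by (fastforce simp: V_def)
      then show ?thesis
      proof cases
        case 1
        have "\<forall>\<^sub>F w in at x. sum lam F < f w" using pole[OF 1] by (simp add: filterlim_at_top_dense)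
        then show ?thesis unfolding eventually_at_filter
          by eventually_elim (use sle e in \<open>fastforce simp: V_def\<close>)
      next
        case 2
        have "open {z. Im z < 0}" by (simp add: open_halfspace_Im_lt)
        then have "\<forall>\<^sub>F w in at x. w \<in> {z. Im z < 0}" using 2 by (intro eventually_at_in_open') auto
        then show ?thesis unfolding eventually_at_filter by eventually_elim (auto simp: V_def)
      next
        case 3
        then have xr: "x = of_real (Re x)" by (simp add: complex_eq_iff)
        show ?thesis
        proof (cases "\<exists>j\<in>F. a j \<le> Re x \<and> Re x \<le> b j")
          case True
          then obtain j where j: "j \<in> F" "a j \<le> Re x" "Re x \<le> b j" by blast
          have "((\<lambda>w. \<Sum>i\<in>F - {j}. H i w) \<longlongrightarrow> (\<Sum>i\<in>F - {j}. 0)) (at x within V)"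
            by (intro tendsto_sum) (subst xr, rule H0, use disj[OF j(1) _ _ j(2,3)] in auto)
          moreover have "(f \<longlongrightarrow> f x) (at x within V)"
            using bd[OF j] xr by (metis continuous_at_imp_continuous_within continuous_within isCont_def)
          ultimately have "((\<lambda>w. (\<Sum>i\<in>F - {j}. H i w) - f w) \<longlongrightarrow> (\<Sum>i\<in>F - {j}. 0) - f x) (at x within V)"
            by (intro tendsto_diff)
          moreover have "(\<Sum>i\<in>F - {j}. 0) - f x < e - lam j" using bd[OF j] xr e by simp
          ultimately have "\<forall>\<^sub>F w in at x within V. (\<Sum>i\<in>F - {j}. H i w) - f w < e - lam j"
            by (rule order_tendstoD(2))
          then show ?thesis unfolding eventually_at_filter
          proof eventually_elim
            case (elim w)
            show ?case
            proof (intro impI)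
              assume w: "w \<noteq> x" "w \<in> V"
              have "s w = H j w + (\<Sum>i\<in>F - {j}. H i w)" unfolding s_def using fin j by (simp add: sum.remove)
              moreover have "H j w \<le> lam j" using Hle[OF j(1)] w by (simp add: V_def)
              ultimately show "s w - f w < e" using elim w by simp
            qed
          qed
        next
          case False
          then have out: "Re x < a i \<or> b i < Re x" if "i \<in> F" for i
            using that by (meson not_le)
          have "((\<lambda>w. \<Sum>i\<in>F. H i w) \<longlongrightarrow> (\<Sum>i\<in>F. 0)) (at x within V)"
            by (intro tendsto_sum) (subst xr, rule H0, assumption, erule out)
          then have "(s \<longlongrightarrow> 0) (at x within V)" by (simp add: s_def)
          then have "\<forall>\<^sub>F w in at x within V. s w < e" using e by (rule order_tendstoD(2))
          then show ?thesis unfolding eventually_at_filter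
            by eventually_elim (use nonneg in \<open>fastforce simp: V_def\<close>)
        qed
      qed
    qed
  qed
  then show ?thesis by (simp add: s_def H_def)
qed

text \<open>Testing with the quadratic \<open>(y + y\<^sup>2) / 2\<close>, which lies below \<open>max 0 y\<close> for \<open>-1 \<le> y \<le> 1\<close>
  and has a harmonic extension from the circle to the disc.\<close>

lemma disc_lower_bound:
  assumes S: "open S" and u: "mvp S u" and sub: "cball (of_real x) r \<subseteq> S" and r: "0 < r" and \<kappa>: "0 \<le> \<kappa>"
    and nonneg: "\<And>z. z \<in> sphere (of_real x) r \<Longrightarrow> 0 \<le> u z"
    and lo: "\<And>z. z \<in> sphere (of_real x) r \<Longrightarrow> 0 < Im z \<Longrightarrow> \<kappa> * Im z \<le> u z"
  shows "\<kappa> * r / 4 \<le> u (of_real x)"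
proof -
  define q where "q = (\<lambda>z. (\<kappa> * r / 2) * Re (- \<i> * z / of_real r + (1 - (z - of_real x)\<^sup>2 / of_real (r\<^sup>2)) / 2))"
  have q: "mvp UNIV q"
    unfolding q_def by (intro mvp_cmult mvp_Re_holomorphic holomorphic_intros) (use r in auto)
  have "\<kappa> * r / 4 = q (of_real x)" by (simp add: q_def)
  also have "\<dots> = circ_mean q (of_real x) r" using mvp_circ_mean[OF open_UNIV q _ r] by simp
  also have "\<dots> \<le> circ_mean u (of_real x) r"
  proof (rule circ_mean_le)
    show "continuous_on (cball (of_real x) r) q" using mvp_continuous[OF q] continuous_on_subset by blast
    show "continuous_on (cball (of_real x) r) u" using mvp_continuous[OF u] sub continuous_on_subset by blast
    fix z :: complex assume z: "z \<in> sphere (of_real x) r"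
    define s where "s = Im z / r"
    have im: "\<bar>Im z\<bar> \<le> r" using z abs_Im_le_cmod[of "of_real x - z"] by (simp add: dist_norm)
    have s1: "\<bar>s\<bar> \<le> 1" using im r by (simp add: s_def)
    have "(Re z - x)\<^sup>2 + (Im z)\<^sup>2 = r\<^sup>2"
      using z r by (auto simp: dist_norm cmod_def power2_commute)
    then have re: "Re ((z - of_real x)\<^sup>2) = r\<^sup>2 - 2 * (Im z)\<^sup>2" by (simp add: power2_eq_square)
    have "q z = (\<kappa> * r / 2) * (Im z / r + (1 - Re ((z - of_real x)\<^sup>2) / r\<^sup>2) / 2)"
      unfolding q_def by (simp add: Re_divide_of_real flip: of_real_power del: power2_eq_square)
    also have "\<dots> = (\<kappa> * r / 2) * (s + s\<^sup>2)"
      unfolding re using r by (simp add: s_def field_simps)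
    finally have qz: "q z = (\<kappa> * r / 2) * (s + s\<^sup>2)" .
    show "q z \<le> u z"
    proof (cases "Im z > 0")
      case True
      then have "s\<^sup>2 \<le> s" using s1 r power_decreasing[of 1 2 s] by (simp add: s_def)
      then have "q z \<le> (\<kappa> * r / 2) * (s + s)" unfolding qz using \<kappa> r by (intro mult_left_mono) auto
      also have "\<dots> = \<kappa> * Im z" using r by (simp add: s_def)
      finally show ?thesis using lo[OF z True] by simp
    next
      case False
      then have s0: "s \<le> 0" using r by (simp add: s_def divide_nonpos_pos)
      have "s + s\<^sup>2 = s * (1 + s)" by (simp add: power2_eq_square algebra_simps)
      also have "\<dots> \<le> 0" using s0 s1 by (intro mult_nonpos_nonneg) auto
      finally have "q z \<le> 0" unfolding qz using \<kappa> r by (intro mult_nonneg_nonpos) auto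
      then show ?thesis using nonneg[OF z] by simp
    qed
  qed (use r in auto)
  also have "\<dots> = u (of_real x)" using mvp_circ_mean[OF S u sub r] .
  finally show ?thesis .
qed

section \<open>Boundary regularity\<close>

text \<open>\<open>Re (v powr (1/4))\<close>, written so that its continuity across the branch cut is visible.\<close>

definition root4 :: "complex \<Rightarrow> real" where
  "root4 v = sqrt ((sqrt (cmod v) + sqrt ((cmod v + Re v) / 2)) / 2)"

lemma Re_csqrt: "Re (csqrt v) = sqrt ((cmod v + Re v) / 2)"
  by simp

lemma root4_eq: "root4 v = Re (csqrt (csqrt v))"
  unfolding root4_def by (simp only: Re_csqrt norm_csqrt)

lemma continuous_on_root4: "continuous_on T root4"
  unfolding root4_def by (intro continuous_intros) auto

lemma root4_lower: "sqrt (sqrt (cmod v) / 2) \<le> root4 v"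
proof -
  have "0 \<le> cmod v + Re v" using abs_Re_le_cmod[of v] by linarith
  then show ?thesis unfolding root4_def by (intro real_sqrt_le_mono divide_right_mono) auto
qed

lemma root4_upper: "root4 v \<le> sqrt (sqrt (cmod v))"
proof -
  have "sqrt ((cmod v + Re v) / 2) \<le> sqrt (cmod v)"
    using complex_Re_le_cmod[of v] by (intro real_sqrt_le_mono) simp
  then show ?thesis unfolding root4_def by (intro real_sqrt_le_mono) simp
qed

lemma csqrt_not_nonpos_Reals:
  assumes "v \<notin> \<real>\<^sub>\<le>\<^sub>0"
  shows "csqrt v \<notin> \<real>\<^sub>\<le>\<^sub>0"
proof
  assume "csqrt v \<in> \<real>\<^sub>\<le>\<^sub>0"
  then have "Re (csqrt v) \<le> 0" "Im (csqrt v) = 0" by (auto simp: complex_nonpos_Reals_iff)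
  then have "csqrt v = 0" using csqrt_principal[of v] by (auto simp: complex_eq_iff)
  then show False using assms by simp
qed

text \<open>\<open>root4\<close> is harmonic off the slit, and unlike the imaginary part of a square root
  it has a positive lower bound on the whole circle, including the point on the slit.\<close>

lemma barrier:
  fixes W :: "complex \<Rightarrow> real"
  assumes s: "s = 1 \<or> s = - 1" and \<delta>: "\<delta> > 0"
    and slit: "\<And>t. 0 \<le> t \<Longrightarrow> t \<le> \<delta> \<Longrightarrow> of_real (e + s * t) \<notin> \<Omega>"
    and cont: "continuous_on UNIV W" and M: "M > 0" "\<And>z. z \<in> cball (of_real e) \<delta> \<Longrightarrow> W z \<le> M"
    and out: "\<And>z. z \<notin> \<Omega> \<Longrightarrow> W z \<le> 0" and sub: "\<And>z. z \<in> \<Omega> \<Longrightarrow> submean W z"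
    and z: "z \<in> cball (of_real e) \<delta>"
  shows "W z \<le> M / sqrt (sqrt \<delta> / 2) * sqrt (sqrt (cmod (z - of_real e)))"
proof -
  define K where "K = M / sqrt (sqrt \<delta> / 2)"
  have K: "K > 0" using M \<delta> by (simp add: K_def)
  define b where "b = (\<lambda>z. root4 (- of_real s * (z - of_real e)))"
  have cb: "continuous_on T b" for T
    unfolding b_def by (intro continuous_on_compose2[OF continuous_on_root4[of UNIV]] continuous_intros) auto
  have norm_s: "cmod (- of_real s * (z - of_real e)) = cmod (z - of_real e)" for z
    using s by (auto simp: norm_mult)
  have b0: "0 \<le> b z" for z
    unfolding b_def by (rule order_trans[OF _ root4_lower]) simp
  have bm: "mean_at b z" if "z \<in> \<Omega>" "z \<in> cball (of_real e) \<delta>" for z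
  proof -
    have nz: "- of_real s * (z - of_real e) \<notin> \<real>\<^sub>\<le>\<^sub>0"
    proof
      assume "- of_real s * (z - of_real e) \<in> \<real>\<^sub>\<le>\<^sub>0"
      then obtain t where t: "t \<le> 0" "- of_real s * (z - of_real e) = of_real t"
        by (auto simp: nonpos_Reals_def)
      then have "z - of_real e = of_real (- s * t)" using s by (auto simp: algebra_simps)
      then have ze: "z = of_real (e + s * (- t))" by (simp add: algebra_simps)
      have "- t \<le> \<delta>"
      proof -
        have "cmod (z - of_real e) = \<bar>t\<bar>" using norm_s[of z] unfolding t(2) by simp
        then show ?thesis using that(2) by (simp add: dist_norm norm_minus_commute)
      qed
      then show False using slit[of "- t"] t(1) that(1) ze by simp
    qed
    define S where "S = (\<lambda>z. - of_real s * (z - of_real e)) -` (- \<real>\<^sub>\<le>\<^sub>0 :: complex set)"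
    have oS: "open S"
      unfolding S_def by (intro open_vimage continuous_intros) (simp add: open_Compl closed_nonpos_Reals_complex)
    have "(\<lambda>z. csqrt (csqrt (- of_real s * (z - of_real e)))) holomorphic_on S"
      by (intro holomorphic_intros csqrt_not_nonpos_Reals) (auto simp: S_def)
    from mvp_Re_holomorphic[OF this oS] have "mvp S b" unfolding b_def root4_eq .
    then show ?thesis by (rule mvp_mean_at) (use nz in \<open>simp add: S_def\<close>)
  qed
  define F where "F = (\<lambda>z. W z + - K * b z)"
  have "F z \<le> 0"
  proof (rule max_principle_compact[of "cball (of_real e) \<delta>" F, OF _ _ _ z])
    show "continuous_on (cball (of_real e) \<delta>) F"
      unfolding F_def by (intro continuous_intros cb continuous_on_subset[OF cont]) auto
    fix w assume w: "w \<in> cball (of_real e) \<delta>" "F w > 0"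
    have "K * b w \<ge> 0" using K b0[of w] by simp
    then have Ww: "W w > 0" using w(2) by (simp add: F_def)
    then have w\<Omega>: "w \<in> \<Omega>" using out[of w] by force
    have "w \<in> ball (of_real e) \<delta>"
    proof (rule ccontr)
      assume "w \<notin> ball (of_real e) \<delta>"
      then have "cmod (w - of_real e) = \<delta>" using w(1) by (simp add: dist_norm norm_minus_commute)
      then have "sqrt (sqrt \<delta> / 2) \<le> b w"
        using root4_lower[of "- of_real s * (w - of_real e)"] norm_s[of w] by (simp add: b_def)
      then have "K * sqrt (sqrt \<delta> / 2) \<le> K * b w" using K by (intro mult_left_mono) auto
      then have "M \<le> K * b w" using \<delta> by (simp add: K_def)
      then show False using w M(2)[OF w(1)] by (simp add: F_def)
    qed
    moreover have "submean F w"
      unfolding F_def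
      by (intro submean_add[of UNIV] sub[OF w\<Omega>] mean_at_submean mean_at_cmult bm[OF w\<Omega> w(1)] cont)
         (auto intro!: continuous_intros cb)
    ultimately show "w \<in> interior (cball (of_real e) \<delta>) \<and> submean F w" by simp
  qed auto
  then have "W z \<le> K * b z" by (simp add: F_def)
  also have "\<dots> \<le> K * sqrt (sqrt (cmod (z - of_real e)))"
    using root4_upper[of "- of_real s * (z - of_real e)"] norm_s[of z] K by (intro mult_left_mono) (auto simp: b_def)
  finally show ?thesis by (simp add: K_def)
qed

text \<open>The geometric condition that makes the barrier available at every finite boundary point.\<close>

definition thick_complement :: "complex set \<Rightarrow> bool" where
  "thick_complement \<Omega> \<longleftrightarrow> (\<forall>e. of_real e \<notin> \<Omega> \<longrightarrow>
     (\<exists>\<delta>>0. \<exists>s. (s = 1 \<or> s = - 1) \<and> (\<forall>t. 0 \<le> t \<longrightarrow> t \<le> \<delta> \<longrightarrow> of_real (e + s * t) \<notin> \<Omega>)))"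

lemma tendsto_0_sqrt_sqrt:
  assumes \<delta>: "\<delta> > 0" and W: "\<And>z. z \<in> cball a \<delta> \<Longrightarrow> 0 \<le> W z \<and> W z \<le> C * sqrt (sqrt (cmod (z - a)))"
  shows "(W \<longlongrightarrow> 0) (at a)"
proof (rule tendsto_sandwich)
  have ev: "\<forall>\<^sub>F z in at a. z \<in> cball a \<delta>"
    using eventually_at_in_open'[of "ball a \<delta>" a] \<delta> by (auto elim!: eventually_mono)
  show "\<forall>\<^sub>F z in at a. 0 \<le> W z" using ev by eventually_elim (use W in blast)
  show "\<forall>\<^sub>F z in at a. W z \<le> C * sqrt (sqrt (cmod (z - a)))" using ev by eventually_elim (use W in blast)
  have "((\<lambda>z. C * sqrt (sqrt (cmod (z - a)))) \<longlongrightarrow> C * sqrt (sqrt (cmod (a - a)))) (at a)"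
    by (intro tendsto_intros)
  then show "((\<lambda>z. C * sqrt (sqrt (cmod (z - a)))) \<longlongrightarrow> 0) (at a)" by simp
qed simp

text \<open>Harnack's inequality settles the two half-planes; at a point of a gap the mean over a small
  circle is positive.\<close>

lemma sym_cone_pos:
  assumes \<Omega>: "slit_domain \<Omega>" and W: "W \<in> sym_cone \<Omega>" and i: "0 < W \<i>" and z: "z \<in> \<Omega>"
  shows "0 < W z"
proof -
  define R where "R = cmod z + 1"
  define q where "q = W (Complex 0 (8 * R))"
  have R: "R \<ge> 1" by (simp add: R_def)
  have "W \<i> \<le> 96 * R / \<bar>Im \<i>\<bar> * q"
    unfolding q_def using R by (intro sym_cone_half_plane(2)[OF \<Omega> W]) auto
  then have "0 < 96 * R * q" using i by simp
  then have q: "q > 0" by (rule zero_less_mult_pos) (use R in simp)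
  have lo: "q / (96 * R) * \<bar>Im w\<bar> \<le> W w" if "dist z w \<le> 1" "Im w \<noteq> 0" for w
  proof -
    have "cmod w \<le> R" using that norm_triangle_ineq2[of w z] by (simp add: R_def dist_norm norm_minus_commute)
    then have "\<bar>Im w\<bar> / (96 * R) * q \<le> W w"
      unfolding q_def using that R abs_Re_le_cmod[of w] abs_Im_le_cmod[of w]
      by (intro sym_cone_half_plane(1)[OF \<Omega> W]) auto
    then show ?thesis by (simp add: mult.commute)
  qed
  show ?thesis
  proof (cases "Im z = 0")
    case False
    then have "0 < q / (96 * R) * \<bar>Im z\<bar>" using q R by simp
    then show ?thesis using lo[of z] False by simp
  next
    case True
    then have zr: "z = of_real (Re z)" by (simp add: complex_eq_iff)
    have op: "open \<Omega>" using \<Omega> by (simp add: slit_domain_def)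
    obtain r0 where r0: "r0 > 0" "cball z r0 \<subseteq> \<Omega>" using op z open_contains_cball by blast
    define r where "r = min r0 1"
    have r: "r > 0" "r \<le> 1" "cball (of_real (Re z)) r \<subseteq> \<Omega>"
      using r0 zr by (auto simp: r_def subset_iff)
    have "q / (96 * R) * r / 4 \<le> W (of_real (Re z))"
    proof (rule disc_lower_bound[OF op sym_coneD(5)[OF W] r(3,1)])
      fix w :: complex assume w: "w \<in> sphere (of_real (Re z)) r" "0 < Im w"
      then have "dist z w \<le> 1" using r zr by simp
      then show "q / (96 * R) * Im w \<le> W w" using lo[of w] w by simp
    qed (use q R sym_coneD(2)[OF W] in auto)
    moreover have "0 < q / (96 * R) * r / 4" using q R r by simp
    ultimately show ?thesis using zr by simp
  qed
qed

section \<open>Existence of a symmetric function\<close>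

lemma abs_Im_le_Re_csqrt: "\<bar>Im z\<bar> \<le> Re (csqrt (of_real (n\<^sup>2) - z\<^sup>2))"
proof -
  define v where "v = of_real (n\<^sup>2) - z\<^sup>2"
  have "(cmod z)\<^sup>2 - n\<^sup>2 \<le> cmod v"
    using norm_triangle_ineq2[of "z\<^sup>2" "of_real (n\<^sup>2)"]
    by (simp add: v_def norm_power norm_minus_commute del: of_real_power)
  moreover have "Re v = n\<^sup>2 - (Re z)\<^sup>2 + (Im z)\<^sup>2" by (simp add: v_def power2_eq_square)
  ultimately have "(Im z)\<^sup>2 \<le> (cmod v + Re v) / 2" by (simp add: cmod_power2)
  then have "sqrt ((Im z)\<^sup>2) \<le> sqrt ((cmod v + Re v) / 2)" by (rule real_sqrt_le_mono)
  then show ?thesis unfolding Re_csqrt v_def[symmetric] by simp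
qed

lemma Re_csqrt_upper: "0 \<le> n \<Longrightarrow> Re (csqrt (of_real (n\<^sup>2) - z\<^sup>2)) \<le> n + cmod z"
proof -
  assume n: "0 \<le> n"
  have "Re (csqrt (of_real (n\<^sup>2) - z\<^sup>2)) \<le> cmod (csqrt (of_real (n\<^sup>2) - z\<^sup>2))" by (rule complex_Re_le_cmod)
  also have "\<dots> = sqrt (cmod (of_real (n\<^sup>2) - z\<^sup>2))" by (rule norm_csqrt)
  also have "\<dots> \<le> sqrt ((n + cmod z)\<^sup>2)"
  proof (rule real_sqrt_le_mono)
    have "cmod (of_real (n\<^sup>2) - z\<^sup>2) \<le> n\<^sup>2 + (cmod z)\<^sup>2"
      using norm_triangle_ineq4[of "of_real (n\<^sup>2)" "z\<^sup>2"] by (simp add: norm_power del: of_real_power)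
    also have "\<dots> \<le> (n + cmod z)\<^sup>2" using n by (simp add: power2_sum)
    finally show "cmod (of_real (n\<^sup>2) - z\<^sup>2) \<le> (n + cmod z)\<^sup>2" .
  qed
  finally show ?thesis using n by simp
qed

text \<open>The function is the least harmonic majorant of \<open>\<bar>Im z\<bar>\<close>, symmetric by its minimality.  It
  exists because \<open>Re (csqrt (n\<^sup>2 - z\<^sup>2))\<close> is a harmonic majorant off the real rays \<open>\<bar>x\<bar> \<ge> n\<close>.  The
  boundary values are those of the approximating functions, since the barrier applies to all of
  them with the same constants.\<close>

lemma sym_cone_exists_bounded:
  assumes \<Omega>: "slit_domain \<Omega>" and thick: "thick_complement \<Omega>" and n: "n > 0"
    and bdd: "\<And>x. n \<le> \<bar>x\<bar> \<Longrightarrow> of_real x \<notin> \<Omega>"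
  obtains S where "S \<in> sym_cone \<Omega>" "0 < S \<i>"
proof -
  have op: "open \<Omega>" and i\<Omega>: "\<i> \<in> \<Omega>" using \<Omega> by (auto simp: slit_domain_def)
  define \<psi> where "\<psi> = (\<lambda>z. \<bar>Im z\<bar>)"
  define H0 where "H0 = (\<lambda>z. Re (csqrt (of_real (n\<^sup>2) - z\<^sup>2)))"
  have c\<psi>: "continuous_on UNIV \<psi>" unfolding \<psi>_def by (intro continuous_intros)
  have Im_m: "mvp UNIV Im"
    using mvp_Re_holomorphic[of "\<lambda>z. - \<i> * z" UNIV] by (simp add: holomorphic_intros)
  have s\<psi>: "submean \<psi> z" for z
  proof -
    have "submean (\<lambda>z. max (Im z) (-1 * Im z)) z"
      by (intro submean_max[of UNIV] mvp_submean[OF Im_m] mvp_submean[OF mvp_cmult[OF Im_m]])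
         (auto intro!: continuous_intros)
    moreover have "(\<lambda>z. max (Im z) (-1 * Im z)) = \<psi>" by (auto simp: \<psi>_def fun_eq_iff abs_if max_def)
    ultimately show ?thesis by simp
  qed
  have slit: "of_real (n\<^sup>2) - z\<^sup>2 \<notin> \<real>\<^sub>\<le>\<^sub>0" if z: "z \<in> \<Omega>" for z
  proof
    assume "of_real (n\<^sup>2) - z\<^sup>2 \<in> \<real>\<^sub>\<le>\<^sub>0"
    then have re: "n\<^sup>2 - ((Re z)\<^sup>2 - (Im z)\<^sup>2) \<le> 0" and im: "Re z * Im z = 0"
      by (auto simp: complex_nonpos_Reals_iff power2_eq_square)
    have "Im z = 0"
    proof (rule ccontr)
      assume "Im z \<noteq> 0"
      then have "Re z = 0" using im by simp
      then have "n\<^sup>2 + (Im z)\<^sup>2 \<le> 0" using re by simp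
      then show False using n by (smt (verit) zero_less_power zero_le_power2)
    qed
    then have "z = of_real (Re z)" "n\<^sup>2 \<le> (Re z)\<^sup>2" using re by (auto simp: complex_eq_iff)
    then show False using bdd[of "Re z"] z abs_le_square_iff[of n "Re z"] n by simp
  qed
  have H0m: "mvp \<Omega> H0"
    unfolding H0_def by (intro mvp_Re_holomorphic holomorphic_intros op) (use slit in auto)
  have H0maj: "\<psi> z \<le> H0 z" for z unfolding \<psi>_def H0_def by (rule abs_Im_le_Re_csqrt)
  have ne: "\<Omega> \<noteq> {}" using i\<Omega> by blast
  obtain h \<psi>s where hm: "mvp \<Omega> h"
    and ps: "\<And>k. continuous_on UNIV (\<psi>s k)" "\<And>k z. z \<in> \<Omega> \<Longrightarrow> submean (\<psi>s k) z"
      "\<And>k z. z \<notin> \<Omega> \<Longrightarrow> \<psi>s k z = \<psi> z" "\<And>z. z \<in> \<Omega> \<Longrightarrow> (\<lambda>k. \<psi>s k z) \<longlonglongrightarrow> h z"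
      "\<forall>k H. mvp \<Omega> H \<longrightarrow> (\<forall>z\<in>\<Omega>. \<psi> z \<le> H z) \<longrightarrow> (\<forall>z\<in>\<Omega>. \<psi>s k z \<le> H z)"
    and h: "\<And>z. z \<in> \<Omega> \<Longrightarrow> \<psi> z \<le> h z"
      "\<forall>H. mvp \<Omega> H \<longrightarrow> (\<forall>z\<in>\<Omega>. \<psi> z \<le> H z) \<longrightarrow> (\<forall>z\<in>\<Omega>. h z \<le> H z)"
    by (rule least_harmonic_majorant[OF op ne c\<psi> s\<psi> H0m H0maj]) (rule that)
  define S where "S = (\<lambda>z. if z \<in> \<Omega> then h z else 0)"
  have outside: "Im z = 0" if "z \<notin> \<Omega>" for z using \<Omega> that by (auto simp: slit_domain_def)
  have S0: "0 \<le> S z" for z using order_trans[OF abs_ge_zero, of "Im z" "h z"] h(1)[of z]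
    by (simp add: S_def \<psi>_def)
  have Sm: "mvp \<Omega> S" by (rule mvp_cong[OF op hm]) (simp add: S_def)
  have sym: "S (cnj z) = S z" for z
  proof -
    have "\<forall>z\<in>\<Omega>. \<psi> z \<le> h (cnj z)"
    proof
      fix z assume "z \<in> \<Omega>"
      then show "\<psi> z \<le> h (cnj z)" using h(1)[of "cnj z"] slit_domain_cnj[OF \<Omega>, of z] by (simp add: \<psi>_def)
    qed
    then have "h w \<le> h (cnj w)" if w: "w \<in> \<Omega>" for w
      using h(2) mvp_cnj[OF op slit_domain_cnj[OF \<Omega>] hm] w by blast
    from this[of z] this[of "cnj z"] slit_domain_cnj[OF \<Omega>, of z]
    show ?thesis by (auto simp: S_def)
  qed
  have "continuous_on UNIV S"
  proof (rule continuous_at_imp_continuous_on, rule ballI)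
    fix z :: complex
    show "isCont S z"
    proof (cases "z \<in> \<Omega>")
      case True
      then show ?thesis using mvp_continuous[OF Sm] op continuous_on_eq_continuous_at by blast
    next
      case False
      define e where "e = Re z"
      have z: "z = of_real e" using outside[OF False] by (simp add: e_def complex_eq_iff)
      obtain \<delta> s where \<delta>: "\<delta> > 0" and s: "s = 1 \<or> s = - 1"
        and sl: "\<And>t. 0 \<le> t \<Longrightarrow> t \<le> \<delta> \<Longrightarrow> of_real (e + s * t) \<notin> \<Omega>"
        using thick False unfolding thick_complement_def z by blast
      define M where "M = n + (\<bar>e\<bar> + \<delta>)"
      have M: "M > 0" using n \<delta> by (simp add: M_def)
      define C where "C = M / sqrt (sqrt \<delta> / 2)"
      have C: "C > 0" using M \<delta> by (simp add: C_def)
      have est: "\<psi>s k w \<le> C * sqrt (sqrt (cmod (w - of_real e)))" if w: "w \<in> cball (of_real e) \<delta>" for k w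
        unfolding C_def
      proof (rule barrier[OF s \<delta> sl ps(1) M _ _ ps(2) w])
        fix v :: complex assume v: "v \<in> cball (of_real e) \<delta>"
        show "\<psi>s k v \<le> M"
        proof (cases "v \<in> \<Omega>")
          case True
          have "cmod v \<le> \<bar>e\<bar> + \<delta>"
            using v norm_triangle_ineq2[of v "of_real e"] by (simp add: dist_norm norm_minus_commute)
          moreover have "\<psi>s k v \<le> H0 v" using True ps(5) H0m H0maj by blast
          moreover have "H0 v \<le> n + cmod v" unfolding H0_def using n by (intro Re_csqrt_upper) auto
          ultimately show ?thesis by (simp add: M_def)
        next
          case F2: False
          then show ?thesis using ps(3)[OF F2] outside[OF F2] M by (simp add: \<psi>_def)
        qed
      next
        show "\<psi>s k v \<le> 0" if "v \<notin> \<Omega>" for v using ps(3)[OF that] outside[OF that] by (simp add: \<psi>_def)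
      qed
      have "S w \<le> C * sqrt (sqrt (cmod (w - of_real e)))" if w: "w \<in> cball (of_real e) \<delta>" for w
      proof (cases "w \<in> \<Omega>")
        case True
        then show ?thesis unfolding S_def using LIMSEQ_le_const2[OF ps(4)[OF True]] est[OF w] by auto
      qed (use C in \<open>simp add: S_def\<close>)
      then have "(S \<longlongrightarrow> 0) (at (of_real e))" using S0 by (intro tendsto_0_sqrt_sqrt[OF \<delta>]) auto
      then show ?thesis using False by (simp add: isCont_def S_def z)
    qed
  qed
  then have "S \<in> sym_cone \<Omega>" using S0 sym Sm by (auto simp: sym_cone_def S_def)
  moreover have "0 < S \<i>" using h(1)[OF i\<Omega>] i\<Omega> by (simp add: S_def \<psi>_def)
  ultimately show ?thesis by (rule that)
qed

text \<open>Harnack's inequality gives local equicontinuity, dominated convergence the mean values.\<close>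

lemma mvp_bounded_limit:
  assumes S: "open S" and f: "\<And>k. mvp S (f k)" and bd: "\<And>k z. z \<in> S \<Longrightarrow> 0 \<le> f k z \<and> f k z \<le> B"
    and lim: "\<And>z. z \<in> S \<Longrightarrow> (\<lambda>k. f k z) \<longlonglongrightarrow> h z"
  shows "mvp S h"
  unfolding mvp_def
proof (intro conjI ballI)
  have local: "\<exists>\<rho>>0. cball a \<rho> \<subseteq> S \<and> (\<forall>w\<in>ball a \<rho>. \<bar>h w - h a\<bar> \<le> 2 * dist a w / (\<rho> - dist a w) * B)"
    if a: "a \<in> S" for a
  proof -
    obtain \<rho> where \<rho>: "\<rho> > 0" "cball a \<rho> \<subseteq> S" using S a open_contains_cball by blast
    have "\<bar>h w - h a\<bar> \<le> 2 * dist a w / (\<rho> - dist a w) * B" if w: "w \<in> ball a \<rho>" for w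
    proof (rule LIMSEQ_le_const2)
      have wS: "w \<in> S" using w \<rho>(2) by auto
      show "(\<lambda>k. \<bar>f k w - f k a\<bar>) \<longlonglongrightarrow> \<bar>h w - h a\<bar>" by (intro tendsto_intros lim wS a)
      have "\<bar>f k w - f k a\<bar> \<le> 2 * dist a w / (\<rho> - dist a w) * B" for k
      proof -
        have "\<bar>f k w - f k a\<bar> \<le> 2 * dist a w / (\<rho> - dist a w) * f k a"
          using \<rho> bd by (intro harnack_oscillation[OF S f \<rho>(2) _ w]) auto
        also have "\<dots> \<le> 2 * dist a w / (\<rho> - dist a w) * B" using w bd[OF a] by (intro mult_left_mono) auto
        finally show ?thesis .
      qed
      then show "\<exists>N. \<forall>k\<ge>N. \<bar>f k w - f k a\<bar> \<le> 2 * dist a w / (\<rho> - dist a w) * B" by blast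
    qed
    then show ?thesis using \<rho> by blast
  qed
  show ch: "continuous_on S h"
  proof (rule continuous_at_imp_continuous_on, rule ballI)
    fix a assume "a \<in> S"
    then obtain \<rho> where \<rho>: "\<rho> > 0" "\<forall>w\<in>ball a \<rho>. \<bar>h w - h a\<bar> \<le> 2 * dist a w / (\<rho> - dist a w) * B"
      using local by blast
    have "((\<lambda>w. 2 * dist a w / (\<rho> - dist a w) * B) \<longlongrightarrow> 2 * dist a a / (\<rho> - dist a a) * B) (at a)"
      using \<rho> by (intro tendsto_intros) auto
    then have z: "((\<lambda>w. 2 * dist a w / (\<rho> - dist a w) * B) \<longlongrightarrow> 0) (at a)" by simp
    have "\<forall>\<^sub>F w in at a. norm (h w - h a) \<le> 2 * dist a w / (\<rho> - dist a w) * B"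
      using eventually_at_in_open'[of "ball a \<rho>" a] \<rho> by (auto elim!: eventually_mono)
    from Lim_null_comparison[OF this z] have "((\<lambda>w. h w - h a) \<longlongrightarrow> 0) (at a)" .
    then show "isCont h a" by (simp add: isCont_def LIM_zero_iff)
  qed
  fix a assume a: "a \<in> S"
  obtain r1 where r1: "r1 > 0" "\<And>r. 0 < r \<Longrightarrow> r < r1 \<Longrightarrow> cball a r \<subseteq> S"
    using small_circle[OF S a] by blast
  have "h a = circ_mean h a r" if r: "0 < r" "r < r1" for r
  proof -
    have sub: "cball a r \<subseteq> S" using r1 r by blast
    then have ss: "sphere a r \<subseteq> S" by auto
    have inS: "circ a r t \<in> S" for t using ss circ_in_sphere[of r a t] r by (meson less_imp_le subsetD)
    have "(\<lambda>k. integral {0..1} (\<lambda>t. f k (circ a r t))) \<longlonglongrightarrow> integral {0..1} (\<lambda>t. h (circ a r t))"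
    proof (rule dominated_convergence(2)[where h = "\<lambda>_. B"])
      show "(\<lambda>t. f k (circ a r t)) integrable_on {0..1}" for k
        using r by (intro integrable_circ[OF mvp_continuous[OF f] ss]) auto
      show "norm (f k (circ a r t)) \<le> B" for k t using bd[OF inS, of k t] by simp
      show "(\<lambda>k. f k (circ a r t)) \<longlonglongrightarrow> h (circ a r t)" for t by (rule lim[OF inS])
    qed auto
    then have "(\<lambda>k. circ_mean (f k) a r) \<longlonglongrightarrow> circ_mean h a r" by (simp add: circ_mean_def)
    moreover have "circ_mean (f k) a r = f k a" for k using mvp_circ_mean[OF S f sub] r by simp
    ultimately have "(\<lambda>k. f k a) \<longlonglongrightarrow> circ_mean h a r" by simp
    then show ?thesis using lim[OF a] LIMSEQ_unique by blast
  qed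
  then show "mean_at h a" unfolding mean_at_def using r1(1) by blast
qed

text \<open>Exhaust \<open>\<Omega>\<close> by domains that meet the real axis in bounded sets.  The normalized solutions are
  locally bounded by the growth estimate and locally equicontinuous by Harnack's inequality, so a
  subsequence converges; near the boundary one barrier works for all of them.\<close>

theorem sym_cone_exists:
  assumes \<Omega>: "slit_domain \<Omega>" and thick: "thick_complement \<Omega>"
  obtains V where "V \<in> sym_cone \<Omega>" "\<And>z. z \<in> \<Omega> \<Longrightarrow> 0 < V z"
proof -
  have op: "open \<Omega>" and Im\<Omega>: "\<And>z. Im z \<noteq> 0 \<Longrightarrow> z \<in> \<Omega>" using \<Omega> by (auto simp: slit_domain_def)
  define \<Omega>n where "\<Omega>n = (\<lambda>n::nat. \<Omega> - {z. Im z = 0 \<and> real n + 1 \<le> \<bar>Re z\<bar>})"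
  have sub\<Omega>: "\<Omega>n n \<subseteq> \<Omega>" for n by (auto simp: \<Omega>n_def)
  have sl: "slit_domain (\<Omega>n n)" for n
  proof -
    have "closed {z. Im z = 0 \<and> real n + 1 \<le> \<bar>Re z\<bar>}"
      by (intro closed_Collect_conj closed_Collect_eq closed_Collect_le continuous_intros)
    then show ?thesis using op Im\<Omega> by (auto simp: slit_domain_def \<Omega>n_def)
  qed
  have th: "thick_complement (\<Omega>n n)" for n
    unfolding thick_complement_def
  proof (intro allI impI)
    fix e assume e: "of_real e \<notin> \<Omega>n n"
    show "\<exists>\<delta>>0. \<exists>s. (s = 1 \<or> s = - 1) \<and> (\<forall>t. 0 \<le> t \<longrightarrow> t \<le> \<delta> \<longrightarrow> of_real (e + s * t) \<notin> \<Omega>n n)"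
    proof (cases "of_real e \<in> \<Omega>")
      case True
      then have "real n + 1 \<le> \<bar>e\<bar>" using e by (simp add: \<Omega>n_def)
      then show ?thesis
        by (intro exI[of _ 1] conjI exI[of _ "if e > 0 then 1 else - 1"]) (auto simp: \<Omega>n_def)
    next
      case False
      then show ?thesis using thick sub\<Omega>[of n] unfolding thick_complement_def by (meson subsetD)
    qed
  qed
  have "\<exists>v. v \<in> sym_cone (\<Omega>n n) \<and> v \<i> = 1" for n
  proof -
    obtain S where S: "S \<in> sym_cone (\<Omega>n n)" "0 < S \<i>"
    proof (rule sym_cone_exists_bounded[OF sl th, of "real n + 1"])
      show "of_real x \<notin> \<Omega>n n" if "real n + 1 \<le> \<bar>x\<bar>" for x using that by (simp add: \<Omega>n_def)
    qed auto
    have "(\<lambda>z. 1 / S \<i> * S z) \<in> sym_cone (\<Omega>n n)"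
      unfolding sym_cone_def mem_Collect_eq
    proof (intro conjI allI impI)
      show "continuous_on UNIV (\<lambda>z. 1 / S \<i> * S z)" by (intro continuous_intros sym_coneD(1)[OF S(1)])
      show "mvp (\<Omega>n n) (\<lambda>z. 1 / S \<i> * S z)" by (rule mvp_cmult[OF sym_coneD(5)[OF S(1)]])
    qed (use S(2) sym_coneD(2-4)[OF S(1)] in auto)
    then show ?thesis using S(2) by (intro exI[of _ "\<lambda>z. 1 / S \<i> * S z"]) simp
  qed
  then obtain v where v: "\<And>n. v n \<in> sym_cone (\<Omega>n n)" "\<And>n. v n \<i> = 1" by metis
  define B where "B = (\<lambda>z. 12288 * (1 + cmod z))"
  have vB: "v n z \<le> B z" for n z using sym_cone_growth[OF sl v(1), of n z] v(2) by (simp add: B_def)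
  have v0: "0 \<le> v n z" for n z using sym_coneD(2)[OF v(1)] .
  have Bpos: "B z > 0" for z by (simp add: B_def add_pos_nonneg)
  obtain Q :: "complex set" where Q: "countable Q" "\<And>X. open X \<Longrightarrow> X \<noteq> {} \<Longrightarrow> \<exists>q\<in>Q. q \<in> X"
    using countable_dense_setE by metis
  have "norm (v n z / B z) \<le> 1" for n z using vB[of n z] v0[of n z] Bpos[of z] by simp
  then obtain k where k: "strict_mono k" "\<And>z. z \<in> Q \<Longrightarrow> \<exists>l. (\<lambda>n. v (k n) z / B z) \<longlonglongrightarrow> l"
    using function_convergent_subsequence[OF Q(1), of "\<lambda>n z. v n z / B z" 1] by blast
  have convQ: "Cauchy (\<lambda>n. v (k n) z)" if zQ: "z \<in> Q" for z
  proof -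
    obtain l where "(\<lambda>n. v (k n) z / B z) \<longlonglongrightarrow> l" using k(2)[OF zQ] by blast
    from tendsto_mult_left[OF this, of "B z"] have "(\<lambda>n. v (k n) z) \<longlonglongrightarrow> B z * l" using Bpos[of z] by simp
    then show ?thesis using LIMSEQ_imp_Cauchy by blast
  qed
  have disc: "\<exists>\<rho>>0. \<exists>N. \<forall>n\<ge>N. cball z \<rho> \<subseteq> \<Omega>n (k n)" if z: "z \<in> \<Omega>" for z
  proof -
    obtain \<rho> where \<rho>: "\<rho> > 0" "cball z \<rho> \<subseteq> \<Omega>" using op z open_contains_cball by blast
    obtain N :: nat where N: "cmod z + \<rho> \<le> real N" using real_arch_simple by blast
    have "cball z \<rho> \<subseteq> \<Omega>n (k n)" if n: "n \<ge> N" for n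
    proof
      fix w assume w: "w \<in> cball z \<rho>"
      have "\<bar>Re w\<bar> \<le> cmod z + \<rho>"
        using w abs_Re_le_cmod[of w] norm_triangle_ineq2[of w z] by (simp add: dist_norm norm_minus_commute)
      also have "\<dots> \<le> real (k n)" using N n seq_suble[OF k(1), of n] by linarith
      finally show "w \<in> \<Omega>n (k n)" using w \<rho>(2) by (auto simp: \<Omega>n_def)
    qed
    then show ?thesis using \<rho>(1) by blast
  qed
  have osc: "\<bar>v m w - v m z\<bar> \<le> 4 / \<rho> * dist z w * B z"
    if sub: "cball z \<rho> \<subseteq> \<Omega>n m" and \<rho>: "\<rho> > 0" and w: "dist z w \<le> \<rho> / 2" for m z w \<rho>
  proof -
    have "\<bar>v m w - v m z\<bar> \<le> 2 * dist z w / (\<rho> - dist z w) * v m z"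
      using sl[of m] v0 w \<rho>
      by (intro harnack_oscillation[OF _ sym_coneD(5)[OF v(1)] sub]) (auto simp: slit_domain_def)
    also have "\<dots> \<le> 2 * dist z w / (\<rho> / 2) * B z"
      using w \<rho> vB v0 by (intro mult_mono divide_left_mono mult_pos_pos) auto
    finally show ?thesis by (simp add: mult_ac)
  qed
  have conv: "\<exists>l. (\<lambda>n. v (k n) z) \<longlonglongrightarrow> l" for z
  proof (cases "z \<in> \<Omega>")
    case False
    then have "v (k n) z = 0" for n using sym_coneD(4)[OF v(1)] sub\<Omega> by blast
    then show ?thesis by auto
  next
    case True
    obtain \<rho> N where \<rho>: "\<rho> > 0" "\<And>n. n \<ge> N \<Longrightarrow> cball z \<rho> \<subseteq> \<Omega>n (k n)" using disc[OF True] by blast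
    have "Cauchy (\<lambda>n. v (k n) z)"
      unfolding Cauchy_def
    proof (intro allI impI)
      fix e :: real assume e: "e > 0"
      define \<eta> where "\<eta> = min (\<rho> / 2) (e * \<rho> / (16 * B z))"
      have \<eta>: "\<eta> > 0" using e \<rho> Bpos by (simp add: \<eta>_def)
      obtain q where q: "q \<in> Q" "q \<in> ball z \<eta>" using Q(2)[of "ball z \<eta>"] \<eta> by auto
      have dq: "dist z q \<le> \<rho> / 2" "dist z q \<le> e * \<rho> / (16 * B z)" using q(2) by (auto simp: \<eta>_def)
      have small: "\<bar>v (k n) q - v (k n) z\<bar> \<le> e / 4" if "n \<ge> N" for n
      proof -
        have "\<bar>v (k n) q - v (k n) z\<bar> \<le> 4 / \<rho> * dist z q * B z" using osc[OF \<rho>(2)[OF that] \<rho>(1) dq(1)] .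
        also have "\<dots> \<le> 4 / \<rho> * (e * \<rho> / (16 * B z)) * B z"
          using dq(2) \<rho>(1) Bpos[of z] by (intro mult_right_mono mult_left_mono) auto
        also have "\<dots> = e / 4" using \<rho>(1) Bpos[of z] by simp
        finally show ?thesis .
      qed
      obtain N' where N': "\<And>m n. m \<ge> N' \<Longrightarrow> n \<ge> N' \<Longrightarrow> dist (v (k m) q) (v (k n) q) < e / 4"
        using convQ[OF q(1)] e unfolding Cauchy_def by (metis divide_pos_pos zero_less_numeral)
      show "\<exists>M. \<forall>m\<ge>M. \<forall>n\<ge>M. dist (v (k m) z) (v (k n) z) < e"
      proof (intro exI[of _ "max N N'"] allI impI)
        fix m n assume mn: "max N N' \<le> m" "max N N' \<le> n"
        have "\<bar>v (k m) q - v (k m) z\<bar> \<le> e / 4" "\<bar>v (k n) q - v (k n) z\<bar> \<le> e / 4"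
          "dist (v (k m) q) (v (k n) q) < e / 4"
          using small[of m] small[of n] N'[of m n] mn by simp_all
        then show "dist (v (k m) z) (v (k n) z) < e"
          using e unfolding dist_real_def by linarith
      qed
    qed
    then show ?thesis using Cauchy_convergent_iff convergent_def by blast
  qed
  then obtain V where V: "\<And>z. (\<lambda>n. v (k n) z) \<longlonglongrightarrow> V z" by metis
  have V0: "0 \<le> V z" for z using LIMSEQ_le_const[OF V] v0 by blast
  have Vz: "V z = 0" if "z \<notin> \<Omega>" for z
  proof -
    have "v (k n) z = 0" for n using sym_coneD(4)[OF v(1)] sub\<Omega> that by blast
    then show ?thesis using V[of z] by (simp add: LIMSEQ_const_iff)
  qed
  have Vs: "V (cnj z) = V z" for z
    using V[of z] V[of "cnj z"] sym_coneD(3)[OF v(1)] LIMSEQ_unique by simp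
  have Vm: "mvp \<Omega> V"
  proof (rule mvp_local)
    fix z assume "z \<in> \<Omega>"
    then obtain \<rho> N where \<rho>: "\<rho> > 0" "\<And>n. n \<ge> N \<Longrightarrow> cball z \<rho> \<subseteq> \<Omega>n (k n)" using disc by blast
    have "mvp (ball z \<rho>) V"
    proof (rule mvp_bounded_limit[of _ "\<lambda>n. v (k (n + N))" "12288 * (1 + (cmod z + \<rho>))"])
      show "mvp (ball z \<rho>) (v (k (n + N)))" for n
        using \<rho>(2)[of "n + N"] by (intro mvp_subset[OF sym_coneD(5)[OF v(1)]]) (auto simp: subset_iff)
      show "0 \<le> v (k (n + N)) w \<and> v (k (n + N)) w \<le> 12288 * (1 + (cmod z + \<rho>))" if "w \<in> ball z \<rho>" for n w
      proof -
        have "cmod w \<le> cmod z + \<rho>" using that norm_triangle_ineq2[of w z] by (simp add: dist_norm norm_minus_commute)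
        then show ?thesis using vB[of "k (n + N)" w] v0 by (simp add: B_def)
      qed
      show "(\<lambda>n. v (k (n + N)) w) \<longlonglongrightarrow> V w" for w using LIMSEQ_ignore_initial_segment[OF V] .
    qed auto
    then show "\<exists>T. open T \<and> z \<in> T \<and> mvp T V" using \<rho>(1) by (intro exI[of _ "ball z \<rho>"]) auto
  qed
  have "continuous_on UNIV V"
  proof (rule continuous_at_imp_continuous_on, rule ballI)
    fix z :: complex
    show "isCont V z"
    proof (cases "z \<in> \<Omega>")
      case True
      then show ?thesis using mvp_continuous[OF Vm] op continuous_on_eq_continuous_at by blast
    next
      case False
      define e where "e = Re z"
      have z: "z = of_real e" using Im\<Omega>[of z] False by (auto simp: e_def complex_eq_iff)
      obtain \<delta> s where \<delta>: "\<delta> > 0" and s: "s = 1 \<or> s = - 1"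
        and sl': "\<And>t. 0 \<le> t \<Longrightarrow> t \<le> \<delta> \<Longrightarrow> of_real (e + s * t) \<notin> \<Omega>"
        using thick False unfolding thick_complement_def z by blast
      define M where "M = 12288 * (1 + (\<bar>e\<bar> + \<delta>))"
      have M: "M > 0" using \<delta> by (simp add: M_def add_pos_nonneg)
      define C where "C = M / sqrt (sqrt \<delta> / 2)"
      have est: "v n w \<le> C * sqrt (sqrt (cmod (w - of_real e)))" if w: "w \<in> cball (of_real e) \<delta>" for n w
        unfolding C_def
      proof (rule barrier[OF s \<delta> _ sym_coneD(1)[OF v(1)] M _ _ _ w])
        show "of_real (e + s * t) \<notin> \<Omega>n n" if "0 \<le> t" "t \<le> \<delta>" for t using sl'[OF that] sub\<Omega> by blast
        fix w :: complex
        show "v n w \<le> M" if "w \<in> cball (of_real e) \<delta>"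
        proof -
          have "cmod w \<le> \<bar>e\<bar> + \<delta>"
            using that norm_triangle_ineq2[of w "of_real e"] by (simp add: dist_norm norm_minus_commute)
          then show ?thesis using vB[of n w] by (simp add: B_def M_def)
        qed
        show "v n w \<le> 0" if "w \<notin> \<Omega>n n" using sym_coneD(4)[OF v(1) that] by simp
        show "submean (v n) w" if "w \<in> \<Omega>n n" using mvp_submean[OF sym_coneD(5)[OF v(1)] that] .
      qed
      have "V w \<le> C * sqrt (sqrt (cmod (w - of_real e)))" if w: "w \<in> cball (of_real e) \<delta>" for w
        using LIMSEQ_le_const2[OF V] est[OF w] by blast
      then have "(V \<longlongrightarrow> 0) (at (of_real e))" using V0 by (intro tendsto_0_sqrt_sqrt[OF \<delta>]) auto
      then show ?thesis using Vz[OF False] by (simp add: isCont_def z)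
    qed
  qed
  then have VP: "V \<in> sym_cone \<Omega>" using V0 Vz Vs Vm by (auto simp: sym_cone_def)
  have "V \<i> = 1" using V[of \<i>] v(2) by (simp add: LIMSEQ_const_iff)
  then have "0 < V z" if "z \<in> \<Omega>" for z using sym_cone_pos[OF \<Omega> VP _ that] by simp
  then show ?thesis using VP that by blast
qed

section \<open>Divergence of the sum over the gaps\<close>

locale gap_domain =
  fixes \<Omega> :: "complex set" and J :: "int set" and c d :: "int \<Rightarrow> real"
  assumes slit: "slit_domain \<Omega>"
    and real_in: "\<And>x. of_real x \<in> \<Omega> \<longleftrightarrow> (\<exists>j\<in>J. c j < x \<and> x < d j)"
    and cd: "\<And>j. j \<in> J \<Longrightarrow> c j < d j"
    and order: "\<And>i j. i \<in> J \<Longrightarrow> j \<in> J \<Longrightarrow> i < j \<Longrightarrow> d i < c j"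
    and convex_J: "\<And>i j k. i \<in> J \<Longrightarrow> k \<in> J \<Longrightarrow> i \<le> j \<Longrightarrow> j \<le> k \<Longrightarrow> j \<in> J"
    and zero_J: "0 \<in> J"
begin

lemma op: "open \<Omega>" and Im_in: "Im z \<noteq> 0 \<Longrightarrow> z \<in> \<Omega>"
  using slit by (auto simp: slit_domain_def)

lemma i_in: "\<i> \<in> \<Omega>"
  by (rule Im_in) simp

lemma mono_d: "i \<in> J \<Longrightarrow> j \<in> J \<Longrightarrow> i \<le> j \<Longrightarrow> d i \<le> d j"
  using order[of i j] cd[of j] by (cases "i = j") auto

lemma mono_c: "i \<in> J \<Longrightarrow> j \<in> J \<Longrightarrow> i \<le> j \<Longrightarrow> c i \<le> c j"
  using order[of i j] cd[of i] by (cases "i = j") auto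

text \<open>Only finitely many gaps lie between two given ones, so a complementary point with gaps on
  both sides lies between two consecutive gaps.\<close>

lemma thick: "thick_complement \<Omega>"
  unfolding thick_complement_def
proof (intro allI impI)
  fix e assume "of_real e \<notin> \<Omega>"
  then have out: "d j \<le> e \<or> e \<le> c j" if "j \<in> J" for j using real_in[of e] that by force
  let ?thesis = "\<exists>\<delta>>0. \<exists>s. (s = 1 \<or> s = - 1) \<and> (\<forall>t. 0 \<le> t \<longrightarrow> t \<le> \<delta> \<longrightarrow> of_real (e + s * t) \<notin> \<Omega>)"
  have right: ?thesis if "\<delta> > 0" "\<And>x. e \<le> x \<Longrightarrow> x \<le> e + \<delta> \<Longrightarrow> of_real x \<notin> \<Omega>" for \<delta>
  proof -
    have "\<forall>t. 0 \<le> t \<longrightarrow> t \<le> \<delta> \<longrightarrow> of_real (e + 1 * t) \<notin> \<Omega>"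
      using that(2) by (simp del: of_real_add)
    then show ?thesis using that(1) by blast
  qed
  have left: ?thesis if "\<delta> > 0" "\<And>x. e - \<delta> \<le> x \<Longrightarrow> x \<le> e \<Longrightarrow> of_real x \<notin> \<Omega>" for \<delta>
  proof -
    have "\<forall>t. 0 \<le> t \<longrightarrow> t \<le> \<delta> \<longrightarrow> of_real (e + - 1 * t) \<notin> \<Omega>"
      using that(2) by (simp del: of_real_add of_real_diff)
    then show ?thesis using that(1) by blast
  qed
  consider "\<forall>j\<in>J. d j \<le> e" | "\<forall>j\<in>J. e \<le> c j" | i j where "i \<in> J" "d i \<le> e" "j \<in> J" "e \<le> c j"
    using out by (metis linorder_not_le)
  then show ?thesis
  proof cases
    case 1
    show ?thesis
    proof (rule right[of 1])
      show "of_real x \<notin> \<Omega>" if "e \<le> x" for x using 1 real_in[of x] that by force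
    qed simp
  next
    case 2
    show ?thesis
    proof (rule left[of 1])
      show "of_real x \<notin> \<Omega>" if "x \<le> e" for x using 2 real_in[of x] that by force
    qed simp
  next
    case 3
    define A where "A = {k \<in> J. d k \<le> e}"
    have Aj: "k < j" if "k \<in> A" for k
    proof (rule ccontr)
      assume "\<not> k < j"
      then have "d j \<le> d k" using mono_d[of j k] that 3 by (auto simp: A_def)
      then show False using that cd[OF 3(3)] 3(4) by (auto simp: A_def)
    qed
    have fin: "finite (A \<inter> {i..j})" by simp
    have iA: "i \<in> A \<inter> {i..j}" using 3 Aj[of i] by (auto simp: A_def)
    define k where "k = Max (A \<inter> {i..j})"
    have ne: "A \<inter> {i..j} \<noteq> {}" using iA by blast
    have k: "k \<in> A" "i \<le> k" using Max_in[OF fin ne] unfolding k_def by simp_all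
    have kJ: "k \<in> J" "d k \<le> e" using k by (auto simp: A_def)
    have k1: "k + 1 \<in> J" using convex_J[OF kJ(1) 3(3), of "k + 1"] Aj[OF k(1)] by simp
    have "k + 1 \<notin> A"
    proof
      assume "k + 1 \<in> A"
      then have "k + 1 \<in> A \<inter> {i..j}" using Aj[of "k + 1"] k by auto
      then show False using Max_ge[OF fin, of "k + 1"] by (simp add: k_def)
    qed
    then have ek: "e \<le> c (k + 1)" using out[OF k1] k1 by (auto simp: A_def)
    have between: "of_real x \<notin> \<Omega>" if x: "d k \<le> x" "x \<le> c (k + 1)" for x
    proof
      assume "of_real x \<in> \<Omega>"
      then obtain l where l: "l \<in> J" "c l < x" "x < d l" using real_in by blast
      show False
      proof (cases "l \<le> k")
        case True
        then show ?thesis using mono_d[OF l(1) kJ(1)] l x by simp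
      next
        case False
        then show ?thesis using mono_c[OF k1 l(1)] l x by simp
      qed
    qed
    show ?thesis
    proof (cases "e < c (k + 1)")
      case True
      show ?thesis by (rule right[of "c (k + 1) - e"]) (use True kJ(2) between in auto)
    next
      case False
      have "d k < c (k + 1)" using order[OF kJ(1) k1] by simp
      then show ?thesis using False ek by (intro left[of "e - d k"]) (use between in auto)
    qed
  qed
qed

lemma slit_interval:
  obtains a b where "a < b" "\<And>x. a \<le> x \<Longrightarrow> x \<le> b \<Longrightarrow> of_real x \<notin> \<Omega>"
proof -
  have "of_real (d 0) \<notin> \<Omega>"
  proof
    assume "of_real (d 0) \<in> \<Omega>"
    then obtain j where j: "j \<in> J" "c j < d 0" "d 0 < d j" using real_in by blast
    then show False using mono_d[OF j(1) zero_J] order[OF zero_J j(1)] by linarith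
  qed
  then obtain \<delta> s where \<delta>: "\<delta> > 0" "s = 1 \<or> s = - 1"
    "\<And>t. 0 \<le> t \<Longrightarrow> t \<le> \<delta> \<Longrightarrow> of_real (d 0 + s * t) \<notin> \<Omega>"
    using thick unfolding thick_complement_def by blast
  show ?thesis
  proof (cases "s = 1")
    case True
    show ?thesis
    proof (rule that[of "d 0" "d 0 + \<delta>"])
      show "of_real x \<notin> \<Omega>" if "d 0 \<le> x" "x \<le> d 0 + \<delta>" for x
        using \<delta>(3)[of "x - d 0"] that True by simp
    qed (use \<delta> in simp)
  next
    case False
    show ?thesis
    proof (rule that[of "d 0 - \<delta>" "d 0"])
      show "of_real x \<notin> \<Omega>" if "d 0 - \<delta> \<le> x" "x \<le> d 0" for x
        using \<delta>(2) \<delta>(3)[of "d 0 - x"] that False by simp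
    qed (use \<delta> in simp)
  qed
qed

text \<open>The interval \<open>[lo j, hi j]\<close> is the middle half of the gap.  A gap with index in \<open>J0\<close> lies on one
  side of the origin, so that \<open>weight j\<close> bounds \<open>\<bar>x\<bar> + 1\<close> for its points; at most one gap is left out.\<close>

definition len where "len j = d j - c j"
definition weight where "weight j = \<bar>c j + d j\<bar> + 1"
definition lo where "lo j = (c j + d j) / 2 - len j / 4"
definition hi where "hi j = (c j + d j) / 2 + len j / 4"
definition J0 where "J0 = {j \<in> J. \<not> (c j < 0 \<and> 0 < d j)}"

lemma J0_D:
  assumes "j \<in> J0"
  shows "j \<in> J" "0 < len j" "lo j < hi j" "hi j - lo j = len j / 2" "0 \<le> c j \<or> d j \<le> 0" "0 < weight j"
  using assms cd[of j] by (auto simp: J0_def len_def lo_def hi_def weight_def field_simps)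

lemma gap_disc:
  assumes j: "j \<in> J0" and x: "lo j \<le> x" "x \<le> hi j" and z: "z \<in> cball (of_real x) (len j / 8)"
  shows "z \<in> \<Omega>" "cmod z + 1 \<le> weight j" "z \<noteq> \<i>"
proof -
  have r: "\<bar>Re z - x\<bar> \<le> len j / 8"
    using z abs_Re_le_cmod[of "z - of_real x"] by (simp add: dist_norm norm_minus_commute)
  have "c j < Re z" "Re z < d j"
    using r x J0_D(2)[OF j] unfolding lo_def hi_def len_def abs_le_iff by (simp_all add: field_simps)
  then show "z \<in> \<Omega>"
    using real_in[of "Re z"] J0_D(1)[OF j] Im_in[of z] by (cases "Im z = 0") (auto simp: complex_eq_iff complex_is_Real_iff of_real_Re)
  have "cmod z \<le> \<bar>x\<bar> + len j / 8"
    using z norm_triangle_ineq2[of z "of_real x"] by (simp add: dist_norm norm_minus_commute)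
  also have "\<dots> \<le> \<bar>c j + d j\<bar>"
    using x J0_D(2,5)[OF j] unfolding lo_def hi_def len_def by (auto simp: abs_if field_simps)
  finally show "cmod z + 1 \<le> weight j" by (simp add: weight_def)
  show "z \<noteq> \<i>"
  proof
    assume zi: "z = \<i>"
    have "len j / 4 \<le> \<bar>x\<bar>" using x J0_D(2,5)[OF j] unfolding lo_def hi_def len_def by (auto simp: abs_if field_simps)
    also have "\<dots> \<le> len j / 8" using r zi by simp
    finally show False using J0_D(2)[OF j] by simp
  qed
qed

lemma middle_disjoint:
  assumes "i \<in> J0" "j \<in> J0" "i \<noteq> j" "lo i \<le> x" "x \<le> hi i"
  shows "x < lo j \<or> hi j < x"
proof (cases "i < j")
  case True
  then show ?thesis using order[of i j] J0_D(1,2)[OF assms(1)] J0_D(1,2)[OF assms(2)] assms(5)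
    by (simp add: lo_def hi_def len_def field_simps)
next
  case False
  then show ?thesis using order[of j i] J0_D(1,2)[OF assms(1)] J0_D(1,2)[OF assms(2)] assms(3,4)
    by (simp add: lo_def hi_def len_def field_simps)
qed

lemma finite_exception: "finite (J - J0)"
proof (cases "J - J0 = {}")
  case False
  then obtain j where j: "j \<in> J - J0" by blast
  have "i = j" if i: "i \<in> J - J0" for i
  proof (rule ccontr)
    assume "i \<noteq> j"
    then show False using order[of i j] order[of j i] i j by (auto simp: J0_def) (smt (verit))
  qed
  then have "J - J0 \<subseteq> {j}" by blast
  then show ?thesis using finite_subset by blast
qed (simp only: finite.emptyI)

lemma sum_bounded_imp_finite:
  assumes K: "\<And>F. finite F \<Longrightarrow> F \<subseteq> J0 \<Longrightarrow> (\<Sum>j\<in>F. (len j / weight j)\<^sup>2) \<le> K"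
  shows "(\<Sum>\<^sub>\<infinity>j\<in>J. ennreal ((len j / weight j)\<^sup>2)) < \<infinity>"
proof -
  define f where "f = (\<lambda>j. (len j / weight j)\<^sup>2)"
  define K' where "K' = K + sum f (J - J0)"
  have "sum (\<lambda>j. ennreal (f j)) F \<le> ennreal K'" if F: "finite F" "F \<subseteq> J" for F
  proof -
    have "sum f F = sum f (F \<inter> J0) + sum f (F - J0)"
      using F(1) by (metis Int_Diff_disjoint finite_Int finite_Diff Int_Diff_Un sum.union_disjoint)
    also have "\<dots> \<le> K + sum f (J - J0)"
    proof (rule add_mono)
      show "sum f (F \<inter> J0) \<le> K" unfolding f_def using F by (intro K) auto
      show "sum f (F - J0) \<le> sum f (J - J0)"
        using F finite_exception by (intro sum_mono2) (auto simp: f_def)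
    qed
    finally have "sum f F \<le> K'" by (simp add: K'_def)
    then show ?thesis by (subst sum_ennreal) (auto simp: f_def intro: ennreal_leI)
  qed
  then have "(\<Sum>\<^sub>\<infinity>j\<in>J. ennreal (f j)) \<le> ennreal K'"
    by (subst nonneg_infsum_complete) (auto intro!: SUP_least)
  also have "\<dots> < \<infinity>" by simp
  finally show ?thesis by (simp add: f_def)
qed

text \<open>A disc of radius \<open>len j / 8\<close> around a point of the middle half stays in \<open>\<Omega>\<close> and avoids \<open>\<i>\<close>.\<close>

lemma middle_lower_bound:
  assumes j: "j \<in> J0" and x: "lo j \<le> x" "x \<le> hi j" and u: "mvp (\<Omega> - {\<i>}) u" and \<kappa>: "0 \<le> \<kappa>"
    and nonneg: "\<And>z. z \<in> \<Omega> - {\<i>} \<Longrightarrow> 0 \<le> u z"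
    and low: "\<And>z. z \<in> \<Omega> - {\<i>} \<Longrightarrow> 0 < Im z \<Longrightarrow> cmod z + 1 \<le> weight j \<Longrightarrow> \<kappa> * Im z \<le> u z"
  shows "\<kappa> * len j / 32 \<le> u (of_real x)"
proof -
  have "\<kappa> * (len j / 8) / 4 \<le> u (of_real x)"
  proof (rule disc_lower_bound[OF _ u])
    show "open (\<Omega> - {\<i>})" using op by (simp add: open_delete)
    show "cball (of_real x) (len j / 8) \<subseteq> \<Omega> - {\<i>}" using gap_disc[OF j x] by blast
    fix z :: complex assume z: "z \<in> sphere (of_real x) (len j / 8)"
    then have zc: "z \<in> cball (of_real x) (len j / 8)" by auto
    show "0 \<le> u z" using nonneg gap_disc[OF j x zc] by blast
    show "\<kappa> * Im z \<le> u z" if "0 < Im z" using low[of z] gap_disc[OF j x zc] that by blast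
  qed (use J0_D(2)[OF j] \<kappa> in auto)
  then show ?thesis by simp
qed

lemma hmeas_middle:
  assumes j: "j \<in> J0" and y: "0 < y"
  shows "len j / (2 * pi) * (y / ((weight j - 1)\<^sup>2 + y\<^sup>2)) \<le> hmeas (lo j) (hi j) (Complex 0 y)"
proof -
  have ab: "lo j < hi j" using J0_D(3)[OF j] .
  obtain t where t: "lo j < t" "t < hi j"
    "hmeas (lo j) (hi j) (Complex 0 y) = (hi j - lo j) / pi * (y / ((0 - t)\<^sup>2 + y\<^sup>2))"
    using hmeas_kernel[OF ab, of "Complex 0 y"] y by auto
  have "of_real t \<in> cball (of_real t :: complex) (len j / 8)" using J0_D(2)[OF j] by simp
  from gap_disc(2)[OF j _ _ this] t have "\<bar>t\<bar> \<le> weight j - 1" by simp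
  then have "t\<^sup>2 \<le> (weight j - 1)\<^sup>2" using power_mono[of "\<bar>t\<bar>" "weight j - 1" 2] by simp
  then have "y / ((weight j - 1)\<^sup>2 + y\<^sup>2) \<le> y / ((0 - t)\<^sup>2 + y\<^sup>2)"
    using y by (intro divide_left_mono mult_pos_pos add_nonneg_pos) auto
  then have "len j / (2 * pi) * (y / ((weight j - 1)\<^sup>2 + y\<^sup>2)) \<le> len j / (2 * pi) * (y / ((0 - t)\<^sup>2 + y\<^sup>2))"
    using J0_D(2)[OF j] by (intro mult_left_mono) auto
  also have "\<dots> = hmeas (lo j) (hi j) (Complex 0 y)" unfolding t(3) J0_D(4)[OF j] by simp
  finally show ?thesis .
qed

text \<open>A positive multiple of \<open>Im z\<close> below \<open>U\<close> forces \<open>U\<close> to be at least a multiple of the gap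
  length in the middle of each gap, while the Poisson integral of \<open>U\<close> at \<open>\<i>\<close> is finite.\<close>

lemma linear_minorant_sum:
  assumes cont: "continuous_on UNIV U" and nonneg: "\<And>z. 0 \<le> U z" and U: "mvp \<Omega> U"
    and \<kappa>: "\<kappa> > 0" and low: "\<And>z. Im z > 0 \<Longrightarrow> \<kappa> * Im z \<le> U z"
    and F: "finite F" "F \<subseteq> J0"
  shows "(\<Sum>j\<in>F. (len j / weight j)\<^sup>2) \<le> 64 * pi / \<kappa> * U \<i>"
proof -
  have "(\<Sum>j\<in>F. \<kappa> * len j / 32 * hmeas (lo j) (hi j) \<i>) \<le> U \<i>"
  proof (rule step_function_minorant[where P = "{}"])
    show "x < lo j \<or> hi j < x" if "i \<in> F" "j \<in> F" "i \<noteq> j" "lo i \<le> x" "x \<le> hi i" for i j x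
      using middle_disjoint[of i j x] that F(2) by blast
    show "mvp ({z. 0 < Im z} - {}) U" by (rule mvp_subset[OF U]) (auto intro: Im_in)
    fix j x assume j: "j \<in> F" and x: "lo j \<le> x" "x \<le> hi j"
    have "\<kappa> * len j / 32 \<le> U (of_real x)"
      using F(2) j \<kappa> nonneg low by (intro middle_lower_bound[OF _ x mvp_subset[OF U]]) auto
    moreover have "isCont U (of_real x)" using cont continuous_on_eq_continuous_at by blast
    ultimately show "isCont U (of_real x) \<and> \<kappa> * len j / 32 \<le> U (of_real x)" by blast
  qed (use F J0_D(2,3) nonneg \<kappa> in \<open>auto simp: subset_iff less_imp_le\<close>)
  moreover have "(len j / weight j)\<^sup>2 * (\<kappa> / (64 * pi)) \<le> \<kappa> * len j / 32 * hmeas (lo j) (hi j) \<i>"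
    if "j \<in> F" for j
  proof -
    have j: "j \<in> J0" using that F by blast
    have s1: "1 \<le> weight j" by (simp add: weight_def)
    have "len j / (2 * pi) * (1 / (weight j)\<^sup>2) \<le> len j / (2 * pi) * (1 / ((weight j - 1)\<^sup>2 + 1\<^sup>2))"
    proof (intro mult_left_mono divide_left_mono mult_pos_pos)
      have "(weight j - 1)\<^sup>2 + 1\<^sup>2 = (weight j)\<^sup>2 - 2 * (weight j - 1)" by (simp add: power2_eq_square algebra_simps)
      then show "(weight j - 1)\<^sup>2 + 1\<^sup>2 \<le> (weight j)\<^sup>2" using s1 by simp
    qed (use J0_D(2)[OF j] s1 in \<open>auto intro: add_nonneg_pos\<close>)
    also have "\<dots> \<le> hmeas (lo j) (hi j) \<i>"
      using hmeas_middle[OF j, of 1] by (simp add: imaginary_unit.code)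
    finally have "\<kappa> * len j / 32 * (len j / (2 * pi) * (1 / (weight j)\<^sup>2)) \<le> \<kappa> * len j / 32 * hmeas (lo j) (hi j) \<i>"
      using \<kappa> J0_D(2)[OF j] by (intro mult_left_mono) auto
    then show ?thesis by (simp add: power2_eq_square power_divide mult_ac)
  qed
  ultimately have "(\<Sum>j\<in>F. (len j / weight j)\<^sup>2 * (\<kappa> / (64 * pi))) \<le> U \<i>"
    by (meson order_trans sum_mono)
  then have "(\<Sum>j\<in>F. (len j / weight j)\<^sup>2) * (\<kappa> / (64 * pi)) \<le> U \<i>" by (simp only: sum_distrib_right)
  moreover have "X \<le> 64 * pi / \<kappa> * U \<i>" if "X * (\<kappa> / (64 * pi)) \<le> U \<i>" for X
    using that \<kappa> by (simp add: field_simps)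
  ultimately show ?thesis by blast
qed

text \<open>If the odd part \<open>k Im z\<close> were not zero, then \<open>u\<close> or its reflection would have the linear minorant
  \<open>\<bar>k\<bar> Im z\<close>, and the sum would be finite.\<close>

lemma P_infinity_sym_cone:
  assumes div: "(\<Sum>\<^sub>\<infinity>j\<in>J. ennreal ((len j / weight j)\<^sup>2)) = \<infinity>" and u: "u \<in> P_infinity \<Omega>"
  shows "(\<lambda>z. if z \<in> \<Omega> then u z else 0) \<in> sym_cone \<Omega>"
proof -
  define U where "U = (\<lambda>z. if z \<in> \<Omega> then u z else 0)"
  have um: "mvp \<Omega> u" and upos: "\<And>z. z \<in> \<Omega> \<Longrightarrow> 0 < u z"
    and u0: "\<And>\<zeta>. \<zeta> \<in> ext_compl \<Omega> - {None} \<Longrightarrow> (u \<longlongrightarrow> 0) (approach \<Omega> \<zeta>)"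
    using u harmonic_on_iff_mvp[OF op] by (auto simp: P_infinity_def)
  have Um: "mvp \<Omega> U" by (rule mvp_cong[OF op um]) (simp add: U_def)
  have U0: "0 \<le> U z" for z using upos[of z] by (simp add: U_def less_imp_le)
  have Uz: "U z = 0" if "z \<notin> \<Omega>" for z using that by (simp add: U_def)
  have cont: "continuous_on UNIV U"
  proof (rule continuous_at_imp_continuous_on, rule ballI)
    fix z :: complex
    show "isCont U z"
    proof (cases "z \<in> \<Omega>")
      case True
      then show ?thesis using mvp_continuous[OF Um] op continuous_on_eq_continuous_at by blast
    next
      case False
      then have "Some z \<in> ext_compl \<Omega> - {None}" by (auto simp: ext_compl_def)
      from u0[OF this] have lim: "(u \<longlongrightarrow> 0) (at z within \<Omega>)" by (simp add: approach_def)
      have "(U \<longlongrightarrow> 0) (at z)"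
      proof (rule tendstoI)
        fix e :: real assume e: "e > 0"
        from tendstoD[OF lim e] have "\<forall>\<^sub>F w in at z. w \<in> \<Omega> \<longrightarrow> dist (u w) 0 < e"
          unfolding eventually_at_filter by eventually_elim auto
        then show "\<forall>\<^sub>F w in at z. dist (U w) 0 < e" by eventually_elim (use e in \<open>auto simp: U_def\<close>)
      qed
      then show ?thesis using Uz[OF False] by (simp add: isCont_def)
    qed
  qed
  obtain k where k: "\<And>z. U z - U (cnj z) = k * Im z"
    using odd_part_linear[OF slit cont U0 Uz Um] by blast
  have contradiction: False
    if "continuous_on UNIV W" "\<And>z. 0 \<le> W z" "mvp \<Omega> W" "\<kappa> > 0" "\<And>z. Im z > 0 \<Longrightarrow> \<kappa> * Im z \<le> W z" for W \<kappa>
    using sum_bounded_imp_finite[OF linear_minorant_sum[OF that]] div by simp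
  have "k = 0"
  proof (rule ccontr)
    assume "k \<noteq> 0"
    then consider "k > 0" | "k < 0" by linarith
    then show False
    proof cases
      case 1
      show ?thesis
      proof (rule contradiction[OF cont U0 Um 1])
        show "k * Im z \<le> U z" for z using k[of z] U0[of "cnj z"] by simp
      qed
    next
      case 2
      show ?thesis
      proof (rule contradiction[of "\<lambda>z. U (cnj z)" "- k"])
        show "continuous_on UNIV (\<lambda>z. U (cnj z))"
          by (intro continuous_on_compose2[OF cont] continuous_intros) auto
        show "mvp \<Omega> (\<lambda>z. U (cnj z))" by (rule mvp_cnj[OF op slit_domain_cnj[OF slit] Um])
        show "- k * Im z \<le> U (cnj z)" for z using k[of z] U0[of z] by simp
      qed (use U0 2 in auto)
    qed
  qed
  then have "U (cnj z) = U z" for z using k[of z] by simp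
  then show ?thesis using cont U0 Uz Um unfolding U_def[symmetric] sym_cone_def by blast
qed

theorem dim_P_infinity:
  assumes div: "(\<Sum>\<^sub>\<infinity>j\<in>J. ennreal ((len j / weight j)\<^sup>2)) = \<infinity>"
  shows "dim_P_infinity_eq_1 \<Omega>"
  unfolding dim_P_infinity_eq_1_def
proof (intro conjI ballI)
  obtain V where V: "V \<in> sym_cone \<Omega>" "\<And>z. z \<in> \<Omega> \<Longrightarrow> 0 < V z"
    using sym_cone_exists[OF slit thick] by blast
  have "(V \<longlongrightarrow> 0) (approach \<Omega> \<zeta>)" if \<zeta>: "\<zeta> \<in> ext_compl \<Omega> - {None}" for \<zeta>
  proof -
    obtain a where a: "\<zeta> = Some a" "a \<notin> \<Omega>" using \<zeta> by (cases \<zeta>) (auto simp: ext_compl_def)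
    have "(V \<longlongrightarrow> V a) (at a)"
      using sym_coneD(1)[OF V(1)] continuous_on_eq_continuous_at[of UNIV V] by (simp add: isCont_def)
    then have "(V \<longlongrightarrow> 0) (at a)" using sym_coneD(4)[OF V(1) a(2)] by simp
    then have "(V \<longlongrightarrow> 0) (at a within \<Omega>)" by (rule tendsto_within_subset) simp
    then show ?thesis by (simp add: approach_def a(1))
  qed
  then have "V \<in> P_infinity \<Omega>"
    using V harmonic_on_iff_mvp[OF op] sym_coneD(5)[OF V(1)] by (simp add: P_infinity_def)
  then show "P_infinity \<Omega> \<noteq> {}" by blast
next
  fix u v assume u: "u \<in> P_infinity \<Omega>" and v: "v \<in> P_infinity \<Omega>"
  have "\<exists>k. \<forall>z. (if z \<in> \<Omega> then v z else 0) = k * (if z \<in> \<Omega> then u z else 0)"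
    by (rule sym_cone_proportional[OF slit P_infinity_sym_cone[OF div u] P_infinity_sym_cone[OF div v]])
       (use u in \<open>auto simp: P_infinity_def\<close>)
  then obtain k where k: "\<And>z. (if z \<in> \<Omega> then v z else 0) = k * (if z \<in> \<Omega> then u z else 0)" by blast
  have "v z = k * u z" if "z \<in> \<Omega>" for z using k[of z] that by simp
  then show "\<exists>k. \<forall>z\<in>\<Omega>. v z = k * u z" by blast
qed

end

section \<open>The Green function\<close>

text \<open>Up to a constant, \<open>2 ln \<bar>\<zeta> + 1\<bar> + ln \<bar>z - b\<bar>\<close> with \<open>\<zeta>\<^sup>2 = (z - a) / (z - b)\<close>, \<open>Re \<zeta> > 0\<close>,
  is the Green function of the complement of \<open>[a, b]\<close> with pole at infinity.\<close>

lemma log_majorant: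
  assumes op: "open \<Omega>" and ab: "a < b" and out: "\<And>x. a \<le> x \<Longrightarrow> x \<le> b \<Longrightarrow> of_real x \<notin> \<Omega>"
  obtains H where "mvp \<Omega> H" "\<And>z. z \<in> \<Omega> \<Longrightarrow> ln (max (1 / 2) (cmod (z - p))) \<le> H z"
proof -
  define w where "w = (\<lambda>z. csqrt ((z - of_real a) / (z - of_real b)))"
  have zb: "z \<noteq> of_real b" if "z \<in> \<Omega>" for z
    using out[of b] ab that by auto
  have slit: "(z - of_real a) / (z - of_real b) \<notin> \<real>\<^sub>\<le>\<^sub>0" if z: "z \<in> \<Omega>" for z
  proof
    assume "(z - of_real a) / (z - of_real b) \<in> \<real>\<^sub>\<le>\<^sub>0"
    then obtain t where t: "t \<le> 0" "(z - of_real a) / (z - of_real b) = of_real t"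
      by (auto simp: nonpos_Reals_def)
    then have "z - of_real a = of_real t * (z - of_real b)" using zb[OF z] by (simp add: field_simps)
    then have "z * of_real (1 - t) = of_real (a - t * b)" by (simp add: algebra_simps)
    then have zr: "z = of_real ((a - t * b) / (1 - t))" using t(1) by (simp add: field_simps)
    have "a \<le> (a - t * b) / (1 - t)" "(a - t * b) / (1 - t) \<le> b"
      using t(1) ab mult_left_mono_neg[of a b t] by (simp_all add: field_simps)
    then show False using out zr z by blast
  qed
  have Rew: "0 < Re (w z)" if "z \<in> \<Omega>" for z
  proof -
    have "w z \<notin> \<real>\<^sub>\<le>\<^sub>0" unfolding w_def by (rule csqrt_not_nonpos_Reals[OF slit[OF that]])
    moreover have "0 < Re (w z) \<or> Re (w z) = 0 \<and> 0 \<le> Im (w z)" unfolding w_def by (rule csqrt_principal)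
    moreover have "Re (w z) \<noteq> 0"
    proof
      assume r: "Re (w z) = 0"
      have "(w z)\<^sup>2 = (z - of_real a) / (z - of_real b)" by (simp add: w_def)
      moreover have "(w z)\<^sup>2 = of_real (- (Im (w z))\<^sup>2)"
        using r by (simp add: complex_eq_iff power2_eq_square)
      ultimately have "(z - of_real a) / (z - of_real b) = of_real (- (Im (w z))\<^sup>2)" by simp
      moreover have "(of_real (- (Im (w z))\<^sup>2) :: complex) \<in> \<real>\<^sub>\<le>\<^sub>0"
        by (subst nonpos_Reals_of_real_iff) simp
      ultimately show False using slit[OF that] by metis
    qed
    ultimately show ?thesis by blast
  qed
  define q where "q = (\<lambda>z. 2 * ln (cmod (w z + 1)) + ln (cmod (z - of_real b)))"
  have w1: "w z + 1 \<noteq> 0" "w z + 1 \<notin> \<real>\<^sub>\<le>\<^sub>0" if "z \<in> \<Omega>" for z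
    using Rew[OF that] by (auto simp: complex_eq_iff complex_nonpos_Reals_iff)
  have "(\<lambda>z. Ln (w z + 1)) holomorphic_on \<Omega>"
    unfolding w_def by (intro holomorphic_intros) (use zb slit w1(2) in \<open>auto simp: w_def\<close>)
  from mvp_Re_holomorphic[OF this op] have "mvp \<Omega> (\<lambda>z. ln (cmod (w z + 1)))"
    by (rule mvp_cong[OF op]) (use w1(1) in simp)
  moreover have "mvp \<Omega> (\<lambda>z. ln (cmod (z - of_real b)))"
    using zb by (intro mvp_subset[OF mvp_ln_cmod]) auto
  ultimately have qm: "mvp \<Omega> q" unfolding q_def by (intro mvp_add mvp_cmult op)
  define m where "m = (\<lambda>z. max (cmod (z - of_real a)) (cmod (z - of_real b)))"
  have mlow: "(b - a) / 2 \<le> m z" for z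
  proof -
    have "b - a = cmod ((z - of_real a) - (z - of_real b))" using ab by (simp flip: of_real_diff)
    also have "\<dots> \<le> cmod (z - of_real a) + cmod (z - of_real b)" by (rule norm_triangle_ineq4)
    finally show ?thesis by (simp add: m_def)
  qed
  have lnm: "ln (m z) \<le> q z" if z: "z \<in> \<Omega>" for z
  proof -
    have le1: "1 \<le> cmod (w z + 1)" using complex_Re_le_cmod[of "w z + 1"] Rew[OF z] by simp
    have lew: "cmod (w z) \<le> cmod (w z + 1)"
    proof -
      have "(cmod (w z))\<^sup>2 \<le> (cmod (w z + 1))\<^sup>2"
        using Rew[OF z] unfolding cmod_power2 by (simp add: power2_sum)
      then show ?thesis by (rule power2_le_imp_le) simp
    qed
    have w0: "0 < cmod (w z)" using Rew[OF z] by auto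
    have "(cmod (w z))\<^sup>2 = cmod (z - of_real a) / cmod (z - of_real b)"
      by (simp add: w_def norm_divide flip: norm_power)
    then have "cmod (z - of_real a) = (cmod (w z))\<^sup>2 * cmod (z - of_real b)"
      using zb[OF z] by simp
    then have "ln (cmod (z - of_real a)) = 2 * ln (cmod (w z)) + ln (cmod (z - of_real b))"
      using w0 zb[OF z] by (simp add: ln_mult ln_realpow)
    moreover have "ln (cmod (w z)) \<le> ln (cmod (w z + 1))" using lew w0 by (intro ln_mono) auto
    ultimately have "ln (cmod (z - of_real a)) \<le> q z" by (simp add: q_def)
    moreover have "ln (cmod (z - of_real b)) \<le> q z" using le1 by (simp add: q_def)
    ultimately show ?thesis by (simp add: m_def max_def)
  qed
  define K where "K = 1 + 2 * cmod (of_real b - p) / (b - a) + 1 / (b - a)"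
  have K: "K > 0" using ab by (simp add: K_def add_pos_nonneg)
  have bound: "max (1 / 2) (cmod (z - p)) \<le> K * m z" for z
  proof -
    have m0: "0 \<le> m z" by (simp add: m_def le_max_iff_disj)
    have 1: "1 \<le> 2 * m z / (b - a)" using mlow[of z] ab by (simp add: field_simps)
    have Km: "K * m z = m z + cmod (of_real b - p) * (2 * m z / (b - a)) + 1 / 2 * (2 * m z / (b - a))"
      by (simp add: K_def algebra_simps)
    have c: "cmod (of_real b - p) * 1 \<le> cmod (of_real b - p) * (2 * m z / (b - a))"
      by (intro mult_left_mono 1) simp
    have "cmod (z - p) \<le> cmod (z - of_real b) + cmod (of_real b - p)"
      using norm_triangle_ineq[of "z - of_real b" "of_real b - p"] by simp
    moreover have "cmod (z - of_real b) \<le> m z" by (simp add: m_def)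
    ultimately show ?thesis unfolding Km using 1 c m0 norm_ge_zero[of "of_real b - p"]
      by (intro max.boundedI) linarith+
  qed
  show thesis
  proof (rule that[of "\<lambda>z. q z + ln K"])
    show "mvp \<Omega> (\<lambda>z. q z + ln K)" by (intro mvp_add op qm mvp_const)
    fix z assume z: "z \<in> \<Omega>"
    have mpos: "m z > 0" using mlow[of z] ab by (smt (verit) half_gt_zero)
    have "ln (max (1 / 2) (cmod (z - p))) \<le> ln (K * m z)"
      using bound[of z] by (intro ln_mono) (auto simp: less_max_iff_disj)
    also have "\<dots> = ln K + ln (m z)" using K mpos by (simp add: ln_mult)
    finally show "ln (max (1 / 2) (cmod (z - p))) \<le> q z + ln K" using lnm[OF z] by simp
  qed
qed

text \<open>The Green function is the least harmonic majorant of the subharmonic function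
  \<open>ln \<bar>t - p\<bar>\<close>, minus this function.  Truncating the logarithm near the pole changes no
  harmonic majorant.\<close>

theorem green_function_exists:
  assumes op: "open \<Omega>" and ab: "a < b" and out: "\<And>x. a \<le> x \<Longrightarrow> x \<le> b \<Longrightarrow> of_real x \<notin> \<Omega>"
    and p: "cball p (1 / 2) \<subseteq> \<Omega>"
  obtains h where "mvp \<Omega> h" "is_green_function \<Omega> p (\<lambda>t. h t - ln (cmod (t - p)))"
proof -
  define \<psi> where "\<psi> = (\<lambda>z. ln (max (1 / 2) (cmod (z - p))))"
  have c\<psi>: "continuous_on UNIV \<psi>"
    unfolding \<psi>_def by (intro continuous_intros) (auto simp: max_def split: if_splits)
  have s\<psi>: "submean \<psi> z" for z
  proof (cases "z \<in> ball p (1 / 2)")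
    case True
    show ?thesis
    proof (rule submean_cong[OF open_ball True])
      show "submean (\<lambda>_. ln (1 / 2)) z" by (intro mean_at_submean mean_at_const)
      show "ln (1 / 2) = \<psi> w" if "w \<in> ball p (1 / 2)" for w
        using that by (simp add: \<psi>_def dist_norm norm_minus_commute max_def)
    qed
  next
    case False
    then have z: "z \<in> - {p}" by auto
    show ?thesis
    proof (rule submean_cong[OF _ z])
      show "submean (\<lambda>w. max (ln (1 / 2)) (ln (cmod (w - p)))) z"
        by (rule submean_max[OF _ z])
           (use z mvp_continuous[OF mvp_ln_cmod[of p]] mvp_submean[OF mvp_ln_cmod z] in
             \<open>auto intro: mean_at_submean\<close>)
      show "max (ln (1 / 2)) (ln (cmod (w - p))) = \<psi> w" if "w \<in> - {p}" for w
        using that by (auto simp: \<psi>_def max_def)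
    qed auto
  qed
  obtain H0 where H0: "mvp \<Omega> H0" "\<And>z. z \<in> \<Omega> \<Longrightarrow> \<psi> z \<le> H0 z"
    using log_majorant[OF op ab out, of p] unfolding \<psi>_def by blast
  have p\<Omega>: "p \<in> \<Omega>" using p by auto
  then have ne: "\<Omega> \<noteq> {}" by blast
  obtain h where hm: "mvp \<Omega> h" and h: "\<And>z. z \<in> \<Omega> \<Longrightarrow> \<psi> z \<le> h z"
      "\<forall>H. mvp \<Omega> H \<longrightarrow> (\<forall>z\<in>\<Omega>. \<psi> z \<le> H z) \<longrightarrow> (\<forall>z\<in>\<Omega>. h z \<le> H z)"
    by (rule least_harmonic_majorant[OF op ne c\<psi> s\<psi> H0(1)], erule H0(2)) (rule that)
  have \<psi>ge: "ln (cmod (z - p)) \<le> \<psi> z" if "z \<noteq> p" for z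
    unfolding \<psi>_def using that by (intro ln_mono) auto
  show thesis
  proof (rule that[OF hm], unfold is_green_function_def, intro conjI allI impI ballI)
    show "green_candidate \<Omega> p (\<lambda>t. h t - ln (cmod (t - p)))"
      unfolding green_candidate_def
    proof (intro conjI ballI exI[of _ h])
      show "harmonic_on \<Omega> h" using hm harmonic_on_iff_mvp[OF op] by blast
      show "0 \<le> h t - ln (cmod (t - p))" if "t \<in> \<Omega> - {p}" for t
        using h(1)[of t] \<psi>ge[of t] that by simp
    qed simp
  next
    fix u t assume u: "green_candidate \<Omega> p u" and t: "t \<in> \<Omega> - {p}"
    obtain hu where hu: "harmonic_on \<Omega> hu" "\<And>t. t \<in> \<Omega> - {p} \<Longrightarrow> u t = hu t - ln (cmod (t - p))"
      and u0: "\<And>t. t \<in> \<Omega> - {p} \<Longrightarrow> 0 \<le> u t"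
      using u unfolding green_candidate_def by blast
    have hum: "mvp \<Omega> hu" using hu(1) harmonic_on_iff_mvp[OF op] by blast
    have far: "\<psi> z \<le> hu z" if "z \<in> \<Omega>" "z \<notin> ball p (1 / 2)" for z
    proof -
      have zp: "z \<in> \<Omega> - {p}" using that by auto
      have "\<psi> z = ln (cmod (z - p))" using that by (simp add: \<psi>_def dist_norm norm_minus_commute max_def)
      then show ?thesis using u0[OF zp] hu(2)[OF zp] by simp
    qed
    have near: "\<psi> z \<le> hu z" if z: "z \<in> ball p (1 / 2)" for z
    proof -
      have "ln (1 / 2) - hu z \<le> 0"
      proof (rule max_principle_compact[of "cball p (1 / 2)" "\<lambda>z. ln (1 / 2) - hu z"])
        show "continuous_on (cball p (1 / 2)) (\<lambda>z. ln (1 / 2) - hu z)"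
          using continuous_on_subset[OF mvp_continuous[OF hum] p] by (intro continuous_intros)
        fix v assume v: "v \<in> cball p (1 / 2)" "ln (1 / 2) - hu v > 0"
        have "v \<in> ball p (1 / 2)"
        proof (rule ccontr)
          assume nb: "v \<notin> ball p (1 / 2)"
          then have "cmod (v - p) = 1 / 2" using v(1) by (simp add: dist_norm norm_minus_commute)
          then have "\<psi> v = ln (1 / 2)" by (simp add: \<psi>_def)
          then show False using far[OF _ nb] v p by auto
        qed
        moreover have "submean (\<lambda>z. ln (1 / 2) - hu z) v"
          using v(1) p by (intro mvp_submean[OF mvp_diff[OF op mvp_const hum]]) auto
        ultimately show "v \<in> interior (cball p (1 / 2)) \<and> submean (\<lambda>z. ln (1 / 2) - hu z) v" by simp
      qed (use z in auto)
      moreover have "\<psi> z = ln (1 / 2)" using z by (simp add: \<psi>_def dist_norm norm_minus_commute max_def)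
      ultimately show ?thesis by simp
    qed
    have "h t \<le> hu t" using h(2) hum far near t by blast
    then show "h t - ln (cmod (t - p)) \<le> u t" using hu(2)[OF t] by simp
  qed
qed

context gap_domain
begin

text \<open>The right-hand side is the Green function of the upper half-plane with pole \<open>\<i>\<close>.\<close>

lemma ln_half_plane_green:
  assumes z: "Im z > 0" "z \<noteq> \<i>"
  shows "2 * Im z / (cmod z + 1)\<^sup>2 \<le> ln (cmod (z + \<i>)) - ln (cmod (z - \<i>))"
proof -
  have pos: "cmod (z - \<i>) > 0" "cmod (z + \<i>) > 0" using z by (auto simp: complex_eq_iff)
  define x where "x = (cmod (z - \<i>))\<^sup>2 / (cmod (z + \<i>))\<^sup>2"
  have x: "x > 0" using pos by (simp add: x_def)
  have "(cmod (z + \<i>))\<^sup>2 = (cmod (z - \<i>))\<^sup>2 + 4 * Im z"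
    unfolding cmod_power2 by (simp add: power2_eq_square algebra_simps)
  moreover have "1 - x = ((cmod (z + \<i>))\<^sup>2 - (cmod (z - \<i>))\<^sup>2) / (cmod (z + \<i>))\<^sup>2"
    using pos by (simp add: x_def diff_divide_distrib)
  ultimately have "1 - x = 4 * Im z / (cmod (z + \<i>))\<^sup>2" by simp
  moreover have "4 * Im z / (cmod z + 1)\<^sup>2 \<le> 4 * Im z / (cmod (z + \<i>))\<^sup>2"
    using norm_triangle_ineq[of z \<i>] pos z
    by (intro divide_left_mono power_mono mult_pos_pos zero_less_power) (auto intro: add_nonneg_pos)
  moreover have "ln x \<le> x - 1" using x by (rule ln_le_minus_one)
  moreover have "ln x = 2 * (ln (cmod (z - \<i>)) - ln (cmod (z + \<i>)))"
    unfolding x_def using pos by (simp add: ln_div ln_realpow)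
  ultimately show ?thesis by simp
qed

text \<open>\<open>h - ln \<bar>z + \<i>\<bar>\<close> is the difference of the two Green functions and has no pole.\<close>

lemma green_lower:
  assumes h: "mvp \<Omega> h" and nonneg: "\<And>t. t \<in> \<Omega> - {\<i>} \<Longrightarrow> 0 \<le> h t - ln (cmod (t - \<i>))"
    and z: "Im z > 0"
  shows "ln (cmod (z + \<i>)) \<le> h z"
proof -
  define W where "W = (\<lambda>z. ln (cmod (z - (- \<i>))) - h z)"
  have Wm: "mvp {z. Im z > 0} W"
    unfolding W_def
    by (intro mvp_diff open_upper mvp_subset[OF mvp_ln_cmod] mvp_subset[OF h]) (auto intro: Im_in)
  have Wle: "W w \<le> ln (cmod (w + \<i>)) - ln (cmod (w - \<i>))" if "Im w > 0" "w \<noteq> \<i>" for w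
    using nonneg[of w] Im_in[of w] that by (simp add: W_def)
  have "W z \<le> 0"
  proof (rule max_principle_frontier[OF open_upper mvp_continuous[OF Wm]])
    show "submean W w" if "w \<in> {z. Im z > 0}" for w using mvp_submean[OF Wm that] .
    show "z \<in> {z. Im z > 0}" using z by simp
    show "\<exists>R. \<forall>w\<in>{z. Im z > 0}. R < cmod w \<longrightarrow> W w < e" if e: "e > 0" for e
    proof (intro exI[of _ "2 + 2 / e"] ballI impI)
      fix w assume w: "w \<in> {z. Im z > 0}" "2 + 2 / e < cmod w"
      have "0 < 2 / e" using e by simp
      then have w2: "2 < cmod w" using w(2) by linarith
      have wi: "w \<noteq> \<i>" using w2 by auto
      have n: "cmod w - 1 \<le> cmod (w - \<i>)" using norm_triangle_ineq2[of w \<i>] by simp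
      have n2: "cmod (w + \<i>) \<le> cmod (w - \<i>) + 2"
        using norm_triangle_ineq[of "w - \<i>" "2 * \<i>"] by (simp add: add.commute)
      have "w + \<i> \<noteq> 0" using w(1) by (auto simp: complex_eq_iff)
      then have pos: "0 < cmod (w - \<i>)" "0 < cmod (w + \<i>)" using wi by simp_all
      have "W w \<le> ln (cmod (w + \<i>)) - ln (cmod (w - \<i>))" using Wle w(1) wi by simp
      also have "\<dots> = ln (cmod (w + \<i>) / cmod (w - \<i>))" using pos by (simp add: ln_div)
      also have "\<dots> \<le> cmod (w + \<i>) / cmod (w - \<i>) - 1" using pos by (intro ln_le_minus_one) simp
      also have "\<dots> \<le> 2 / cmod (w - \<i>)"
      proof -
        have "cmod (w + \<i>) / cmod (w - \<i>) \<le> (cmod (w - \<i>) + 2) / cmod (w - \<i>)"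
          using n2 by (intro divide_right_mono) auto
        also have "\<dots> = 1 + 2 / cmod (w - \<i>)" using pos(1) by (simp add: add_divide_distrib)
        finally show ?thesis by simp
      qed
      also have "\<dots> \<le> 2 / (cmod w - 1)" using n w2 by (intro divide_left_mono mult_pos_pos) auto
      also have "\<dots> < e"
      proof -
        have "2 / e < cmod w - 1" using w(2) by simp
        then show ?thesis using e w2 by (simp add: field_simps)
      qed
      finally show "W w < e" .
    qed
    show "\<forall>\<^sub>F w in at x within {z. Im z > 0}. W w < e" if x: "x \<notin> {z. Im z > 0}" and e: "e > 0" for x e
    proof (cases "Im x < 0")
      case True
      have "open {z. Im z < 0}" by (simp add: open_halfspace_Im_lt)
      then have "\<forall>\<^sub>F w in at x. w \<in> {z. Im z < 0}" using True by (intro eventually_at_in_open') auto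
      then show ?thesis unfolding eventually_at_filter by eventually_elim auto
    next
      case False
      then have x0: "Im x = 0" using x by simp
      have xi: "x + \<i> \<noteq> 0" "x - \<i> \<noteq> 0" using x0 by (auto simp: complex_eq_iff)
      have eq: "cmod (x + \<i>) = cmod (x - \<i>)" using x0 by (simp add: cmod_def)
      have "((\<lambda>w. ln (cmod (w + \<i>)) - ln (cmod (w - \<i>))) \<longlongrightarrow> ln (cmod (x + \<i>)) - ln (cmod (x - \<i>)))
          (at x within {z. Im z > 0})"
        using xi by (intro tendsto_intros) auto
      moreover have "ln (cmod (x + \<i>)) - ln (cmod (x - \<i>)) < e" using eq e by simp
      ultimately have 1: "\<forall>\<^sub>F w in at x within {z. Im z > 0}. ln (cmod (w + \<i>)) - ln (cmod (w - \<i>)) < e"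
        by (rule order_tendstoD(2))
      have "\<forall>\<^sub>F w in at x. w \<in> - {\<i>}" using xi by (intro eventually_at_in_open') auto
      then have 2: "\<forall>\<^sub>F w in at x within {z. Im z > 0}. w \<noteq> \<i>"
        unfolding eventually_at_filter by eventually_elim auto
      have 3: "\<forall>\<^sub>F w in at x within {z. Im z > 0}. Im w > 0"
        unfolding eventually_at_filter by auto
      show ?thesis using 1 2 3 by eventually_elim (use Wle in fastforce)
    qed
  qed
  then show ?thesis by (simp add: W_def)
qed

lemma green_pole:
  assumes h: "mvp \<Omega> h"
  shows "filterlim (\<lambda>t. h t - ln (cmod (t - \<i>))) at_top (at \<i>)"
proof -
  have "isCont h \<i>" using mvp_continuous[OF h] op i_in continuous_on_eq_continuous_at by blast
  then have "(h \<longlongrightarrow> h \<i>) (at \<i>)" by (simp add: isCont_def)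
  moreover have "filterlim (\<lambda>t. - ln (cmod (t - \<i>))) at_top (at \<i>)"
  proof -
    have "((\<lambda>t. cmod (t - \<i>)) \<longlongrightarrow> cmod (\<i> - \<i>)) (at \<i>)" by (intro tendsto_intros)
    then have "filterlim (\<lambda>t. cmod (t - \<i>)) (at_right 0) (at \<i>)"
      unfolding filterlim_at by (auto simp: eventually_at_filter)
    from filterlim_compose[OF ln_at_0 this]
    show ?thesis by (simp add: filterlim_uminus_at_top)
  qed
  ultimately have "filterlim (\<lambda>t. h t + - ln (cmod (t - \<i>))) at_top (at \<i>)"
    by (rule filterlim_tendsto_add_at_top)
  then show ?thesis by simp
qed

text \<open>Were \<open>g\<close> bounded by \<open>C / \<bar>t\<bar>\<close> near infinity, then \<open>y g(iy)\<close> would be bounded, and so would be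
  the integral of \<open>g\<close> over the gaps; but \<open>g\<close> is at least a multiple of \<open>len j / (weight j)\<^sup>2\<close> in the
  middle of a gap.\<close>

lemma green_decay_sum:
  assumes h: "mvp \<Omega> h" and nonneg: "\<And>t. t \<in> \<Omega> - {\<i>} \<Longrightarrow> 0 \<le> h t - ln (cmod (t - \<i>))"
    and decay: "\<And>t. t \<in> \<Omega> \<Longrightarrow> R \<le> cmod t \<Longrightarrow> (h t - ln (cmod (t - \<i>))) * cmod t \<le> C"
    and F: "finite F" "F \<subseteq> J0"
  shows "(\<Sum>j\<in>F. (len j / weight j)\<^sup>2) \<le> 64 * pi * C"
proof -
  define g where "g = (\<lambda>t. h t - ln (cmod (t - \<i>)))"
  have gm: "mvp (\<Omega> - {\<i>}) g"
    unfolding g_def using op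
    by (intro mvp_diff open_Diff mvp_subset[OF h] mvp_subset[OF mvp_ln_cmod]) auto
  define lam where "lam = (\<lambda>j. 2 / (weight j)\<^sup>2 * len j / 32)"
  define y where "y = \<bar>R\<bar> + (\<Sum>j\<in>F. weight j) + 2"
  have s1: "1 \<le> weight j" for j by (simp add: weight_def)
  have sum0: "0 \<le> (\<Sum>j\<in>F. weight j)" using s1 by (intro sum_nonneg) (smt (verit))
  have y: "y \<ge> 2" "y \<ge> R" using sum0 by (auto simp: y_def)
  have ys: "weight j - 1 \<le> y" if "j \<in> F" for j
    using member_le_sum[of j F weight] F(1) that s1 by (auto simp: y_def intro: order_trans) (smt (verit))
  have "(\<Sum>j\<in>F. lam j * hmeas (lo j) (hi j) (Complex 0 y)) \<le> g (Complex 0 y)"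
  proof (rule step_function_minorant[where P = "{\<i>}"])
    show "x < lo j \<or> hi j < x" if "i \<in> F" "j \<in> F" "i \<noteq> j" "lo i \<le> x" "x \<le> hi i" for i j x
      using middle_disjoint[of i j x] that F(2) by blast
    show "mvp ({z. 0 < Im z} - {\<i>}) g" by (rule mvp_subset[OF gm]) (auto intro: Im_in)
    show "0 \<le> g w" if "0 < Im w" "w \<notin> {\<i>}" for w
      using nonneg[of w] Im_in[of w] that by (simp add: g_def)
    show "filterlim g at_top (at p)" if "p \<in> {\<i>}" for p
      using green_pole[OF h] that by (simp add: g_def)
    fix j x assume j: "j \<in> F" and x: "lo j \<le> x" "x \<le> hi j"
    have jJ: "j \<in> J0" using j F by blast
    have "2 / (weight j)\<^sup>2 * len j / 32 \<le> g (of_real x)"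
    proof (rule middle_lower_bound[OF jJ x gm])
      show "0 \<le> g z" if "z \<in> \<Omega> - {\<i>}" for z using nonneg[OF that] by (simp add: g_def)
      fix z assume z: "z \<in> \<Omega> - {\<i>}" "0 < Im z" "cmod z + 1 \<le> weight j"
      have "2 / (weight j)\<^sup>2 * Im z \<le> 2 * Im z / (cmod z + 1)\<^sup>2"
      proof -
        have "2 * Im z / (weight j)\<^sup>2 \<le> 2 * Im z / (cmod z + 1)\<^sup>2"
          using z s1[of j] by (intro divide_left_mono power_mono mult_pos_pos zero_less_power)
            (auto intro: add_nonneg_pos)
        then show ?thesis by simp
      qed
      also have "\<dots> \<le> ln (cmod (z + \<i>)) - ln (cmod (z - \<i>))"
        using z by (intro ln_half_plane_green) auto
      also have "\<dots> \<le> g z" using green_lower[OF h nonneg z(2)] by (simp add: g_def)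
      finally show "2 / (weight j)\<^sup>2 * Im z \<le> g z" .
    qed simp
    moreover have "isCont g (of_real x)"
    proof -
      have "of_real x \<in> cball (of_real x :: complex) (len j / 8)" using J0_D(2)[OF jJ] by simp
      from gap_disc(1,3)[OF jJ x this] have "of_real x \<in> \<Omega> - {\<i>}" by blast
      moreover have "open (\<Omega> - {\<i>})" using op by (simp add: open_delete)
      ultimately show ?thesis
        using mvp_continuous[OF gm] continuous_on_eq_continuous_at by blast
    qed
    ultimately show "isCont g (of_real x) \<and> lam j \<le> g (of_real x)" by (simp add: lam_def)
  qed (use F J0_D(2,3) y in \<open>auto simp: lam_def subset_iff less_imp_le complex_eq_iff\<close>)
  then have "y * (\<Sum>j\<in>F. lam j * hmeas (lo j) (hi j) (Complex 0 y)) \<le> y * g (Complex 0 y)"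
    using y by (intro mult_left_mono) auto
  also have "\<dots> \<le> C"
  proof -
    have "cmod (Complex 0 y) = y" using y by (simp add: cmod_def)
    then show ?thesis
      using decay[of "Complex 0 y"] Im_in[of "Complex 0 y"] y by (simp add: g_def mult.commute)
  qed
  finally have le: "(\<Sum>j\<in>F. y * (lam j * hmeas (lo j) (hi j) (Complex 0 y))) \<le> C"
    by (simp add: sum_distrib_left)
  have "(len j / weight j)\<^sup>2 * (1 / (64 * pi)) \<le> y * (lam j * hmeas (lo j) (hi j) (Complex 0 y))"
    if jF: "j \<in> F" for j
  proof -
    have j: "j \<in> J0" using jF F by blast
    have l0: "0 \<le> lam j" using J0_D(2)[OF j] by (simp add: lam_def)
    have "1 / 2 \<le> y\<^sup>2 / ((weight j - 1)\<^sup>2 + y\<^sup>2)"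
    proof -
      have "(weight j - 1)\<^sup>2 \<le> y\<^sup>2" using ys[OF jF] s1[of j] by (intro power_mono) auto
      moreover have "0 < y\<^sup>2" using y by simp
      ultimately show ?thesis by (subst pos_le_divide_eq) (auto intro: add_nonneg_pos)
    qed
    then have "len j / (2 * pi) * (1 / 2) \<le> len j / (2 * pi) * (y\<^sup>2 / ((weight j - 1)\<^sup>2 + y\<^sup>2))"
      using J0_D(2)[OF j] by (intro mult_left_mono) auto
    also have "\<dots> = y * (len j / (2 * pi) * (y / ((weight j - 1)\<^sup>2 + y\<^sup>2)))"
      by (simp add: power2_eq_square)
    also have "\<dots> \<le> y * hmeas (lo j) (hi j) (Complex 0 y)"
      using y by (intro mult_left_mono hmeas_middle[OF j]) auto
    finally have "lam j * (len j / (2 * pi) * (1 / 2)) \<le> lam j * (y * hmeas (lo j) (hi j) (Complex 0 y))"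
      using l0 by (intro mult_left_mono)
    moreover have "lam j * (len j / (2 * pi) * (1 / 2)) = (len j / weight j)\<^sup>2 * (1 / (64 * pi))"
      by (simp add: lam_def power2_eq_square power_divide)
    ultimately show ?thesis by (simp add: mult_ac)
  qed
  then have "(\<Sum>j\<in>F. (len j / weight j)\<^sup>2 * (1 / (64 * pi))) \<le> C"
    using le by (meson order_trans sum_mono)
  then have "(\<Sum>j\<in>F. (len j / weight j)\<^sup>2) * (1 / (64 * pi)) \<le> C" by (simp only: sum_distrib_right)
  then show ?thesis by (simp add: field_simps)
qed

theorem green_limsup:
  assumes div: "(\<Sum>\<^sub>\<infinity>j\<in>J. ennreal ((len j / weight j)\<^sup>2)) = \<infinity>"
  shows "\<exists>z\<in>\<Omega>. \<exists>g. is_green_function \<Omega> z g \<and>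
    Limsup (approach \<Omega> None) (\<lambda>t. ereal (g t * cmod t)) = \<infinity>"
proof -
  obtain a b where ab: "a < b" "\<And>x. a \<le> x \<Longrightarrow> x \<le> b \<Longrightarrow> of_real x \<notin> \<Omega>"
    using slit_interval by blast
  have "cball \<i> (1 / 2) \<subseteq> \<Omega>"
  proof
    fix z assume "z \<in> cball \<i> (1 / 2)"
    then have "\<bar>1 - Im z\<bar> \<le> 1 / 2" using abs_Im_le_cmod[of "\<i> - z"] by (simp add: dist_norm)
    then show "z \<in> \<Omega>" by (intro Im_in) auto
  qed
  then obtain h where h: "mvp \<Omega> h" "is_green_function \<Omega> \<i> (\<lambda>t. h t - ln (cmod (t - \<i>)))"
    using green_function_exists[OF op ab] by blast
  define g where "g = (\<lambda>t. h t - ln (cmod (t - \<i>)))"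
  have nonneg: "0 \<le> h t - ln (cmod (t - \<i>))" if "t \<in> \<Omega> - {\<i>}" for t
    using h(2) that unfolding is_green_function_def green_candidate_def by blast
  have "Limsup (approach \<Omega> None) (\<lambda>t. ereal (g t * cmod t)) = \<infinity>"
  proof (rule ccontr)
    assume "Limsup (approach \<Omega> None) (\<lambda>t. ereal (g t * cmod t)) \<noteq> \<infinity>"
    then obtain C where "Limsup (approach \<Omega> None) (\<lambda>t. ereal (g t * cmod t)) < ereal C"
      using less_PInf_Ex_of_nat[of "Limsup (approach \<Omega> None) (\<lambda>t. ereal (g t * cmod t))"] by auto
    from Limsup_lessD[OF this] have "\<forall>\<^sub>F t in inf at_infinity (principal \<Omega>). g t * cmod t < C"
      by (simp add: approach_def)
    then have "\<forall>\<^sub>F t in at_infinity. t \<in> \<Omega> \<longrightarrow> g t * cmod t < C"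
      by (simp add: eventually_inf_principal)
    then obtain R where "\<And>t. R \<le> cmod t \<Longrightarrow> t \<in> \<Omega> \<Longrightarrow> g t * cmod t < C"
      unfolding eventually_at_infinity by blast
    then have "(h t - ln (cmod (t - \<i>))) * cmod t \<le> C" if "t \<in> \<Omega>" "R \<le> cmod t" for t
      using that unfolding g_def by (meson less_imp_le)
    from sum_bounded_imp_finite[OF green_decay_sum[OF h(1) nonneg this]] show False using div by simp
  qed
  then show ?thesis using h(2) i_in unfolding g_def by blast
qed

end

lemma index_range_convex:
  assumes "i \<in> index_range N M" "k \<in> index_range N M" "i \<le> j" "j \<le> k"
  shows "j \<in> index_range N M"
proof -
  have "enat (nat (- j)) \<le> enat (nat (- i))" "enat (nat j) \<le> enat (nat k)" using assms by auto
  moreover have "enat (nat (- i)) \<le> N" "enat (nat k) \<le> M" using assms(1,2) by (simp_all add: index_range_def)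
  ultimately have "enat (nat (- j)) \<le> N" "enat (nat j) \<le> M" by (blast intro: order_trans)+
  then show ?thesis by (simp add: index_range_def)
qed

theorem mainTheorem4:
  fixes \<Omega> :: "complex set" and E :: "complex option set"
    and M N :: enat and c d :: "int \<Rightarrow> real"
  assumes "denjoy_domain \<Omega>"
    and "E = ext_compl \<Omega>"
    and "\<forall>\<zeta>\<in>E. regular_boundary_point \<Omega> \<zeta>"
    and "M + N = \<infinity>"
    and "{x::real. Some (complex_of_real x) \<notin> E} = (\<Union>j\<in>index_range N M. {c j<..<d j})"
    and "\<forall>j\<in>index_range N M. c j < d j"
    and "\<forall>j\<in>index_range N M. j + 1 \<in> index_range N M \<longrightarrow> d j < c (j + 1)"
    and "(\<Sum>\<^sub>\<infinity>j\<in>index_range N M. ennreal (((d j - c j) / (\<bar>c j + d j\<bar> + 1))\<^sup>2)) = \<infinity>"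
  shows "dim_P_infinity_eq_1 \<Omega> \<and>
    (\<exists>z\<in>\<Omega>. \<exists>g. is_green_function \<Omega> z g \<and>
       Limsup (approach \<Omega> None) (\<lambda>t. ereal (g t * cmod t)) = \<infinity>)"
proof -
  let ?J = "index_range N M"
  have E: "Some z \<in> E \<longleftrightarrow> z \<notin> \<Omega>" for z using assms(2) by (auto simp: ext_compl_def)
  interpret gap_domain \<Omega> ?J c d
  proof
    show "slit_domain \<Omega>"
      unfolding slit_domain_def
    proof (intro conjI allI impI)
      show "open \<Omega>" using assms(1) by (simp add: denjoy_domain_def)
      fix z assume "Im z \<noteq> 0"
      then have "Some z \<notin> insert None (Some ` \<real>)" by (auto simp: complex_is_Real_iff)
      then show "z \<in> \<Omega>" using assms(1,2) E[of z] unfolding denjoy_domain_def by blast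
    qed
    show "of_real x \<in> \<Omega> \<longleftrightarrow> (\<exists>j\<in>?J. c j < x \<and> x < d j)" for x
    proof -
      have "of_real x \<in> \<Omega> \<longleftrightarrow> x \<in> {x. Some (complex_of_real x) \<notin> E}" by (simp add: E)
      then show ?thesis unfolding assms(5) by simp
    qed
    show cd: "c j < d j" if "j \<in> ?J" for j using assms(6) that by blast
    show "0 \<in> ?J" by (simp add: index_range_def zero_enat_def[symmetric])
    show "d i < c j" if "i \<in> ?J" "j \<in> ?J" "i < j" for i j
    proof -
      have "i + 1 \<le> j" using that by simp
      then show ?thesis using that(2)
      proof (induction j rule: int_ge_induct)
        case base
        then show ?case using assms(7) that(1) by blast
      next
        case (step k)
        have k: "k \<in> ?J" using index_range_convex[OF that(1) step.prems] step.hyps by simp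
        then show ?case using step.IH[OF k] cd[OF k] assms(7) step.prems by fastforce
      qed
    qed
  qed (use index_range_convex in blast)
  have "(\<Sum>\<^sub>\<infinity>j\<in>?J. ennreal ((len j / weight j)\<^sup>2)) = \<infinity>"
    using assms(8) by (simp add: len_def weight_def)
  then show ?thesis using dim_P_infinity green_limsup by blast
qed

end
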